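(* Suppose the feasibility assumption and the local assumption stated in the context hold, and that the two-stage decomposition algorithm with extrapolation steps described in the context encounters an iterate $w^l$ sufficiently close to $w^*$ in Step 3 for a sufficiently small value of $\mu^l$. Then the algorithm will remain in the while-loop (Step 4) and $w^l$ converges to $w^*$ at a superlinear rate.
   Context: Two-stage problem with one subproblem ($N=1$), objective smoothing: first stage (master problem) $\min_x f_0(x)+\hat f_1(x)$ s.t. $c_0(x)\le0$, $x\in\mathbb{R}^{n_0}$; second stage (subproblem) $\hat f_1(x)=\min_{y_1\in\mathbb{R}^{n_1}}f_1(y_1;x)$ s.t. $c_1(y_1;x)\le0$. The undecomposed problem is $$\min_{x,y_1}f_0(x)+f_1(y_1;x)\quad\text{s.t.}\quad c_0(x)\le0,\ c_1(y_1;x)\le0.$$ For $\mu>0$ the smoothed subproblem is $\hat f_1(x;\mu)=\min_{y_1,s_1,\tilde x_1}f_1(y_1;\tilde x_1)-\mu\sum_j\ln(s_{1j})$ s.t. $c_1(y_1;\tilde x_1)+s_1=0$ $[\lambda_1]$, $\tilde x_1-x=0$ $[\eta_1]$ (multipliers in brackets), and the smoothed master problem is $\min_xf_0(x)+\hat f_1(x;\mu)$ s.t. $c_0(x)\le0$. Hessians are assumed computable; the master solver is a second-order SQP method using the exact Hessian, and the subproblem solver is a Newton-based interior-point method (line-search Newton iterations on $F_1=0$, with $F_1$ below). Let $z=(x,y_1,\tilde x_1,s_1)$, $\varphi(z;\mu)=f_0(x)+f_1(y_1;\tilde x_1)-\mu\sum_j\ln(s_{1j})$, $\tilde c_1(z)=(c_1(y_1;\tilde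 x_1)+s_1,\tilde x_1-x)$, $u=(x,\lambda_0,s_0)$, $v_1=(y_1,\tilde x_1,s_1,\lambda_1,\eta_1)$, $w=(u,v_1)$, where $\lambda_0$ and $s_0$ are multipliers and slacks for $c_0(x)\le0$, and $\mathcal{L}(w)=f_0(x)+f_1(y_1;\tilde x_1)+c_0(x)^T\lambda_0+\tilde c_1(z)^T(\lambda_1^T,\eta_1^T)^T$. Define $$F_1(w;\mu)=\big(\nabla_{y_1}\mathcal{L},\ \nabla_{\tilde x_1}\mathcal{L},\ s_1\circ\lambda_1-\mu e,\ c_1(y_1;\tilde x_1)+s_1,\ \tilde x_1-x\big),$$ $$F^C(w;\mu)=\big(\nabla_x\mathcal{L}(w),\ c_0(x)+s_0,\ \max\{\min\{s_0,\lambda_0\},-s_0,-\lambda_0\},\ F_1(w;\mu)\big),$$ $$F_0(u;\mu)=\big(\nabla f_0(x)+\nabla_x\hat f_1(x;\mu)+\nabla c_0(x)\lambda_0,\ c_0(x)+s_0,\ s_0\circ\lambda_0\big)\quad\text{with }\lambda_0\ge0,\ s_0\ge0,$$ where $\circ$, max and min are componentwise and $e$ is the all-ones vector. Set $\theta(w;\mu)=\|F^C(w;\mu)\|$ and $\theta_0(u;\mu)=\|F_0(u;\mu)\|$ with $\nabla_x\hat f_1(x;\mu)=-\eta_1$, where $\eta_1$ is the multiplier from the smoothed subproblem solution at $x$. Extrapolation quadratic program at $w^l$ with parameter $\mu^{l+1}$: $$\begin{aligned}\min_{\Delta z}\ &\nabla_z\varphi(z^l;\mu^{l+1})^T\Delta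 z+\tfrac12\Delta z^T\nabla_{zz}^2\mathcal{L}(w^l)\Delta z+\tfrac12\Delta s_1^T(S_1^l)^{-1}\Lambda_1^l\Delta s_1\\ \text{s.t.}\ &\nabla_xc_0(x^l)^T\Delta x+c_0(x^l)\le0\ [\lambda_0^+],\qquad \nabla_z\tilde c_1(z^l)^T\Delta z+\tilde c_1(z^l)=0\ [\lambda_1^+,\eta_1^+],\end{aligned}$$ with $S_1^l=\mathrm{diag}(s_1^l)$, $\Lambda_1^l=\mathrm{diag}(\lambda_1^l)$. An optimal solution $\Delta z^l$ with its multipliers gives the primal-dual (extrapolation) step $\Delta w^l=(\Delta z^l,\lambda_0^+-\lambda_0^l,\lambda_1^+-\lambda_1^l,\eta_1^+-\eta_1^l)$, with the slack component of the step given by $s_0^l+\Delta s_0^l=-(c_0(x^l)+\nabla_xc_0(x^l)^T\Delta x^l)$. Step size (fraction-to-the-boundary rule), with $\tau^l\in(0,1)$: $$\alpha^l=\max\{\alpha\in(0,1]:\ s_1^l+\alpha\Delta s_1^l\ge\tau^ls_1^l,\ \lambda_1^l+\alpha\Delta\lambda_1^l\ge\tau^l\lambda_1^l\}.$$ Two-stage decomposition algorithm with extrapolation steps. Input: $\tilde u^0$, $\mu^0>0$, $c_{\mu,1}\in(0,1)$, $c_{\mu,2}\in(1,2)$, $\bar c>0$, $\tau^{\max}>0$ (such that $\tau^l\in(0,1)$ below). Step 1: $l\leftarrow0$. Step 2: starting from $\tilde u^l$, call the SQP method on the smoothed master problem with $\mu=\mu^l$ to find $u^l$ with $\theta_0(u^l;\mu^l)\le\bar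 c\,\mu^l$. Step 3: set $w^l=(u^l,v_1^l)$, where $v_1^l$ is the last subproblem solution corresponding to $u^l$. Step 4: while $\theta(w^l;\mu^l)\le\bar c\,\mu^l$: set $\mu^{l+1}=\min\{c_{\mu,1}\mu^l,(\mu^l)^{c_{\mu,2}}\}$ and $\tau^l=\min\{\tau^{\max},\mu^{l+1}\}$; solve the extrapolation quadratic program to get $\Delta w^l$, compute $\alpha^l$, set $w^{l+1}=w^l+\alpha^l\Delta w^l$; $l\leftarrow l+1$. Step 5: take the first-stage part of the current $w^l$ as new starting point $\tilde u^l$ and go to Step 2. Local assumption: $w^*=(u^*,v_1^* )$ is the primal-dual solution corresponding to a local minimum of the undecomposed problem that satisfies the second-order sufficiency conditions and strict complementarity; $f_0(\cdot),f_1(\cdot;\cdot),c_0(\cdot),c_1(\cdot;\cdot)$ are $C^2$ and have locally Lipschitz continuous second derivatives at $(x^*,y_1^* )$; and the linear independence constraint qualification (LICQ) holds at $(x^*,y_1^* )$ for the undecomposed problem. Feasibility assumption: for any $x$ sent to the subproblem by the master problem, the subproblem parameterized by $x$ is feasible and the subproblem solver always returns a KKT point.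
   Formalization: Added: the Step 3 iterate satisfies the while-loop test θ(w^l;μ^l) ≤ c̄μ^l (Step 2 does not imply it); the extrapolation QP's "optimal solution" is the local minimizer with multipliers nearest the current iterate, since with a global minimizer the claim can fail. *)

theory Defs
  imports "HOL-Analysis.Analysis" "HOL-Library.Landau_Symbols"
begin

section \<open>Derivatives\<close>

definition grad :: "('a::real_inner \<Rightarrow> real) \<Rightarrow> 'a \<Rightarrow> 'a" where
  "grad f p = (THE D. GDERIV f p :> D)"

definition hess :: "('a::real_inner \<Rightarrow> real) \<Rightarrow> 'a \<Rightarrow> 'a \<Rightarrow> 'a" where
  "hess f p = frechet_derivative (grad f) (at p)"

text \<open>Only the behaviour near \<open>p\<close> matters: \<open>f\<close> is \<open>C\<^sup>2\<close> on a neighbourhood of \<open>p\<close>, with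
  Lipschitz second derivative there.\<close>

definition C2_lipschitz_near :: "('a::real_normed_vector \<Rightarrow> 'b::real_normed_vector) \<Rightarrow> 'a \<Rightarrow> bool" where
  "C2_lipschitz_near f p \<longleftrightarrow>
    (\<exists>U (f' :: 'a \<Rightarrow> 'a \<Rightarrow>\<^sub>L 'b) (f'' :: 'a \<Rightarrow> 'a \<Rightarrow>\<^sub>L 'a \<Rightarrow>\<^sub>L 'b) K.
       open U \<and> p \<in> U \<and>
       (\<forall>q\<in>U. (f has_derivative blinfun_apply (f' q)) (at q)) \<and>
       (\<forall>q\<in>U. (f' has_derivative blinfun_apply (f'' q)) (at q)) \<and>
       continuous_on U f'' \<and> K-lipschitz_on U f'')"


section \<open>Optimality notions for a nonlinear program \<open>min f p\<close> s.t. \<open>g i p \<le> 0\<close> for all \<open>i\<close>\<close>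

definition nlp_feasible :: "('i \<Rightarrow> 'p \<Rightarrow> real) \<Rightarrow> 'p \<Rightarrow> bool" where
  "nlp_feasible g p \<longleftrightarrow> (\<forall>i. g i p \<le> 0)"

definition nlp_local_min :: "('p::metric_space \<Rightarrow> real) \<Rightarrow> ('i \<Rightarrow> 'p \<Rightarrow> real) \<Rightarrow> 'p \<Rightarrow> bool" where
  "nlp_local_min f g p \<longleftrightarrow> nlp_feasible g p \<and>
     (\<exists>r>0. \<forall>q. nlp_feasible g q \<and> dist q p < r \<longrightarrow> f p \<le> f q)"

definition nlp_lagrangian :: "('p \<Rightarrow> real) \<Rightarrow> ('i::finite \<Rightarrow> 'p \<Rightarrow> real) \<Rightarrow> ('i \<Rightarrow> real) \<Rightarrow> 'p \<Rightarrow> real" where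
  "nlp_lagrangian f g lam p = f p + (\<Sum>i\<in>UNIV. lam i * g i p)"

definition nlp_kkt :: "('p::real_inner \<Rightarrow> real) \<Rightarrow> ('i::finite \<Rightarrow> 'p \<Rightarrow> real) \<Rightarrow> 'p \<Rightarrow> ('i \<Rightarrow> real) \<Rightarrow> bool" where
  "nlp_kkt f g p lam \<longleftrightarrow> nlp_feasible g p \<and> grad (nlp_lagrangian f g lam) p = 0 \<and>
     (\<forall>i. 0 \<le> lam i) \<and> (\<forall>i. lam i * g i p = 0)"

definition nlp_active :: "('i \<Rightarrow> 'p \<Rightarrow> real) \<Rightarrow> 'p \<Rightarrow> 'i set" where
  "nlp_active g p = {i. g i p = 0}"

definition nlp_strict_complementarity :: "('i \<Rightarrow> 'p \<Rightarrow> real) \<Rightarrow> 'p \<Rightarrow> ('i \<Rightarrow> real) \<Rightarrow> bool" where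
  "nlp_strict_complementarity g p lam \<longleftrightarrow> (\<forall>i\<in>nlp_active g p. 0 < lam i)"

definition nlp_licq :: "('i \<Rightarrow> 'p::real_inner \<Rightarrow> real) \<Rightarrow> 'p \<Rightarrow> bool" where
  "nlp_licq g p \<longleftrightarrow> inj_on (\<lambda>i. grad (g i) p) (nlp_active g p) \<and>
     independent ((\<lambda>i. grad (g i) p) ` nlp_active g p)"

definition nlp_critical_cone :: "('i \<Rightarrow> 'p::real_inner \<Rightarrow> real) \<Rightarrow> 'p \<Rightarrow> ('i \<Rightarrow> real) \<Rightarrow> 'p set" where
  "nlp_critical_cone g p lam =
     {d. \<forall>i\<in>nlp_active g p. grad (g i) p \<bullet> d \<le> 0 \<and> (0 < lam i \<longrightarrow> grad (g i) p \<bullet> d = 0)}"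

definition nlp_sosc :: "('p::real_inner \<Rightarrow> real) \<Rightarrow> ('i::finite \<Rightarrow> 'p \<Rightarrow> real) \<Rightarrow> 'p \<Rightarrow> ('i \<Rightarrow> real) \<Rightarrow> bool" where
  "nlp_sosc f g p lam \<longleftrightarrow>
     (\<forall>d\<in>nlp_critical_cone g p lam. d \<noteq> 0 \<longrightarrow> 0 < d \<bullet> hess (nlp_lagrangian f g lam) p d)"


section \<open>The two-stage problem\<close>

text \<open>The second-stage functions take the arguments \<open>y\<^sub>1\<close> and \<open>x\<close> in this order.\<close>

record ('n0::finite, 'n1::finite, 'm0::finite, 'm1::finite) two_stage =
  f0 :: "real^'n0 \<Rightarrow> real"
  f1 :: "real^'n1 \<Rightarrow> real^'n0 \<Rightarrow> real"
  c0 :: "real^'n0 \<Rightarrow> real^'m0"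
  c1 :: "real^'n1 \<Rightarrow> real^'n0 \<Rightarrow> real^'m1"

text \<open>Tuples are used, rather than records, so that the Euclidean norm is available:
  \<open>u = (x, \<lambda>\<^sub>0, s\<^sub>0)\<close>, \<open>v\<^sub>1 = (y\<^sub>1, xt\<^sub>1, s\<^sub>1, \<lambda>\<^sub>1, \<eta>\<^sub>1)\<close>, \<open>w = (u, v\<^sub>1)\<close> and \<open>z = (x, y\<^sub>1, xt\<^sub>1, s\<^sub>1)\<close>,
  where \<open>xt\<^sub>1\<close> is the second-stage copy of \<open>x\<close>.\<close>

type_synonym ('n0, 'm0) upoint = "(real^'n0) \<times> (real^'m0) \<times> (real^'m0)"
type_synonym ('n0, 'n1, 'm1) vpoint =
  "(real^'n1) \<times> (real^'n0) \<times> (real^'m1) \<times> (real^'m1) \<times> (real^'n0)"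
type_synonym ('n0, 'n1, 'm0, 'm1) wpoint = "('n0, 'm0) upoint \<times> ('n0, 'n1, 'm1) vpoint"
type_synonym ('n0, 'n1, 'm1) zpoint = "(real^'n0) \<times> (real^'n1) \<times> (real^'n0) \<times> (real^'m1)"

definition comp_mult :: "real^'m \<Rightarrow> real^'m \<Rightarrow> real^'m" where
  "comp_mult a b = (\<chi> i. a $ i * b $ i)"


subsection \<open>The undecomposed problem, in the variables \<open>(x, y\<^sub>1)\<close>\<close>

fun joint_obj :: "('n0::finite, 'n1::finite, 'm0::finite, 'm1::finite) two_stage
    \<Rightarrow> (real^'n0) \<times> (real^'n1) \<Rightarrow> real" where
  "joint_obj P (x, y) = f0 P x + f1 P y x"

fun joint_con :: "('n0::finite, 'n1::finite, 'm0::finite, 'm1::finite) two_stage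
    \<Rightarrow> 'm0 + 'm1 \<Rightarrow> (real^'n0) \<times> (real^'n1) \<Rightarrow> real" where
  "joint_con P (Inl i) (x, y) = c0 P x $ i"
| "joint_con P (Inr j) (x, y) = c1 P y x $ j"

definition joint_mult :: "real^'m0 \<Rightarrow> real^'m1 \<Rightarrow> 'm0 + 'm1 \<Rightarrow> real" where
  "joint_mult l0 l1 = case_sum (\<lambda>i. l0 $ i) (\<lambda>j. l1 $ j)"

text \<open>The remaining components of \<open>w\<^sup>*\<close> are determined by the solution \<open>(x\<^sup>*, y\<^sub>1\<^sup>*)\<close> and its multipliers:
  the slacks by the constraints, \<open>xt\<^sub>1\<close> by \<open>xt\<^sub>1 = x\<close>, and \<open>\<eta>\<^sub>1\<close> by stationarity of the Lagrangian in \<open>xt\<^sub>1\<close>.\<close>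

fun local_assumption :: "('n0::finite, 'n1::finite, 'm0::finite, 'm1::finite) two_stage
    \<Rightarrow> ('n0, 'n1, 'm0, 'm1) wpoint \<Rightarrow> bool" where
  "local_assumption P ((x, l0, s0), (y, xt, s1, l1, e1)) \<longleftrightarrow>
     s0 = - c0 P x \<and> s1 = - c1 P y x \<and> xt = x \<and>
     e1 = - grad (\<lambda>x'. f1 P y x' + c1 P y x' \<bullet> l1) x \<and>
     nlp_local_min (joint_obj P) (joint_con P) (x, y) \<and>
     nlp_kkt (joint_obj P) (joint_con P) (x, y) (joint_mult l0 l1) \<and>
     nlp_sosc (joint_obj P) (joint_con P) (x, y) (joint_mult l0 l1) \<and>
     nlp_strict_complementarity (joint_con P) (x, y) (joint_mult l0 l1) \<and>
     nlp_licq (joint_con P) (x, y) \<and>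
     C2_lipschitz_near (f0 P) x \<and>
     C2_lipschitz_near (\<lambda>(y', x'). f1 P y' x') (y, x) \<and>
     C2_lipschitz_near (c0 P) x \<and>
     C2_lipschitz_near (\<lambda>(y', x'). c1 P y' x') (y, x)"


subsection \<open>Optimality residuals\<close>

fun zpart :: "('n0::finite, 'n1::finite, 'm0::finite, 'm1::finite) wpoint \<Rightarrow> ('n0, 'n1, 'm1) zpoint" where
  "zpart ((x, l0, s0), (y, xt, s1, l1, e1)) = (x, y, xt, s1)"

fun phi :: "('n0::finite, 'n1::finite, 'm0::finite, 'm1::finite) two_stage \<Rightarrow> real
    \<Rightarrow> ('n0, 'n1, 'm1) zpoint \<Rightarrow> real" where
  "phi P \<mu> (x, y, xt, s1) = f0 P x + f1 P y xt - \<mu> * (\<Sum>j\<in>UNIV. ln (s1 $ j))"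

fun ctil :: "('n0::finite, 'n1::finite, 'm0::finite, 'm1::finite) two_stage
    \<Rightarrow> ('n0, 'n1, 'm1) zpoint \<Rightarrow> (real^'m1) \<times> (real^'n0)" where
  "ctil P (x, y, xt, s1) = (c1 P y xt + s1, xt - x)"

fun lagrangian :: "('n0::finite, 'n1::finite, 'm0::finite, 'm1::finite) two_stage
    \<Rightarrow> ('n0, 'n1, 'm0, 'm1) wpoint \<Rightarrow> real" where
  "lagrangian P ((x, l0, s0), (y, xt, s1, l1, e1)) =
     f0 P x + f1 P y xt + c0 P x \<bullet> l0 + ctil P (x, y, xt, s1) \<bullet> (l1, e1)"

fun F1 :: "('n0::finite, 'n1::finite, 'm0::finite, 'm1::finite) two_stage \<Rightarrow> real
    \<Rightarrow> ('n0, 'n1, 'm0, 'm1) wpoint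
    \<Rightarrow> (real^'n1) \<times> (real^'n0) \<times> (real^'m1) \<times> (real^'m1) \<times> (real^'n0)" where
  "F1 P \<mu> ((x, l0, s0), (y, xt, s1, l1, e1)) =
     (grad (\<lambda>y'. lagrangian P ((x, l0, s0), (y', xt, s1, l1, e1))) y,
      grad (\<lambda>xt'. lagrangian P ((x, l0, s0), (y, xt', s1, l1, e1))) xt,
      comp_mult s1 l1 - (\<chi> j. \<mu>),
      c1 P y xt + s1,
      xt - x)"

fun FC :: "('n0::finite, 'n1::finite, 'm0::finite, 'm1::finite) two_stage \<Rightarrow> real
    \<Rightarrow> ('n0, 'n1, 'm0, 'm1) wpoint
    \<Rightarrow> (real^'n0) \<times> (real^'m0) \<times> (real^'m0)
      \<times> ((real^'n1) \<times> (real^'n0) \<times> (real^'m1) \<times> (real^'m1) \<times> (real^'n0))" where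
  "FC P \<mu> ((x, l0, s0), v) =
     (grad (\<lambda>x'. lagrangian P ((x', l0, s0), v)) x,
      c0 P x + s0,
      (\<chi> i. Max {min (s0 $ i) (l0 $ i), - s0 $ i, - l0 $ i}),
      F1 P \<mu> ((x, l0, s0), v))"

definition theta :: "('n0::finite, 'n1::finite, 'm0::finite, 'm1::finite) two_stage \<Rightarrow> real
    \<Rightarrow> ('n0, 'n1, 'm0, 'm1) wpoint \<Rightarrow> real" where
  "theta P \<mu> w = norm (FC P \<mu> w)"

text \<open>The argument \<open>g\<close> stands for the gradient of the smoothed second-stage value function at \<open>x\<close>. It is
  evaluated as \<open>-\<eta>\<^sub>1\<close>, with \<open>\<eta>\<^sub>1\<close> taken from the subproblem solution \<open>v\<^sub>1\<close> that the solver
  returned at \<open>x\<close>; \<open>\<mu>\<close> enters through \<open>v\<^sub>1\<close> only.\<close>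

fun F0 :: "('n0::finite, 'n1::finite, 'm0::finite, 'm1::finite) two_stage \<Rightarrow> real^'n0
    \<Rightarrow> ('n0, 'm0) upoint \<Rightarrow> (real^'n0) \<times> (real^'m0) \<times> (real^'m0)" where
  "F0 P g (x, l0, s0) =
     (grad (f0 P) x + g + transpose (jacobian (c0 P) (at x)) *v l0, c0 P x + s0, comp_mult s0 l0)"

fun theta0 :: "('n0::finite, 'n1::finite, 'm0::finite, 'm1::finite) two_stage
    \<Rightarrow> ('n0, 'm0) upoint \<Rightarrow> ('n0, 'n1, 'm1) vpoint \<Rightarrow> real" where
  "theta0 P u (y, xt, s1, l1, e1) = norm (F0 P (- e1) u)"

text \<open>\<open>F1\<close> depends on the first-stage part of its argument through \<open>x\<close> only. The barrier term requires
  \<open>s\<^sub>1 > 0\<close>.\<close>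

fun subproblem_kkt :: "('n0::finite, 'n1::finite, 'm0::finite, 'm1::finite) two_stage \<Rightarrow> real
    \<Rightarrow> real^'n0 \<Rightarrow> ('n0, 'n1, 'm1) vpoint \<Rightarrow> bool" where
  "subproblem_kkt P \<mu> x (y, xt, s1, l1, e1) \<longleftrightarrow>
     (\<forall>j. 0 < s1 $ j) \<and> F1 P \<mu> ((x, 0, 0), (y, xt, s1, l1, e1)) = 0"

definition subproblem_feasible :: "('n0::finite, 'n1::finite, 'm0::finite, 'm1::finite) two_stage
    \<Rightarrow> real^'n0 \<Rightarrow> bool" where
  "subproblem_feasible P x \<longleftrightarrow> (\<exists>y. c1 P y x \<le> 0)"


subsection \<open>The extrapolation quadratic program at \<open>w\<close>\<close>

fun qp_obj :: "('n0::finite, 'n1::finite, 'm0::finite, 'm1::finite) two_stage \<Rightarrow> real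
    \<Rightarrow> ('n0, 'n1, 'm0, 'm1) wpoint \<Rightarrow> ('n0, 'n1, 'm1) zpoint \<Rightarrow> real" where
  "qp_obj P \<mu> ((x, l0, s0), (y, xt, s1, l1, e1)) (dx, dy, dxt, ds1) =
     (let z = (x, y, xt, s1); dz = (dx, dy, dxt, ds1);
          L = (\<lambda>(x', y', xt', s1'). lagrangian P ((x', l0, s0), (y', xt', s1', l1, e1)))
      in grad (phi P \<mu>) z \<bullet> dz + 1/2 * (dz \<bullet> hess L z dz)
         + 1/2 * (\<Sum>j\<in>UNIV. ds1 $ j * (l1 $ j / s1 $ j) * ds1 $ j))"

definition qp_ineq :: "('n0::finite, 'n1::finite, 'm0::finite, 'm1::finite) two_stage
    \<Rightarrow> ('n0, 'n1, 'm0, 'm1) wpoint \<Rightarrow> ('n0, 'n1, 'm1) zpoint \<Rightarrow> real^'m0" where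
  "qp_ineq P w dz = frechet_derivative (c0 P) (at (fst (zpart w))) (fst dz) + c0 P (fst (zpart w))"

definition qp_eq :: "('n0::finite, 'n1::finite, 'm0::finite, 'm1::finite) two_stage
    \<Rightarrow> ('n0, 'n1, 'm0, 'm1) wpoint \<Rightarrow> ('n0, 'n1, 'm1) zpoint \<Rightarrow> (real^'m1) \<times> (real^'n0)" where
  "qp_eq P w dz = frechet_derivative (ctil P) (at (zpart w)) dz + ctil P (zpart w)"

definition qp_feasible :: "('n0::finite, 'n1::finite, 'm0::finite, 'm1::finite) two_stage
    \<Rightarrow> ('n0, 'n1, 'm0, 'm1) wpoint \<Rightarrow> ('n0, 'n1, 'm1) zpoint \<Rightarrow> bool" where
  "qp_feasible P w dz \<longleftrightarrow> qp_ineq P w dz \<le> 0 \<and> qp_eq P w dz = 0"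

definition qp_local_min :: "('n0::finite, 'n1::finite, 'm0::finite, 'm1::finite) two_stage \<Rightarrow> real
    \<Rightarrow> ('n0, 'n1, 'm0, 'm1) wpoint \<Rightarrow> ('n0, 'n1, 'm1) zpoint \<Rightarrow> bool" where
  "qp_local_min P \<mu> w dz \<longleftrightarrow> qp_feasible P w dz \<and>
     (\<exists>r>0. \<forall>dz'. qp_feasible P w dz' \<and> dist dz' dz < r \<longrightarrow> qp_obj P \<mu> w dz \<le> qp_obj P \<mu> w dz')"

definition qp_multipliers :: "('n0::finite, 'n1::finite, 'm0::finite, 'm1::finite) two_stage \<Rightarrow> real
    \<Rightarrow> ('n0, 'n1, 'm0, 'm1) wpoint \<Rightarrow> ('n0, 'n1, 'm1) zpoint
    \<Rightarrow> real^'m0 \<Rightarrow> real^'m1 \<Rightarrow> real^'n0 \<Rightarrow> bool" where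
  "qp_multipliers P \<mu> w dz l0p l1p e1p \<longleftrightarrow>
     grad (\<lambda>d. qp_obj P \<mu> w d + qp_ineq P w d \<bullet> l0p + qp_eq P w d \<bullet> (l1p, e1p)) dz = 0 \<and>
     0 \<le> l0p \<and> comp_mult l0p (qp_ineq P w dz) = 0"

fun primal_dual_step :: "('n0::finite, 'n1::finite, 'm0::finite, 'm1::finite) two_stage
    \<Rightarrow> ('n0, 'n1, 'm0, 'm1) wpoint \<Rightarrow> ('n0, 'n1, 'm1) zpoint
    \<Rightarrow> real^'m0 \<Rightarrow> real^'m1 \<Rightarrow> real^'n0 \<Rightarrow> ('n0, 'n1, 'm0, 'm1) wpoint" where
  "primal_dual_step P ((x, l0, s0), (y, xt, s1, l1, e1)) (dx, dy, dxt, ds1) l0p l1p e1p =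
     ((dx, l0p - l0, - qp_ineq P ((x, l0, s0), (y, xt, s1, l1, e1)) (dx, dy, dxt, ds1) - s0),
      (dy, dxt, ds1, l1p - l1, e1p - e1))"

definition qp_step :: "('n0::finite, 'n1::finite, 'm0::finite, 'm1::finite) two_stage \<Rightarrow> real
    \<Rightarrow> ('n0, 'n1, 'm0, 'm1) wpoint \<Rightarrow> ('n0, 'n1, 'm0, 'm1) wpoint \<Rightarrow> bool" where
  "qp_step P \<mu> w dw \<longleftrightarrow>
     (\<exists>dz l0p l1p e1p. qp_local_min P \<mu> w dz \<and> qp_multipliers P \<mu> w dz l0p l1p e1p \<and>
        dw = primal_dual_step P w dz l0p l1p e1p)"

text \<open>The quadratic program need not be convex, not even near a point satisfying the second-order
  sufficiency conditions. It may be unbounded below, or have global minimizers far away from \<open>0\<close>: for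
  \<open>f\<^sub>0(x) = x - 2 x\<^sup>2\<close> and \<open>0 \<le> x \<le> 1\<close>, at the strict local solution \<open>x = 0\<close>, its unique global minimizer
  is \<open>\<Delta>x = 1\<close>. The usual SQP convention is adopted: a solution is a local one, and the solution
  closest to the current primal-dual iterate is taken. If the primal-dual solution is
  unique, it is that solution.\<close>

definition extrapolation_step :: "('n0::finite, 'n1::finite, 'm0::finite, 'm1::finite) two_stage \<Rightarrow> real
    \<Rightarrow> ('n0, 'n1, 'm0, 'm1) wpoint \<Rightarrow> ('n0, 'n1, 'm0, 'm1) wpoint \<Rightarrow> bool" where
  "extrapolation_step P \<mu> w dw \<longleftrightarrow>
     qp_step P \<mu> w dw \<and> (\<forall>dw'. qp_step P \<mu> w dw' \<longrightarrow> norm dw \<le> norm dw')"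

fun step_sizes :: "real \<Rightarrow> ('n0::finite, 'n1::finite, 'm0::finite, 'm1::finite) wpoint
    \<Rightarrow> ('n0, 'n1, 'm0, 'm1) wpoint \<Rightarrow> real set" where
  "step_sizes \<tau> (u, (y, xt, s1, l1, e1)) (du, (dy, dxt, ds1, dl1, de1)) =
     {\<alpha>\<in>{0<..1}. \<tau> *\<^sub>R s1 \<le> s1 + \<alpha> *\<^sub>R ds1 \<and> \<tau> *\<^sub>R l1 \<le> l1 + \<alpha> *\<^sub>R dl1}"

definition is_step_size :: "real \<Rightarrow> ('n0::finite, 'n1::finite, 'm0::finite, 'm1::finite) wpoint
    \<Rightarrow> ('n0, 'n1, 'm0, 'm1) wpoint \<Rightarrow> real \<Rightarrow> bool" where
  "is_step_size \<tau> w dw \<alpha> \<longleftrightarrow> \<alpha> \<in> step_sizes \<tau> w dw \<and> (\<forall>\<beta>\<in>step_sizes \<tau> w dw. \<beta> \<le> \<alpha>)"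


section \<open>The algorithm\<close>

record params =
  cmu1 :: real
  cmu2 :: real
  cbar :: real
  taumax :: real

definition mu_next :: "params \<Rightarrow> real \<Rightarrow> real" where
  "mu_next A \<mu> = min (cmu1 A * \<mu>) (\<mu> powr cmu2 A)"

definition tau :: "params \<Rightarrow> real \<Rightarrow> real" where
  "tau A \<mu> = min (taumax A) (mu_next A \<mu>)"

text \<open>The barrier parameters are nonincreasing, so the condition on \<open>\<tau>\<^sup>0\<close> puts every
  \<open>\<tau>\<^sup>l\<close> into \<open>(0,1)\<close>.\<close>

definition valid_input :: "params \<Rightarrow> real \<Rightarrow> bool" where
  "valid_input A \<mu>0 \<longleftrightarrow> 0 < \<mu>0 \<and> 0 < cmu1 A \<and> cmu1 A < 1 \<and> 1 < cmu2 A \<and> cmu2 A < 2 \<and>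
     0 < cbar A \<and> 0 < taumax A \<and> tau A \<mu>0 < 1"

text \<open>Configurations: about to run Step 2 from a starting point; Step 3 done; at the test of the
  while-loop of Step 4. They carry the iteration counter \<open>l\<close> and the current \<open>\<mu>\<close>.\<close>

datatype ('n0::finite, 'n1::finite, 'm0::finite, 'm1::finite) config =
    Step2 nat "('n0, 'm0) upoint" real
  | Step3 nat "('n0, 'n1, 'm0, 'm1) wpoint" real
  | Step4 nat "('n0, 'n1, 'm0, 'm1) wpoint" real

text \<open>\<open>sqp ut \<mu> evals u\<close>: the SQP method, started from \<open>ut\<close> on the smoothed master problem with
  parameter \<open>\<mu>\<close>, may terminate with \<open>u\<close> after the subproblem calls \<open>evals\<close>, a chronological list of
  pairs of an \<open>x\<close> sent to the subproblem solver and the \<open>v\<^sub>1\<close> returned for it. The internals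
  of the two solvers are left unspecified; their contracts are the termination test in \<open>master\<close> and
  \<open>feasibility_assumption\<close>.\<close>

type_synonym ('n0, 'n1, 'm0, 'm1) sqp_method =
  "('n0, 'm0) upoint \<Rightarrow> real \<Rightarrow> ((real^'n0) \<times> ('n0, 'n1, 'm1) vpoint) list \<Rightarrow> ('n0, 'm0) upoint \<Rightarrow> bool"

inductive alg_step :: "('n0::finite, 'n1::finite, 'm0::finite, 'm1::finite) two_stage \<Rightarrow> params
    \<Rightarrow> ('n0, 'n1, 'm0, 'm1) sqp_method
    \<Rightarrow> ('n0, 'n1, 'm0, 'm1) config \<Rightarrow> ('n0, 'n1, 'm0, 'm1) config \<Rightarrow> bool"
  for P A sqp where
  master: "sqp ut \<mu> evals (x, l0, s0) \<Longrightarrow> 0 \<le> l0 \<Longrightarrow> 0 \<le> s0 \<Longrightarrow>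
     vs = map snd (filter (\<lambda>e. fst e = x) evals) \<Longrightarrow> vs \<noteq> [] \<Longrightarrow>
     theta0 P (x, l0, s0) (last vs) \<le> cbar A * \<mu> \<Longrightarrow>
     alg_step P A sqp (Step2 l ut \<mu>) (Step3 l ((x, l0, s0), last vs) \<mu>)"
| enter: "alg_step P A sqp (Step3 l w \<mu>) (Step4 l w \<mu>)"
| loop: "theta P \<mu> w \<le> cbar A * \<mu> \<Longrightarrow>
     extrapolation_step P (mu_next A \<mu>) w dw \<Longrightarrow> is_step_size (tau A \<mu>) w dw \<alpha> \<Longrightarrow>
     alg_step P A sqp (Step4 l w \<mu>) (Step4 (Suc l) (w + \<alpha> *\<^sub>R dw) (mu_next A \<mu>))"
| exit: "\<not> theta P \<mu> w \<le> cbar A * \<mu> \<Longrightarrow>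
     alg_step P A sqp (Step4 l w \<mu>) (Step2 l (fst w) \<mu>)"

text \<open>A maximal run. A configuration in which the algorithm cannot proceed (say, because the quadratic program
  has no solution) is repeated forever, so that runs are not assumed to succeed.\<close>

definition alg_run :: "('n0::finite, 'n1::finite, 'm0::finite, 'm1::finite) two_stage \<Rightarrow> params
    \<Rightarrow> ('n0, 'n1, 'm0, 'm1) sqp_method \<Rightarrow> ('n0, 'm0) upoint \<Rightarrow> real
    \<Rightarrow> (nat \<Rightarrow> ('n0, 'n1, 'm0, 'm1) config) \<Rightarrow> bool" where
  "alg_run P A sqp u0 \<mu>0 \<sigma> \<longleftrightarrow> \<sigma> 0 = Step2 0 u0 \<mu>0 \<and>
     (\<forall>k. alg_step P A sqp (\<sigma> k) (\<sigma> (Suc k)) \<or>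
          (\<nexists>c. alg_step P A sqp (\<sigma> k) c) \<and> \<sigma> (Suc k) = \<sigma> k)"

definition feasibility_assumption :: "('n0::finite, 'n1::finite, 'm0::finite, 'm1::finite) two_stage
    \<Rightarrow> ('n0, 'n1, 'm0, 'm1) sqp_method \<Rightarrow> (nat \<Rightarrow> ('n0, 'n1, 'm0, 'm1) config) \<Rightarrow> bool" where
  "feasibility_assumption P sqp \<sigma> \<longleftrightarrow>
     (\<forall>k l ut \<mu> evals u. \<sigma> k = Step2 l ut \<mu> \<and> sqp ut \<mu> evals u \<longrightarrow>
        (\<forall>(x, v)\<in>set evals. subproblem_feasible P x \<and> subproblem_kkt P \<mu> x v))"

definition converges_superlinearly :: "(nat \<Rightarrow> 'a::metric_space) \<Rightarrow> 'a \<Rightarrow> bool" where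
  "converges_superlinearly ws wstar \<longleftrightarrow>
     ws \<longlonglongrightarrow> wstar \<and> (\<lambda>n. dist (ws (Suc n)) wstar) \<in> o(\<lambda>n. dist (ws n) wstar)"

end

theory Submission
  imports Defs
begin

text \<open>Three facts carry the proof. The point is that near \<open>w\<^sup>*\<close> and for small \<open>\<mu>\<close>, one pass through the
  while-loop is one full Newton step for a smooth square system with a nonsingular Jacobian.

  \<^emph>\<open>The residual is the norm of a smooth map.\<close> By strict complementarity exactly one of \<open>s\<^sub>0\<close>, \<open>\<lambda>\<^sub>0\<close> is
  small in each component near \<open>w\<^sup>*\<close>, and the max-min block of \<open>F\<^sup>C\<close> is that one up to sign. Replacing the
  block accordingly gives a smooth map \<open>G\<close> with \<open>\<theta>(w;\<mu>) = \<parallel>G w - \<mu> E\<parallel>\<close>, where the constant \<open>E\<close> has ones in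
  the block \<open>s\<^sub>1 \<circ> \<lambda>\<^sub>1\<close> and zeros elsewhere (\<open>norm_FC\<close>). Second-order sufficiency, strict complementarity and
  LICQ make \<open>G'(w\<^sup>*)\<close> injective (\<open>G'_injective\<close>). Hence \<open>\<parallel>w - w\<^sup>*\<parallel>\<close> and \<open>\<parallel>G w\<parallel>\<close> are comparable near \<open>w\<^sup>*\<close>,
  and a Newton step \<open>d\<close> leaves a residual of order \<open>\<parallel>d\<parallel>\<^sup>2\<close> (\<open>newton_neighbourhood\<close>).

  \<^emph>\<open>The extrapolation step is the Newton step for \<open>G w = \<mu>\<^sup>+ E\<close>.\<close> If a primal-dual solution of the
  quadratic program leads to a point near \<open>w\<^sup>*\<close>, strict complementarity fixes its active set, and its KKT system
  becomes the linearized equation (\<open>qp_step_imp_newton\<close>). Conversely the Newton step is a solution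
  (\<open>newton_imp_qp_step\<close>): the Hessian need not be positive definite, but it is so on the critical directions, and
  the barrier weights \<open>\<lambda>\<^sub>1\<^sub>j / s\<^sub>1\<^sub>j\<close> of the active constraints grow beyond every bound near \<open>w\<^sup>*\<close>, so that they
  compensate for negative curvature in the other directions (\<open>curvature\<close>); at the active first-stage constraints
  the positive multipliers do so for short displacements (\<open>qp_local_min_sufficient\<close>). Because the Newton step is short, it
  is the only solution that is closest to the current iterate.

  \<^emph>\<open>The exponent \<open>c\<^sub>\<mu>\<^sub>,\<^sub>2 < 2\<close> fits the quadratic residual.\<close> If \<open>\<theta>(w;\<mu>) \<le> c \<mu>\<close>, then \<open>\<parallel>w - w\<^sup>*\<parallel>\<close> and the
  Newton step are \<open>O(\<mu>)\<close>, so the new residual is \<open>O(\<mu>\<^sup>2)\<close>, which is \<open>o(\<mu>\<^sup>+)\<close>. The loop test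
  therefore holds again. Moreover each product \<open>s\<^sub>1\<^sub>j \<lambda>\<^sub>1\<^sub>j\<close> at the new point is at least \<open>\<mu>\<^sup>+ / 2\<close>, which together
  with \<open>\<tau> \<le> \<mu>\<^sup>+\<close> makes \<open>\<alpha> = 1\<close> admissible (\<open>fraction_to_boundary\<close>). Finally the new distance to \<open>w\<^sup>*\<close>
  lies between two constant multiples of \<open>\<mu>\<^sup>+\<close> (\<open>one_step\<close>); since the ratio of consecutive barrier
  parameters tends to \<open>0\<close>, so does the ratio of consecutive distances.\<close>


section \<open>Functions with locally Lipschitz derivative\<close>

text \<open>The derivative is a parameter, so that the closure rules below compute it: the Jacobian of \<open>G\<close> is read off from its
  proof of smoothness. Stating the Lipschitz condition pointwise in \<open>d\<close> avoids packing \<open>g' q\<close> into a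
  bounded linear function.\<close>

definition C1_lipschitz_near ::
    "('a::real_normed_vector \<Rightarrow> 'b::real_normed_vector) \<Rightarrow> ('a \<Rightarrow> 'a \<Rightarrow> 'b) \<Rightarrow> 'a \<Rightarrow> bool" where
  "C1_lipschitz_near g g' p \<longleftrightarrow> (\<exists>r>0. \<exists>K\<ge>0.
     (\<forall>q\<in>ball p r. (g has_derivative g' q) (at q)) \<and>
     (\<forall>q\<in>ball p r. \<forall>q'\<in>ball p r. \<forall>d. norm (g' q d - g' q' d) \<le> K * norm (q - q') * norm d))"

text \<open>On a ball, the derivative, the function and the increments of the function are bounded in terms of the derivative and the
  value at the centre; one constant serves all these estimates.\<close>

lemma C1_lipschitz_nearE:
  assumes "C1_lipschitz_near g g' p"
  obtains r K where "0 < r" "0 \<le> K"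
    "\<And>q. q \<in> ball p r \<Longrightarrow> (g has_derivative g' q) (at q)"
    "\<And>q q' d. q \<in> ball p r \<Longrightarrow> q' \<in> ball p r \<Longrightarrow> norm (g' q d - g' q' d) \<le> K * norm (q - q') * norm d"
    "\<And>q d. q \<in> ball p r \<Longrightarrow> norm (g' q d) \<le> K * norm d"
    "\<And>q. q \<in> ball p r \<Longrightarrow> norm (g q) \<le> K"
    "\<And>q q'. q \<in> ball p r \<Longrightarrow> q' \<in> ball p r \<Longrightarrow> norm (g q - g q') \<le> K * norm (q - q')"
proof -
  from assms obtain r K where rK: "0 < r" "0 \<le> K"
    and der: "\<And>q. q \<in> ball p r \<Longrightarrow> (g has_derivative g' q) (at q)"
    and lip: "\<And>q q' d. q \<in> ball p r \<Longrightarrow> q' \<in> ball p r \<Longrightarrow> norm (g' q d - g' q' d) \<le> K * norm (q - q') * norm d"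
    unfolding C1_lipschitz_near_def by blast
  define B where "B = onorm (g' p) + K * r"
  have blp: "bounded_linear (g' p)" using der[of p] rK has_derivative_bounded_linear by auto
  have B0: "0 \<le> B" unfolding B_def using onorm_pos_le[OF blp] rK by simp
  have bd: "norm (g' q d) \<le> B * norm d" if "q \<in> ball p r" for q d
  proof -
    have "norm (g' q d) \<le> norm (g' p d) + norm (g' q d - g' p d)" by norm
    also have "norm (g' q d - g' p d) \<le> K * norm (q - p) * norm d" using lip that rK by auto
    also have "\<dots> \<le> K * r * norm d"
      using that rK by (intro mult_right_mono mult_left_mono) (auto simp: dist_norm norm_minus_commute)
    finally show ?thesis using onorm[OF blp, of d] unfolding B_def by (simp add: algebra_simps)
  qed
  have glip: "norm (g q - g q') \<le> B * norm (q - q')" if "q \<in> ball p r" "q' \<in> ball p r" for q q'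
  proof (rule differentiable_bound[OF convex_ball[of p r] _ _ that])
    fix x assume x: "x \<in> ball p r"
    show "(g has_derivative g' x) (at x within ball p r)" using der[OF x] by (rule has_derivative_at_withinI)
    show "onorm (g' x) \<le> B" by (rule onorm_bound) (use bd x B0 in auto)
  qed
  have gb: "norm (g q) \<le> norm (g p) + B * r" if "q \<in> ball p r" for q
  proof -
    have "norm (g q) \<le> norm (g p) + norm (g q - g p)" by norm
    also have "norm (g q - g p) \<le> B * norm (q - p)" using glip that rK by auto
    also have "\<dots> \<le> B * r" using that B0 by (intro mult_left_mono) (auto simp: dist_norm norm_minus_commute)
    finally show ?thesis by simp
  qed
  define M where "M = max K (max B (norm (g p) + B * r))"
  have M: "K \<le> M" "B \<le> M" "norm (g p) + B * r \<le> M" by (auto simp: M_def)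
  show ?thesis
  proof (rule that[of r M])
    show "0 \<le> M" using M rK by linarith
    show "norm (g' q d - g' q' d) \<le> M * norm (q - q') * norm d" if "q \<in> ball p r" "q' \<in> ball p r" for q q' d
      using order_trans[OF lip[OF that] mult_right_mono[OF mult_right_mono[OF M(1)]]] by simp
    show "norm (g' q d) \<le> M * norm d" if "q \<in> ball p r" for q d
      using order_trans[OF bd[OF that] mult_right_mono[OF M(2)]] by simp
    show "norm (g q - g q') \<le> M * norm (q - q')" if "q \<in> ball p r" "q' \<in> ball p r" for q q'
      using order_trans[OF glip[OF that] mult_right_mono[OF M(2)]] by simp
    show "norm (g q) \<le> M" if "q \<in> ball p r" for q using gb[OF that] M by linarith
  qed (use rK der in auto)
qed

lemma C1_lipschitz_near_linear:
  assumes "bounded_linear h"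
  shows "C1_lipschitz_near h (\<lambda>_. h) p"
  unfolding C1_lipschitz_near_def
  by (rule exI[of _ 1], simp, rule exI[of _ 0])
     (use bounded_linear_imp_has_derivative[OF assms] in auto)

lemma C1_lipschitz_near_const: "C1_lipschitz_near (\<lambda>_. c) (\<lambda>_ _. 0) p"
  unfolding C1_lipschitz_near_def
  by (rule exI[of _ 1], simp, rule exI[of _ 0]) auto

lemma C1_lipschitz_near_bilinear:
  fixes p :: "'x::real_normed_vector"
  assumes bb: "bounded_bilinear prd" and f: "C1_lipschitz_near f f' p" and g: "C1_lipschitz_near g g' p"
  shows "C1_lipschitz_near (\<lambda>x. prd (f x) (g x)) (\<lambda>x d. prd (f x) (g' x d) + prd (f' x d) (g x)) p"
proof -
  interpret bounded_bilinear prd by fact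
  obtain M where M: "0 \<le> M" "\<And>a b. norm (prd a b) \<le> norm a * norm b * M"
    using nonneg_bounded by blast
  from f obtain r1 K1 where 1: "0 < r1" "0 \<le> K1"
    "\<And>q. q \<in> ball p r1 \<Longrightarrow> (f has_derivative f' q) (at q)"
    "\<And>q q' d. q \<in> ball p r1 \<Longrightarrow> q' \<in> ball p r1 \<Longrightarrow> norm (f' q d - f' q' d) \<le> K1 * norm (q - q') * norm d"
    "\<And>q d. q \<in> ball p r1 \<Longrightarrow> norm (f' q d) \<le> K1 * norm d"
    "\<And>q. q \<in> ball p r1 \<Longrightarrow> norm (f q) \<le> K1"
    "\<And>q q'. q \<in> ball p r1 \<Longrightarrow> q' \<in> ball p r1 \<Longrightarrow> norm (f q - f q') \<le> K1 * norm (q - q')"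
    by (rule C1_lipschitz_nearE) blast
  from g obtain r2 K2 where 2: "0 < r2" "0 \<le> K2"
    "\<And>q. q \<in> ball p r2 \<Longrightarrow> (g has_derivative g' q) (at q)"
    "\<And>q q' d. q \<in> ball p r2 \<Longrightarrow> q' \<in> ball p r2 \<Longrightarrow> norm (g' q d - g' q' d) \<le> K2 * norm (q - q') * norm d"
    "\<And>q d. q \<in> ball p r2 \<Longrightarrow> norm (g' q d) \<le> K2 * norm d"
    "\<And>q. q \<in> ball p r2 \<Longrightarrow> norm (g q) \<le> K2"
    "\<And>q q'. q \<in> ball p r2 \<Longrightarrow> q' \<in> ball p r2 \<Longrightarrow> norm (g q - g q') \<le> K2 * norm (q - q')"
    by (rule C1_lipschitz_nearE) blast
  have sub: "ball p (min r1 r2) \<subseteq> ball p r1" "ball p (min r1 r2) \<subseteq> ball p r2" by auto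
  show ?thesis unfolding C1_lipschitz_near_def
  proof (intro exI conjI ballI allI)
    show "0 < min r1 r2" using 1 2 by auto
    show "0 \<le> 4 * (K1 * K2 * M)" using 1 2 M by auto
    fix q assume q: "q \<in> ball p (min r1 r2)"
    show "((\<lambda>x. prd (f x) (g x)) has_derivative (\<lambda>d. prd (f q) (g' q d) + prd (f' q d) (g q))) (at q)"
      by (rule FDERIV) (use q 1(3) 2(3) sub in auto)
    fix q' d :: 'x assume q': "q' \<in> ball p (min r1 r2)"
    have m: "q \<in> ball p r1" "q \<in> ball p r2" "q' \<in> ball p r1" "q' \<in> ball p r2" using q q' sub by auto
    let ?D = "norm (q - q') * norm d"
    have eq: "prd (f q) (g' q d) + prd (f' q d) (g q) - (prd (f q') (g' q' d) + prd (f' q' d) (g q'))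
       = prd (f q) (g' q d - g' q' d) + prd (f q - f q') (g' q' d)
         + (prd (f' q d - f' q' d) (g q) + prd (f' q' d) (g q - g q'))"
      by (simp add: diff_left diff_right)
    have a1: "norm (prd (f q) (g' q d - g' q' d)) \<le> K1 * (K2 * norm (q - q') * norm d) * M"
      by (rule order_trans[OF M(2)]) (intro mult_right_mono mult_mono 1 2 m M norm_ge_zero)
    have a2: "norm (prd (f q - f q') (g' q' d)) \<le> (K1 * norm (q - q')) * (K2 * norm d) * M"
      by (rule order_trans[OF M(2)]) (intro mult_right_mono mult_mono mult_nonneg_nonneg 1 2 m M norm_ge_zero)
    have a3: "norm (prd (f' q d - f' q' d) (g q)) \<le> (K1 * norm (q - q') * norm d) * K2 * M"
      by (rule order_trans[OF M(2)]) (intro mult_right_mono mult_mono mult_nonneg_nonneg 1 2 m M norm_ge_zero)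
    have a4: "norm (prd (f' q' d) (g q - g q')) \<le> (K1 * norm d) * (K2 * norm (q - q')) * M"
      by (rule order_trans[OF M(2)]) (intro mult_right_mono mult_mono mult_nonneg_nonneg 1 2 m M norm_ge_zero)
    show "norm (prd (f q) (g' q d) + prd (f' q d) (g q) - (prd (f q') (g' q' d) + prd (f' q' d) (g q')))
      \<le> 4 * (K1 * K2 * M) * norm (q - q') * norm d"
      unfolding eq
      by (rule order_trans[OF norm_triangle_ineq] order_trans[OF add_mono[OF norm_triangle_ineq norm_triangle_ineq]])+
         (use a1 a2 a3 a4 in \<open>simp add: algebra_simps\<close>)
  qed
qed

lemma C1_lipschitz_near_add:
  assumes f: "C1_lipschitz_near f f' p" and g: "C1_lipschitz_near g g' p"
  shows "C1_lipschitz_near (\<lambda>x. f x + g x) (\<lambda>x d. f' x d + g' x d) p"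
proof -
  from f obtain r1 K1 where 1: "0 < r1" "0 \<le> K1"
    "\<And>q. q \<in> ball p r1 \<Longrightarrow> (f has_derivative f' q) (at q)"
    "\<And>q q' d. q \<in> ball p r1 \<Longrightarrow> q' \<in> ball p r1 \<Longrightarrow> norm (f' q d - f' q' d) \<le> K1 * norm (q - q') * norm d"
    unfolding C1_lipschitz_near_def by blast
  from g obtain r2 K2 where 2: "0 < r2" "0 \<le> K2"
    "\<And>q. q \<in> ball p r2 \<Longrightarrow> (g has_derivative g' q) (at q)"
    "\<And>q q' d. q \<in> ball p r2 \<Longrightarrow> q' \<in> ball p r2 \<Longrightarrow> norm (g' q d - g' q' d) \<le> K2 * norm (q - q') * norm d"
    unfolding C1_lipschitz_near_def by blast
  show ?thesis unfolding C1_lipschitz_near_def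
  proof (intro exI conjI ballI allI)
    show "0 < min r1 r2" "0 \<le> K1 + K2" using 1 2 by auto
    fix q assume q: "q \<in> ball p (min r1 r2)"
    show "((\<lambda>x. f x + g x) has_derivative (\<lambda>d. f' q d + g' q d)) (at q)"
      by (intro has_derivative_add 1 2) (use q in auto)
    fix q' d assume q': "q' \<in> ball p (min r1 r2)"
    have m: "q \<in> ball p r1" "q \<in> ball p r2" "q' \<in> ball p r1" "q' \<in> ball p r2" using q q' by auto
    show "norm (f' q d + g' q d - (f' q' d + g' q' d)) \<le> (K1 + K2) * norm (q - q') * norm d"
      using 1(4)[OF m(1,3), of d] 2(4)[OF m(2,4), of d]
        norm_triangle_ineq[of "f' q d - f' q' d" "g' q d - g' q' d"]
      by (simp add: algebra_simps)
  qed
qed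

lemma C1_lipschitz_near_linear_comp:
  assumes h: "bounded_linear h" and f: "C1_lipschitz_near f f' p"
  shows "C1_lipschitz_near (\<lambda>x. h (f x)) (\<lambda>x d. h (f' x d)) p"
proof -
  from h obtain B where B: "0 \<le> B" "\<And>x. norm (h x) \<le> norm x * B"
    using bounded_linear.nonneg_bounded by blast
  from f obtain r1 K1 where 1: "0 < r1" "0 \<le> K1"
    "\<And>q. q \<in> ball p r1 \<Longrightarrow> (f has_derivative f' q) (at q)"
    "\<And>q q' d. q \<in> ball p r1 \<Longrightarrow> q' \<in> ball p r1 \<Longrightarrow> norm (f' q d - f' q' d) \<le> K1 * norm (q - q') * norm d"
    unfolding C1_lipschitz_near_def by blast
  show ?thesis unfolding C1_lipschitz_near_def
  proof (intro exI conjI ballI allI)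
    show "0 < r1" "0 \<le> K1 * B" using 1 B by auto
    fix q assume q: "q \<in> ball p r1"
    show "((\<lambda>x. h (f x)) has_derivative (\<lambda>d. h (f' q d))) (at q)"
      by (rule bounded_linear.has_derivative[OF h 1(3)[OF q]])
    fix q' d assume q': "q' \<in> ball p r1"
    show "norm (h (f' q d) - h (f' q' d)) \<le> K1 * B * norm (q - q') * norm d"
      using order_trans[OF B(2) mult_right_mono[OF 1(4)[OF q q', of d] B(1)]]
      by (simp add: linear_diff[OF bounded_linear.linear[OF h], symmetric] algebra_simps)
  qed
qed

lemma C1_lipschitz_near_comp_linear:
  assumes h: "bounded_linear h" and f: "C1_lipschitz_near f f' (h p)"
  shows "C1_lipschitz_near (\<lambda>x. f (h x)) (\<lambda>x d. f' (h x) (h d)) p"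
proof -
  from h obtain B where B: "0 < B" "\<And>x. norm (h x) \<le> norm x * B"
    using bounded_linear.pos_bounded by blast
  from f obtain r1 K1 where 1: "0 < r1" "0 \<le> K1"
    "\<And>q. q \<in> ball (h p) r1 \<Longrightarrow> (f has_derivative f' q) (at q)"
    "\<And>q q' d. q \<in> ball (h p) r1 \<Longrightarrow> q' \<in> ball (h p) r1 \<Longrightarrow> norm (f' q d - f' q' d) \<le> K1 * norm (q - q') * norm d"
    unfolding C1_lipschitz_near_def by blast
  have mem: "h q \<in> ball (h p) r1" if "q \<in> ball p (r1 / B)" for q
  proof -
    have "norm (h p - h q) \<le> norm (p - q) * B" using B(2)[of "p - q"] by (simp add: linear_diff[OF bounded_linear.linear[OF h]])
    also have "\<dots> < r1" using that B by (simp add: dist_norm field_simps)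
    finally show ?thesis by (simp add: dist_norm)
  qed
  show ?thesis unfolding C1_lipschitz_near_def
  proof (intro exI conjI ballI allI)
    show "0 < r1 / B" "0 \<le> K1 * B * B" using 1 B by auto
    fix q assume q: "q \<in> ball p (r1 / B)"
    show "((\<lambda>x. f (h x)) has_derivative (\<lambda>d. f' (h q) (h d))) (at q)"
      using diff_chain_at[OF bounded_linear_imp_has_derivative[OF h] 1(3)[OF mem[OF q]]]
      by (simp add: o_def)
    fix q' d assume q': "q' \<in> ball p (r1 / B)"
    have "norm (f' (h q) (h d) - f' (h q') (h d)) \<le> K1 * norm (h q - h q') * norm (h d)"
      by (rule 1(4)[OF mem[OF q] mem[OF q']])
    also have "\<dots> \<le> K1 * (norm (q - q') * B) * (norm d * B)"
      using 1 B by (intro mult_mono mult_left_mono) (auto simp: linear_diff[OF bounded_linear.linear[OF h], symmetric])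
    finally show "norm (f' (h q) (h d) - f' (h q') (h d)) \<le> K1 * B * B * norm (q - q') * norm d"
      by (simp add: algebra_simps)
  qed
qed

lemma C1_lipschitz_near_Pair:
  assumes f: "C1_lipschitz_near f f' p" and g: "C1_lipschitz_near g g' p"
  shows "C1_lipschitz_near (\<lambda>x. (f x, g x)) (\<lambda>x d. (f' x d, g' x d)) p"
proof -
  have "C1_lipschitz_near (\<lambda>x. (f x, 0) + (0, g x)) (\<lambda>x d. (f' x d, 0) + (0, g' x d)) p"
    by (intro C1_lipschitz_near_add C1_lipschitz_near_linear_comp[OF _ f] C1_lipschitz_near_linear_comp[OF _ g]
        bounded_linear_Pair bounded_linear_ident bounded_linear_zero)
  then show ?thesis by simp
qed

lemma C1_lipschitz_near_taylor:
  assumes "C1_lipschitz_near g g' p"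
  obtains r K where "0 < r" "0 \<le> K"
    "\<And>q q'. q \<in> ball p r \<Longrightarrow> q' \<in> ball p r \<Longrightarrow> norm (g q' - g q - g' q (q' - q)) \<le> K * (norm (q' - q))\<^sup>2"
proof -
  from assms obtain r K where rK: "0 < r" "0 \<le> K"
    and der: "\<And>q. q \<in> ball p r \<Longrightarrow> (g has_derivative g' q) (at q)"
    and lip: "\<And>q q' d. q \<in> ball p r \<Longrightarrow> q' \<in> ball p r \<Longrightarrow> norm (g' q d - g' q' d) \<le> K * norm (q - q') * norm d"
    unfolding C1_lipschitz_near_def by blast
  have "norm (g q' - g q - g' q (q' - q)) \<le> K * (norm (q' - q))\<^sup>2" if q: "q \<in> ball p r" "q' \<in> ball p r" for q q'
  proof -
    have "norm (g q' - g q - g' q (q' - q)) \<le> norm (q' - q) * (K * norm (q' - q))"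
    proof (rule differentiable_bound_linearization[where S="closed_segment q q'"])
      have seg: "closed_segment q q' \<subseteq> ball p r" using q by (intro closed_segment_subset) auto
      show "q + t *\<^sub>R (q' - q) \<in> closed_segment q q'" if "t \<in> {0..1}" for t
        using that unfolding closed_segment_def by (auto simp: algebra_simps intro!: exI[of _ t])
      show "q \<in> closed_segment q q'" by simp
      fix x assume x: "x \<in> closed_segment q q'"
      show "(g has_derivative g' x) (at x within closed_segment q q')"
        using der x seg has_derivative_at_withinI by blast
      show "onorm (g' x - g' q) \<le> K * norm (q' - q)"
      proof (rule onorm_bound)
        show "0 \<le> K * norm (q' - q)" using rK by simp
        fix d
        have "norm (g' x d - g' q d) \<le> K * norm (x - q) * norm d" using lip x seg q by blast
        also have "\<dots> \<le> K * norm (q' - q) * norm d"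
          using segment_bound(1)[OF x] rK by (intro mult_right_mono mult_left_mono) auto
        finally show "norm ((g' x - g' q) d) \<le> K * norm (q' - q) * norm d" by simp
      qed
    qed
    then show ?thesis by (simp add: power2_eq_square algebra_simps)
  qed
  then show ?thesis using that rK by blast
qed

text \<open>A function whose derivative is itself continuously differentiable has a locally Lipschitz derivative.\<close>

lemma C1_lipschitz_near_of_derivative:
  fixes f' :: "'a::real_normed_vector \<Rightarrow> 'a \<Rightarrow>\<^sub>L 'b::real_normed_vector"
  assumes f: "C1_lipschitz_near f' f'' p"
    and "\<forall>\<^sub>F q in nhds p. (f has_derivative blinfun_apply (f' q)) (at q)"
  shows "C1_lipschitz_near f (\<lambda>q. blinfun_apply (f' q)) p"
proof -
  obtain r1 where r1: "0 < r1" "\<And>q. q \<in> ball p r1 \<Longrightarrow> (f has_derivative blinfun_apply (f' q)) (at q)"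
    using assms(2) unfolding eventually_nhds_metric by (auto simp: dist_commute)
  from f obtain r2 K2 where 2: "0 < r2" "0 \<le> K2"
    "\<And>q q'. q \<in> ball p r2 \<Longrightarrow> q' \<in> ball p r2 \<Longrightarrow> norm (f' q - f' q') \<le> K2 * norm (q - q')"
    by (rule C1_lipschitz_nearE) blast
  show ?thesis unfolding C1_lipschitz_near_def
  proof (intro exI conjI ballI allI)
    show "0 < min r1 r2" "0 \<le> K2" using r1 2 by auto
    fix q assume q: "q \<in> ball p (min r1 r2)"
    show "(f has_derivative blinfun_apply (f' q)) (at q)" using r1 q by auto
    fix q' d assume q': "q' \<in> ball p (min r1 r2)"
    have "norm ((f' q - f' q') d) \<le> norm (f' q - f' q') * norm d" by (rule norm_blinfun)
    also have "\<dots> \<le> K2 * norm (q - q') * norm d" using 2(3)[of q q'] q q' by (intro mult_right_mono) auto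
    finally show "norm (f' q d - f' q' d) \<le> K2 * norm (q - q') * norm d"
      by (simp add: blinfun.diff_left)
  qed
qed

text \<open>The second difference \<open>f(p + h d + h e) - f(p + h e) - f(p + h d) + f p\<close> is symmetric in \<open>d\<close> and \<open>e\<close>. The mean value
  inequality, applied to a first difference in direction \<open>d\<close> as a function of the displacement along \<open>e\<close>,
  shows that it equals \<open>h\<^sup>2 f''(p) d e\<close> up to \<open>O(h\<^sup>3)\<close>.
  Symmetry is needed because the gradient of the quadratic program involves the symmetrized Hessian, whereas the Newton
  equation involves the Hessian itself.\<close>

lemma second_derivative_symmetric:
  fixes f' :: "'a::real_normed_vector \<Rightarrow> 'a \<Rightarrow>\<^sub>L 'b::real_normed_vector"
  assumes f'': "C1_lipschitz_near f' f'' p"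
    and ev: "\<forall>\<^sub>F q in nhds p. (f has_derivative blinfun_apply (f' q)) (at q)"
  shows "f'' p d e = f'' p e d"
proof -
  obtain r1 where r1: "0 < r1" "\<And>q. q \<in> ball p r1 \<Longrightarrow> (f has_derivative blinfun_apply (f' q)) (at q)"
    using ev unfolding eventually_nhds_metric by (auto simp: dist_commute)
  obtain r2 K2 where 2: "0 < r2" "0 \<le> K2"
    "\<And>q q'. q \<in> ball p r2 \<Longrightarrow> q' \<in> ball p r2 \<Longrightarrow> norm (f' q' - f' q - f'' q (q' - q)) \<le> K2 * (norm (q' - q))\<^sup>2"
    using C1_lipschitz_near_taylor[OF f''] by blast
  from f'' obtain r3 K3 where 3: "0 < r3" "0 \<le> K3"
    "\<And>q q' d. q \<in> ball p r3 \<Longrightarrow> q' \<in> ball p r3 \<Longrightarrow> norm (f'' q d - f'' q' d) \<le> K3 * norm (q - q') * norm d"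
    and der: "\<And>q. q \<in> ball p r3 \<Longrightarrow> (f' has_derivative f'' q) (at q)"
    unfolding C1_lipschitz_near_def by blast
  define r where "r = min r1 (min r2 r3)"
  have r: "0 < r" using r1 2 3 by (auto simp: r_def)
  have blp: "bounded_linear (f'' p)" using der[of p] 3(1) has_derivative_bounded_linear by auto
  have half: "norm (f (p + h *\<^sub>R d + h *\<^sub>R e) - f (p + h *\<^sub>R e) - (f (p + h *\<^sub>R d) - f p) - h\<^sup>2 *\<^sub>R f'' p d e)
      \<le> (K2 + K3) * norm e * (norm d + norm e)\<^sup>2 * h ^ 3" (is "norm ?X \<le> _")
    if h: "0 < h" "h * (norm d + norm e) < r" for h d e
  proof -
    \<comment> \<open>Subtracting the expected linear part makes the derivative of the first difference \<open>O(h\<^sup>2)\<close> on the segment.\<close>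
    define g where "g v = f (p + h *\<^sub>R d + v) - f (p + v) - blinfun_apply (f'' p (h *\<^sub>R d)) v" for v
    let ?C = "(K2 + K3) * (norm d + norm e)\<^sup>2 * h\<^sup>2"
    have "norm (g (h *\<^sub>R e) - g 0) \<le> ?C * norm (h *\<^sub>R e - 0)"
    proof (rule differentiable_bound[where S="cball 0 (h * norm e)"
          and f'="\<lambda>v w. f' (p + h *\<^sub>R d + v) w - f' (p + v) w - f'' p (h *\<^sub>R d) w"])
      fix v :: 'a assume "v \<in> cball 0 (h * norm e)"
      then have v: "norm v \<le> h * norm e" by simp
      have n1: "norm (h *\<^sub>R d + v) \<le> h * (norm d + norm e)"
        using norm_triangle_ineq[of "h *\<^sub>R d" v] v h(1) by (simp add: algebra_simps)
      have n2: "norm v \<le> h * (norm d + norm e)"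
      proof -
        have "0 \<le> h * norm d" using h(1) by simp
        then show ?thesis using v by (simp add: distrib_left)
      qed
      have n3: "norm (h *\<^sub>R d) \<le> h * (norm d + norm e)" using h(1) by (simp add: algebra_simps)
      have dist_add: "dist p (p + x) = norm x" for x by (simp add: dist_norm)
      have m: "p + h *\<^sub>R d + v \<in> ball p r" "p + v \<in> ball p r"
        using n1 n2 h dist_add by (simp_all add: add.assoc)
      have mm: "p + h *\<^sub>R d + v \<in> ball p r1" "p + v \<in> ball p r1" "p + h *\<^sub>R d + v \<in> ball p r2" "p + v \<in> ball p r2"
         "p + v \<in> ball p r3" "p \<in> ball p r3" using m 3(1) by (auto simp: r_def)
      have dd: "((\<lambda>v. f (a + v)) has_derivative blinfun_apply (f' (a + v))) (at v)"
        if "a + v \<in> ball p r1" for a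
      proof -
        have "((\<lambda>v. a + v) has_derivative (\<lambda>w. w)) (at v)" by (auto intro!: derivative_eq_intros)
        from has_derivative_compose[OF this r1(2)[OF that]] show ?thesis by simp
      qed
      show "(g has_derivative (\<lambda>w. f' (p + h *\<^sub>R d + v) w - f' (p + v) w - f'' p (h *\<^sub>R d) w)) (at v within cball 0 (h * norm e))"
        unfolding g_def
        by (intro has_derivative_diff has_derivative_at_withinI[OF dd] mm
            bounded_linear_imp_has_derivative blinfun.bounded_linear_right)
      have s1: "norm (f' (p + h *\<^sub>R d + v) - f' (p + v) - f'' (p + v) (h *\<^sub>R d)) \<le> K2 * (norm (h *\<^sub>R d))\<^sup>2"
        using 2(3)[OF mm(4,3)] by simp
      have s2: "norm (f'' (p + v) (h *\<^sub>R d) - f'' p (h *\<^sub>R d)) \<le> K3 * norm v * norm (h *\<^sub>R d)"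
        using 3(3)[OF mm(5,6), of "h *\<^sub>R d"] by simp
      have "norm (f' (p + h *\<^sub>R d + v) - f' (p + v) - f'' p (h *\<^sub>R d)) \<le> K2 * (norm (h *\<^sub>R d))\<^sup>2 + K3 * norm v * norm (h *\<^sub>R d)"
        using norm_triangle_ineq[of "f' (p + h *\<^sub>R d + v) - f' (p + v) - f'' (p + v) (h *\<^sub>R d)" "f'' (p + v) (h *\<^sub>R d) - f'' p (h *\<^sub>R d)"] s1 s2
        by simp
      also have "\<dots> \<le> K2 * (h * (norm d + norm e))\<^sup>2 + K3 * (h * (norm d + norm e)) * (h * (norm d + norm e))"
        using n2 n3 2 3 h(1) by (intro add_mono mult_left_mono mult_mono power_mono) auto
      also have "\<dots> = ?C" by (simp add: power2_eq_square algebra_simps)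
      finally have fin: "norm (f' (p + h *\<^sub>R d + v) - f' (p + v) - f'' p (h *\<^sub>R d)) \<le> ?C" .
      show "onorm (\<lambda>w. f' (p + h *\<^sub>R d + v) w - f' (p + v) w - f'' p (h *\<^sub>R d) w) \<le> ?C"
      proof (rule onorm_bound)
        show "0 \<le> ?C" using 2(2) 3(2) by simp
        fix w
        show "norm (f' (p + h *\<^sub>R d + v) w - f' (p + v) w - f'' p (h *\<^sub>R d) w) \<le> ?C * norm w"
          using order_trans[OF norm_blinfun mult_right_mono[OF fin]]
          by (simp add: blinfun.diff_left[symmetric])
      qed
    qed (use h in auto)
    moreover have "g (h *\<^sub>R e) - g 0 = ?X"
      using linear_scale[OF bounded_linear.linear[OF blp]]
      by (simp add: g_def blinfun.scaleR_left blinfun.scaleR_right blinfun.zero_right power2_eq_square)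
    ultimately show ?thesis using h(1) by (simp add: power2_eq_square power3_eq_cube algebra_simps)
  qed
  let ?S = "norm d + norm e" and ?D = "norm (f'' p d e - f'' p e d)"
  let ?C = "(K2 + K3) * norm e * ?S\<^sup>2 + (K2 + K3) * norm d * ?S\<^sup>2"
  have bnd: "?D \<le> ?C * h" if h: "0 < h" "h * ?S < r" for h
  proof -
    let ?Y = "f (p + h *\<^sub>R d + h *\<^sub>R e) - f (p + h *\<^sub>R e) - (f (p + h *\<^sub>R d) - f p)"
    have 1: "norm (?Y - h\<^sup>2 *\<^sub>R f'' p d e) \<le> (K2 + K3) * norm e * ?S\<^sup>2 * h ^ 3"
      using half[OF h] .
    have 2: "norm (?Y - h\<^sup>2 *\<^sub>R f'' p e d) \<le> (K2 + K3) * norm d * ?S\<^sup>2 * h ^ 3"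
      using half[of h e d] h by (simp add: algebra_simps)
    have "h\<^sup>2 * ?D = norm ((?Y - h\<^sup>2 *\<^sub>R f'' p e d) - (?Y - h\<^sup>2 *\<^sub>R f'' p d e))"
      by (simp add: scaleR_diff_right[symmetric])
    also have "\<dots> \<le> ?C * h ^ 3"
      using norm_triangle_ineq4[of "?Y - h\<^sup>2 *\<^sub>R f'' p e d" "?Y - h\<^sup>2 *\<^sub>R f'' p d e"] 1 2
      by (simp add: algebra_simps)
    also have "\<dots> = h\<^sup>2 * (?C * h)" by (simp add: power2_eq_square power3_eq_cube)
    finally show ?thesis using h(1) by simp
  qed
  have "((\<lambda>h. ?C * h) \<longlongrightarrow> ?C * 0) (at_right 0)" by (intro tendsto_intros)
  moreover have "\<forall>\<^sub>F h in at_right 0. ?D \<le> ?C * h"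
  proof -
    have "((\<lambda>h. h * ?S) \<longlongrightarrow> 0 * ?S) (at_right 0)" by (intro tendsto_intros)
    then have "\<forall>\<^sub>F h in at_right 0. h * ?S < r" using r by (intro order_tendstoD(2)[where a=r]) auto
    moreover have "\<forall>\<^sub>F h::real in at_right 0. 0 < h" by (simp add: eventually_at_right_less)
    ultimately show ?thesis by eventually_elim (use bnd in auto)
  qed
  ultimately have "?D \<le> ?C * 0" by (intro tendsto_lowerbound) auto
  then show ?thesis by simp
qed



lemma C1_lipschitz_near_nearby:
  assumes "C1_lipschitz_near g g' p"
  shows "\<forall>\<^sub>F q in nhds p. C1_lipschitz_near g g' q"
proof -
  from assms obtain r K where rK: "0 < r" "0 \<le> K"
    and der: "\<And>q. q \<in> ball p r \<Longrightarrow> (g has_derivative g' q) (at q)"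
    and lip: "\<And>q q' d. q \<in> ball p r \<Longrightarrow> q' \<in> ball p r \<Longrightarrow> norm (g' q d - g' q' d) \<le> K * norm (q - q') * norm d"
    unfolding C1_lipschitz_near_def by blast
  have "C1_lipschitz_near g g' q" if q: "q \<in> ball p r" for q
  proof -
    obtain e where "0 < e" "ball q e \<subseteq> ball p r" using openE[OF open_ball q] by blast
    then show ?thesis unfolding C1_lipschitz_near_def using der lip rK by (meson subsetD)
  qed
  then show ?thesis using rK eventually_nhds_ball[of r p] by (auto elim: eventually_mono)
qed

section \<open>Lagrangians and their derivatives\<close>

definition C2_data :: "('a::real_normed_vector \<Rightarrow> 'b::real_normed_vector) \<Rightarrow> ('a \<Rightarrow> 'a \<Rightarrow>\<^sub>L 'b)
    \<Rightarrow> ('a \<Rightarrow> 'a \<Rightarrow> 'a \<Rightarrow>\<^sub>L 'b) \<Rightarrow> 'a \<Rightarrow> bool" where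
  "C2_data f f' f'' p \<longleftrightarrow>
     (\<forall>\<^sub>F q in nhds p. (f has_derivative blinfun_apply (f' q)) (at q)) \<and> C1_lipschitz_near f' f'' p"

lemma C2_data_nearby:
  assumes "C2_data f f' f'' p"
  shows "\<forall>\<^sub>F q in nhds p. C2_data f f' f'' q"
proof -
  have "\<forall>\<^sub>F q in nhds p. \<forall>\<^sub>F q' in nhds q. (f has_derivative blinfun_apply (f' q')) (at q')"
    using assms unfolding C2_data_def by (metis eventually_eventually)
  moreover have "\<forall>\<^sub>F q in nhds p. C1_lipschitz_near f' f'' q"
    using assms C1_lipschitz_near_nearby unfolding C2_data_def by blast
  ultimately show ?thesis by eventually_elim (simp add: C2_data_def)
qed

lemma C2_dataD:
  assumes "C2_data f f' f'' p"
  shows "(f has_derivative blinfun_apply (f' p)) (at p)" "(f' has_derivative f'' p) (at p)"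
    "C1_lipschitz_near f (\<lambda>q. blinfun_apply (f' q)) p"
proof -
  show "(f has_derivative blinfun_apply (f' p)) (at p)"
    using assms unfolding C2_data_def by (metis eventually_nhds_x_imp_x)
  show "(f' has_derivative f'' p) (at p)"
    using assms unfolding C2_data_def C1_lipschitz_near_def by auto
  show "C1_lipschitz_near f (\<lambda>q. blinfun_apply (f' q)) p"
    using assms C1_lipschitz_near_of_derivative unfolding C2_data_def by blast
qed

lemma C2_lipschitz_near_imp_data:
  fixes f :: "'a::real_normed_vector \<Rightarrow> 'b::real_normed_vector"
  assumes "C2_lipschitz_near f p"
  obtains f' f'' where "C2_data f f' f'' p"
proof -
  from assms obtain U f' f'' K where U: "open U" "p \<in> U"
    and d1: "\<forall>q\<in>U. (f has_derivative blinfun_apply (f' q)) (at q)"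
    and d2: "\<forall>q\<in>U. (f' has_derivative blinfun_apply (f'' q)) (at q)"
    and lip: "K-lipschitz_on U (f'' :: 'a \<Rightarrow> 'a \<Rightarrow>\<^sub>L 'a \<Rightarrow>\<^sub>L 'b)"
    unfolding C2_lipschitz_near_def by blast
  obtain r where r: "0 < r" "ball p r \<subseteq> U" using U open_contains_ball by metis
  have "C1_lipschitz_near f' (\<lambda>q d. f'' q d) p"
    unfolding C1_lipschitz_near_def
  proof (intro exI conjI ballI allI)
    show "0 < r" "0 \<le> K" using r lip lipschitz_on_nonneg by auto
    fix q assume q: "q \<in> ball p r"
    show "(f' has_derivative (\<lambda>d. f'' q d)) (at q)" using d2 q r by auto
    fix q' d :: 'a assume q': "q' \<in> ball p r"
    have "norm ((f'' q - f'' q') d) \<le> norm (f'' q - f'' q') * norm d" by (rule norm_blinfun)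
    also have "\<dots> \<le> K * norm (q - q') * norm d"
      using lipschitz_onD[OF lip subsetD[OF r(2) q] subsetD[OF r(2) q']] by (intro mult_right_mono) (auto simp: dist_norm)
    finally show "norm (f'' q d - f'' q' d) \<le> K * norm (q - q') * norm d"
      by (simp add: blinfun.diff_left)
  qed
  moreover have "\<forall>\<^sub>F q in nhds p. (f has_derivative blinfun_apply (f' q)) (at q)"
    using U d1 eventually_nhds by blast
  ultimately show ?thesis using that[of f' "\<lambda>q d. f'' q d"] unfolding C2_data_def by blast
qed

lemma C2_data_linear:
  assumes "bounded_linear h"
  shows "C2_data h (\<lambda>_. Blinfun h) (\<lambda>_ _. 0) p"
  unfolding C2_data_def
  using bounded_linear_imp_has_derivative[OF assms] C1_lipschitz_near_const
  by (auto simp: bounded_linear_Blinfun_apply[OF assms])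

lemma C2_data_add:
  assumes "C2_data f f' f'' p" "C2_data g g' g'' p"
  shows "C2_data (\<lambda>x. f x + g x) (\<lambda>x. f' x + g' x) (\<lambda>x d. f'' x d + g'' x d) p"
proof -
  have 1: "\<forall>\<^sub>F q in nhds p. (f has_derivative blinfun_apply (f' q)) (at q)"
    and 2: "\<forall>\<^sub>F q in nhds p. (g has_derivative blinfun_apply (g' q)) (at q)"
    using assms unfolding C2_data_def by auto
  have "\<forall>\<^sub>F q in nhds p. ((\<lambda>x. f x + g x) has_derivative blinfun_apply (f' q + g' q)) (at q)"
    using 1 2
  proof eventually_elim
    case (elim q)
    have "blinfun_apply (f' q + g' q) = (\<lambda>d. f' q d + g' q d)" by (auto simp: blinfun.add_left)
    then show ?case using has_derivative_add[OF elim] by simp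
  qed
  then show ?thesis using assms C1_lipschitz_near_add unfolding C2_data_def by blast
qed

lemma C2_data_linear_comp:
  assumes h: "bounded_linear h" and f: "C2_data f f' f'' p"
  shows "C2_data (\<lambda>x. h (f x)) (\<lambda>x. Blinfun h o\<^sub>L f' x) (\<lambda>x d. Blinfun h o\<^sub>L f'' x d) p"
proof -
  have 1: "\<forall>\<^sub>F q in nhds p. (f has_derivative blinfun_apply (f' q)) (at q)"
    using assms unfolding C2_data_def by auto
  have "\<forall>\<^sub>F q in nhds p. ((\<lambda>x. h (f x)) has_derivative blinfun_apply (Blinfun h o\<^sub>L f' q)) (at q)"
    using 1
  proof eventually_elim
    case (elim q)
    have "blinfun_apply (Blinfun h o\<^sub>L f' q) = (\<lambda>d. h (f' q d))"
      by (auto simp: bounded_linear_Blinfun_apply[OF h])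
    then show ?case using bounded_linear.has_derivative[OF h elim] by simp
  qed
  moreover have "C1_lipschitz_near (\<lambda>x. Blinfun h o\<^sub>L f' x) (\<lambda>x d. Blinfun h o\<^sub>L f'' x d) p"
    by (rule C1_lipschitz_near_linear_comp[OF bounded_bilinear.bounded_linear_right[OF bounded_bilinear_blinfun_compose]])
       (use f in \<open>simp add: C2_data_def\<close>)
  ultimately show ?thesis unfolding C2_data_def by blast
qed

lemma C2_data_comp_linear:
  assumes h: "bounded_linear h" and f: "C2_data f f' f'' (h p)"
  shows "C2_data (\<lambda>x. f (h x)) (\<lambda>x. f' (h x) o\<^sub>L Blinfun h) (\<lambda>x d. f'' (h x) (h d) o\<^sub>L Blinfun h) p"
proof -
  have 1: "\<forall>\<^sub>F q in nhds (h p). (f has_derivative blinfun_apply (f' q)) (at q)"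
    using assms unfolding C2_data_def by auto
  have "isCont h p" using h by (simp add: linear_continuous_at)
  then have "filterlim h (nhds (h p)) (nhds p)"
    by (simp add: isCont_def tendsto_at_iff_tendsto_nhds)
  from eventually_compose_filterlim[OF 1 this]
  have "\<forall>\<^sub>F q in nhds p. (f has_derivative blinfun_apply (f' (h q))) (at (h q))" .
  then have "\<forall>\<^sub>F q in nhds p. ((\<lambda>x. f (h x)) has_derivative blinfun_apply (f' (h q) o\<^sub>L Blinfun h)) (at q)"
  proof eventually_elim
    case (elim q)
    have "blinfun_apply (f' (h q) o\<^sub>L Blinfun h) = (\<lambda>d. f' (h q) (h d))"
      by (auto simp: bounded_linear_Blinfun_apply[OF h])
    then show ?case using has_derivative_compose[OF bounded_linear_imp_has_derivative[OF h] elim] by simp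
  qed
  moreover have "C1_lipschitz_near (\<lambda>x. f' (h x)) (\<lambda>x d. f'' (h x) (h d)) p"
    by (rule C1_lipschitz_near_comp_linear[OF h]) (use f in \<open>simp add: C2_data_def\<close>)
  then have "C1_lipschitz_near (\<lambda>x. f' (h x) o\<^sub>L Blinfun h) (\<lambda>x d. f'' (h x) (h d) o\<^sub>L Blinfun h) p"
    by (rule C1_lipschitz_near_linear_comp[OF bounded_bilinear.bounded_linear_left[OF bounded_bilinear_blinfun_compose]])
  ultimately show ?thesis unfolding C2_data_def by blast
qed

text \<open>The transpose of a linear map, applied to a multiplier. With \<open>real\<close> as codomain and the multiplier \<open>1\<close>, it is the Riesz
  representative, so that gradients of objectives and of constraints are expressed by the same bilinear operation.\<close>

definition adj :: "('a::euclidean_space \<Rightarrow>\<^sub>L 'b::real_inner) \<Rightarrow> 'b \<Rightarrow> 'a" where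
  "adj A l = (\<Sum>b\<in>Basis. (A b \<bullet> l) *\<^sub>R b)"

lemma adj_inner: "adj A l \<bullet> d = A d \<bullet> l"
proof -
  have "A d \<bullet> l = A (\<Sum>b\<in>Basis. (d \<bullet> b) *\<^sub>R b) \<bullet> l" by (simp add: euclidean_representation)
  also have "\<dots> = (\<Sum>b\<in>Basis. (d \<bullet> b) * (A b \<bullet> l))"
    by (simp add: blinfun.sum_right blinfun.scaleR_right inner_sum_left)
  also have "\<dots> = adj A l \<bullet> d"
    unfolding adj_def inner_sum_left inner_scaleR_left by (intro sum.cong) (simp_all add: inner_commute mult.commute)
  finally show ?thesis by simp
qed

lemma adj_inner': "d \<bullet> adj A l = A d \<bullet> l"
  by (metis adj_inner inner_commute)

lemma bounded_bilinear_adj: "bounded_bilinear (adj :: ('a::euclidean_space \<Rightarrow>\<^sub>L 'b::real_inner) \<Rightarrow> 'b \<Rightarrow> 'a)"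
proof
  show "adj (A + A') l = adj A l + adj A' l" for A A' :: "'a \<Rightarrow>\<^sub>L 'b" and l
    by (simp add: adj_def blinfun.add_left inner_add_left scaleR_add_left sum.distrib)
  show "adj A (l + l') = adj A l + adj A l'" for A :: "'a \<Rightarrow>\<^sub>L 'b" and l l'
    by (simp add: adj_def inner_add_right scaleR_add_left sum.distrib)
  show "adj (r *\<^sub>R A) l = r *\<^sub>R adj A l" for r and A :: "'a \<Rightarrow>\<^sub>L 'b" and l
    by (simp add: adj_def blinfun.scaleR_left scaleR_sum_right)
  show "adj A (r *\<^sub>R l) = r *\<^sub>R adj A l" for r and A :: "'a \<Rightarrow>\<^sub>L 'b" and l
    by (simp add: adj_def scaleR_sum_right)
  have "norm (adj A l) \<le> norm A * norm l * 1" for A :: "'a \<Rightarrow>\<^sub>L 'b" and l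
  proof -
    have "norm (adj A l) * norm (adj A l) = A (adj A l) \<bullet> l"
      by (metis adj_inner power2_eq_square power2_norm_eq_inner)
    also have "\<dots> \<le> norm (A (adj A l)) * norm l" by (rule norm_cauchy_schwarz)
    also have "\<dots> \<le> norm A * norm (adj A l) * norm l" by (intro mult_right_mono norm_blinfun) auto
    finally have "norm (adj A l) * norm (adj A l) \<le> norm (adj A l) * (norm A * norm l)" by (simp add: ac_simps)
    then show ?thesis by (cases "norm (adj A l) = 0") (auto simp: mult_le_cancel_left)
  qed
  then show "\<exists>K. \<forall>(A :: 'a \<Rightarrow>\<^sub>L 'b) l. norm (adj A l) \<le> norm A * norm l * K" by blast
qed

interpretation adj: bounded_bilinear adj by (rule bounded_bilinear_adj)

lemma grad_eq: "GDERIV f p :> D \<Longrightarrow> grad f p = D"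
proof -
  assume D: "GDERIV f p :> D"
  have "D' = D" if "GDERIV f p :> D'" for D'
  proof -
    have "(\<lambda>h. h \<bullet> D') = (\<lambda>h. h \<bullet> D)"
      using D that unfolding gderiv_def by (rule has_derivative_unique[rotated])
    from fun_cong[OF this, of "D' - D"] have "(D' - D) \<bullet> (D' - D) = 0" by (simp add: inner_diff_right)
    then show ?thesis by simp
  qed
  then show ?thesis unfolding grad_def using D by (rule the_equality[rotated])
qed

definition lagr_grad :: "('z::euclidean_space \<Rightarrow> 'z \<Rightarrow>\<^sub>L real) \<Rightarrow> ('z \<Rightarrow> 'z \<Rightarrow>\<^sub>L 'y::real_inner) \<Rightarrow> 'z \<Rightarrow> 'y \<Rightarrow> 'z" where
  "lagr_grad f' c' z l = adj (f' z) 1 + adj (c' z) l"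

definition lagr_hess :: "('z::euclidean_space \<Rightarrow> 'z \<Rightarrow> 'z \<Rightarrow>\<^sub>L real) \<Rightarrow> ('z \<Rightarrow> 'z \<Rightarrow> 'z \<Rightarrow>\<^sub>L 'y::real_inner)
    \<Rightarrow> 'z \<Rightarrow> 'y \<Rightarrow> 'z \<Rightarrow> 'z" where
  "lagr_hess f'' c'' z l d = adj (f'' z d) 1 + adj (c'' z d) l"

lemma lagr_hess_inner: "e \<bullet> lagr_hess f'' c'' z l d = f'' z d e + c'' z d e \<bullet> l"
  by (simp add: lagr_hess_def inner_add_right adj_inner')

lemma lagrangian_GDERIV:
  assumes "C2_data f f' f'' z" "C2_data c c' c'' z"
  shows "GDERIV (\<lambda>z. f z + c z \<bullet> l) z :> lagr_grad f' c' z l"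
proof -
  have "((\<lambda>z. f z + c z \<bullet> l) has_derivative (\<lambda>d. f' z d + c' z d \<bullet> l)) (at z)"
    using C2_dataD(1)[OF assms(1)] C2_dataD(1)[OF assms(2)]
    by (auto intro!: derivative_eq_intros)
  moreover have "(\<lambda>d. f' z d + c' z d \<bullet> l) = (\<lambda>d. d \<bullet> lagr_grad f' c' z l)"
    by (simp add: lagr_grad_def inner_add_right adj_inner')
  ultimately show ?thesis unfolding gderiv_def by simp
qed

lemma lagr_grad_has_derivative:
  assumes "C2_data f f' f'' z" "C2_data c c' c'' z"
  shows "((\<lambda>z. lagr_grad f' c' z l) has_derivative lagr_hess f'' c'' z l) (at z)"
proof -
  have 1: "((\<lambda>z. adj (f' z) 1) has_derivative (\<lambda>d. adj (f'' z d) 1)) (at z)"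
    by (rule bounded_linear.has_derivative[OF adj.bounded_linear_left C2_dataD(2)[OF assms(1)]])
  have 2: "((\<lambda>z. adj (c' z) l) has_derivative (\<lambda>d. adj (c'' z d) l)) (at z)"
    by (rule bounded_linear.has_derivative[OF adj.bounded_linear_left C2_dataD(2)[OF assms(2)]])
  show ?thesis unfolding lagr_grad_def lagr_hess_def[abs_def] by (intro has_derivative_add 1 2)
qed

lemma lagrangian_hess:
  assumes f: "C2_data f f' f'' z" and c: "C2_data c c' c'' z"
  shows "hess (\<lambda>z. f z + c z \<bullet> l) z = lagr_hess f'' c'' z l"
proof -
  have ev: "\<forall>\<^sub>F q in nhds z. grad (\<lambda>z. f z + c z \<bullet> l) q = lagr_grad f' c' q l"
    using C2_data_nearby[OF f] C2_data_nearby[OF c]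
    by eventually_elim (rule grad_eq[OF lagrangian_GDERIV])
  have "(grad (\<lambda>z. f z + c z \<bullet> l) has_derivative lagr_hess f'' c'' z l) (at z)"
    by (rule has_derivative_transform_eventually[OF lagr_grad_has_derivative[OF f c, of l]])
       (use ev eventually_nhds_x_imp_x[OF ev] in \<open>auto simp: eventually_at_filter elim: eventually_mono\<close>)
  then show ?thesis unfolding hess_def by (rule frechet_derivative_at[symmetric])
qed

lemma lagr_hess_symmetric:
  assumes f: "C2_data f f' f'' z" and c: "C2_data c c' c'' z"
  shows "d \<bullet> lagr_hess f'' c'' z l e = e \<bullet> lagr_hess f'' c'' z l d"
  using second_derivative_symmetric[of f' f'' z f d e] second_derivative_symmetric[of c' c'' z c d e] f c
  by (simp add: lagr_hess_inner C2_data_def)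

lemma bounded_linear_lagr_hess:
  assumes f: "C2_data f f' f'' z" and c: "C2_data c c' c'' z"
  shows "bounded_linear (lagr_hess f'' c'' z l)"
  using lagr_grad_has_derivative[OF f c] by (rule has_derivative_bounded_linear)

section \<open>Newton's method near a regular zero\<close>

text \<open>Injectivity at the zero is a lower bound \<open>\<parallel>G'(p) d\<parallel> \<ge> B \<parallel>d\<parallel>\<close>, which by Lipschitz continuity persists nearby with
  \<open>B / 2\<close>. The last estimate says that a full Newton step from \<open>w\<close> to \<open>w'\<close> leaves a residual of second order.\<close>

lemma newton_neighbourhood:
  fixes G :: "'w::euclidean_space \<Rightarrow> 'w"
  assumes G: "C1_lipschitz_near G G' p" and G0: "G p = 0"
    and inj: "\<And>d. G' p d = 0 \<Longrightarrow> d = 0"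
  obtains r C where "0 < r" "0 < C"
    "\<And>w. w \<in> ball p r \<Longrightarrow> linear (G' w)"
    "\<And>w d. w \<in> ball p r \<Longrightarrow> norm d \<le> C * norm (G' w d)"
    "\<And>w y. w \<in> ball p r \<Longrightarrow> \<exists>d. G' w d = y"
    "\<And>w. w \<in> ball p r \<Longrightarrow> norm (w - p) \<le> C * norm (G w)"
    "\<And>w. w \<in> ball p r \<Longrightarrow> norm (G w) \<le> C * norm (w - p)"
    "\<And>w w'. w \<in> ball p r \<Longrightarrow> w' \<in> ball p r \<Longrightarrow> norm (G w' - G w - G' w (w' - w)) \<le> C * (norm (w' - w))\<^sup>2"
proof -
  from G obtain r1 K1 where 1: "0 < r1" "0 \<le> K1"
    "\<And>q. q \<in> ball p r1 \<Longrightarrow> (G has_derivative G' q) (at q)"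
    "\<And>q q' d. q \<in> ball p r1 \<Longrightarrow> q' \<in> ball p r1 \<Longrightarrow> norm (G' q d - G' q' d) \<le> K1 * norm (q - q') * norm d"
    "\<And>q q'. q \<in> ball p r1 \<Longrightarrow> q' \<in> ball p r1 \<Longrightarrow> norm (G q - G q') \<le> K1 * norm (q - q')"
    by (rule C1_lipschitz_nearE) blast
  obtain r2 K2 where 2: "0 < r2" "0 \<le> K2"
    "\<And>q q'. q \<in> ball p r2 \<Longrightarrow> q' \<in> ball p r2 \<Longrightarrow> norm (G q' - G q - G' q (q' - q)) \<le> K2 * (norm (q' - q))\<^sup>2"
    using C1_lipschitz_near_taylor[OF G] by blast
  have lin: "linear (G' w)" if "w \<in> ball p r1" for w
    using 1(3)[OF that] has_derivative_linear by blast
  have linp: "linear (G' p)" using lin 1(1) by simp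
  have "inj (G' p)" using linear_injective_0[OF linp] inj by blast
  from linear_inj_bounded_below_pos[OF linp this]
  obtain B where B: "0 < B" "\<And>d. B * norm d \<le> norm (G' p d)" by blast
  \<comment> \<open>The two last radii keep the variation of \<open>G'\<close> below \<open>B / 2\<close> and the Taylor remainder below \<open>B / 4 * norm (w - p)\<close>.\<close>
  define r where "r = min (min r1 r2) (min (B / (2 * (K1 + 1))) (B / (4 * (K2 + 1))))"
  have r: "0 < r" "r \<le> r1" "r \<le> r2" "r \<le> B / (2 * (K1 + 1))" "r \<le> B / (4 * (K2 + 1))"
    using 1(1,2) 2(1,2) B(1) by (auto simp: r_def)
  have sub: "w \<in> ball p r1" "w \<in> ball p r2" if "w \<in> ball p r" for w using that r by auto
  have below: "B / 2 * norm d \<le> norm (G' w d)" if w: "w \<in> ball p r" for w d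
  proof -
    have "K1 * norm (p - w) \<le> (K1 + 1) * (B / (2 * (K1 + 1)))"
      using w r 1(2) by (intro mult_mono) (auto simp: dist_norm)
    also have "\<dots> = B / 2" using 1(2) by (simp add: field_simps)
    finally have k: "K1 * norm (p - w) * norm d \<le> B / 2 * norm d" by (intro mult_right_mono) auto
    have "B * norm d \<le> norm (G' p d)" by (rule B)
    also have "\<dots> \<le> norm (G' w d) + norm (G' p d - G' w d)" by norm
    also have "norm (G' p d - G' w d) \<le> K1 * norm (p - w) * norm d"
      using 1(1) sub(1)[OF w] by (intro 1(4)) auto
    finally show ?thesis using k by (simp add: field_simps)
  qed
  define C where "C = max (4 / B) (max K1 K2)"
  have C: "4 / B \<le> C" "K1 \<le> C" "K2 \<le> C" "0 < C"
    using B(1) by (auto simp: C_def less_max_iff_disj)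
  have C2: "2 / B \<le> C" using C(1) B(1) by (simp add: field_simps)
  show ?thesis
  proof (rule that[of r C])
    show "linear (G' w)" if "w \<in> ball p r" for w using lin sub that by blast
    show low: "norm d \<le> C * norm (G' w d)" if "w \<in> ball p r" for w d
    proof -
      have "norm d = (2 / B) * (B / 2 * norm d)" using B(1) by simp
      also have "\<dots> \<le> (2 / B) * norm (G' w d)" using below[OF that] B(1) by (intro mult_left_mono) auto
      also have "\<dots> \<le> C * norm (G' w d)" using C2 by (intro mult_right_mono) auto
      finally show ?thesis .
    qed
    show "\<exists>d. G' w d = y" if w: "w \<in> ball p r" for w y
    proof -
      have "inj (G' w)"
      proof (subst linear_injective_0[OF lin[OF sub(1)[OF w]]], intro allI impI)
        fix d assume "G' w d = 0" then show "d = 0" using low[OF w, of d] by simp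
      qed
      then have "surj (G' w)" using linear_injective_imp_surjective lin[OF sub(1)[OF w]] by blast
      then show ?thesis by (metis surjD)
    qed
    show "norm (w - p) \<le> C * norm (G w)" if w: "w \<in> ball p r" for w
    proof -
      have n: "norm (w - p) \<le> B / (4 * (K2 + 1))" using w r by (auto simp: dist_norm norm_minus_commute)
      have "K2 * (norm (w - p))\<^sup>2 = (K2 * norm (w - p)) * norm (w - p)" by (simp add: power2_eq_square)
      also have "K2 * norm (w - p) \<le> (K2 + 1) * (B / (4 * (K2 + 1)))"
        using n 2(2) by (intro mult_mono) auto
      also have "\<dots> = B / 4" using 2(2) by (simp add: field_simps)
      finally have k: "K2 * (norm (w - p))\<^sup>2 \<le> B / 4 * norm (w - p)" by (simp add: mult_right_mono)
      have "norm (G w - G p - G' p (w - p)) \<le> K2 * (norm (w - p))\<^sup>2"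
        using 2(1) sub(2)[OF w] by (intro 2(3)) auto
      moreover have "B * norm (w - p) \<le> norm (G' p (w - p))" by (rule B)
      moreover have "norm (G' p (w - p)) \<le> norm (G w) + norm (G w - G p - G' p (w - p))"
        using G0 norm_triangle_ineq4[of "G w" "G w - G' p (w - p)"] by simp
      ultimately have "B * norm (w - p) \<le> norm (G w) + B / 4 * norm (w - p)" using k by linarith
      then have "B / 4 * norm (w - p) \<le> norm (G w)" using mult_nonneg_nonneg[of B "norm (w - p)"] B(1) norm_ge_zero[of "w - p"] by linarith
      then have "norm (w - p) \<le> 4 / B * norm (G w)" using B(1) by (simp add: field_simps)
      also have "\<dots> \<le> C * norm (G w)" using C by (intro mult_right_mono) auto
      finally show ?thesis .
    qed
    show "norm (G w) \<le> C * norm (w - p)" if w: "w \<in> ball p r" for w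
    proof -
      have "norm (G w - G p) \<le> K1 * norm (w - p)" using 1(1) sub(1)[OF w] by (intro 1(5)) auto
      also have "\<dots> \<le> C * norm (w - p)" using C by (intro mult_right_mono) auto
      finally show ?thesis using G0 by simp
    qed
    show "norm (G w' - G w - G' w (w' - w)) \<le> C * (norm (w' - w))\<^sup>2"
      if "w \<in> ball p r" "w' \<in> ball p r" for w w'
      using order_trans[OF 2(3)[OF sub(2)[OF that(1)] sub(2)[OF that(2)]] mult_right_mono[OF C(3)]] by simp
  qed (use r C in auto)
qed

section \<open>Quadratic programs\<close>

text \<open>Finsler's lemma: a form that is positive on the kernel of \<open>B\<close> becomes positive definite when a large multiple of
  \<open>\<parallel>B h\<parallel>\<^sup>2\<close> is added. Extracting a convergent subsequence of unit vectors also takes care of a parameter \<open>w\<close>, so the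
  constants are uniform near \<open>p\<close>. The set \<open>S\<close> contains the parameters at which \<open>Q\<close> and \<open>B\<close> are known to be
  homogeneous.\<close>

lemma finsler_uniform:
  fixes Q :: "'w::real_normed_vector \<Rightarrow> 'z::euclidean_space \<Rightarrow> real" and B :: "'w \<Rightarrow> 'z \<Rightarrow> 'y::real_normed_vector"
  assumes Qc: "\<And>h. isCont (\<lambda>(w, h). Q w h) (p, h)" and Bc: "\<And>h. isCont (\<lambda>(w, h). B w h) (p, h)"
    and Qh: "\<And>w t h. w \<in> S \<Longrightarrow> Q w (t *\<^sub>R h) = t\<^sup>2 * Q w h"
    and Bh: "\<And>w t h. w \<in> S \<Longrightarrow> B w (t *\<^sub>R h) = t *\<^sub>R B w h"
    and pos: "\<And>h. h \<noteq> 0 \<Longrightarrow> B p h = 0 \<Longrightarrow> 0 < Q p h"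
  obtains r M \<kappa> where "0 < r" "0 < M" "0 < \<kappa>"
    "\<And>w h. w \<in> ball p r \<Longrightarrow> w \<in> S \<Longrightarrow> \<kappa> * (norm h)\<^sup>2 \<le> Q w h + M * (norm (B w h))\<^sup>2"
proof -
  have "\<exists>n::nat. \<forall>w\<in>ball p (1 / Suc n). \<forall>h. norm h = 1 \<longrightarrow> 1 / Suc n \<le> Q w h + Suc n * (norm (B w h))\<^sup>2"
  proof (rule ccontr)
    assume "\<not> ?thesis"
    then have "\<forall>n::nat. \<exists>w h. w \<in> ball p (1 / Suc n) \<and> norm h = 1 \<and> Q w h + Suc n * (norm (B w h))\<^sup>2 < 1 / Suc n"
      by (meson not_le)
    then obtain w h where wh: "\<And>n::nat. w n \<in> ball p (1 / Suc n)" "\<And>n. norm (h n) = 1"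
      "\<And>n::nat. Q (w n) (h n) + Suc n * (norm (B (w n) (h n)))\<^sup>2 < 1 / Suc n" by metis
    have "compact (sphere (0::'z) 1)" by simp
    moreover have "\<forall>n. h n \<in> sphere 0 1" using wh(2) by simp
    ultimately obtain h0 \<phi> where h0: "h0 \<in> sphere 0 1" "strict_mono \<phi>" "(h \<circ> \<phi>) \<longlonglongrightarrow> h0"
      unfolding compact_def by blast
    have inv0: "(\<lambda>n. 1 / real (Suc n)) \<longlonglongrightarrow> 0"
      using LIMSEQ_inverse_real_of_nat by (simp add: inverse_eq_divide)
    have "w \<longlonglongrightarrow> p"
    proof (rule metric_tendsto_imp_tendsto[OF inv0])
      show "\<forall>\<^sub>F n in sequentially. dist (w n) p \<le> dist (1 / real (Suc n)) 0"
        using wh(1) by (intro always_eventually allI) (auto simp: dist_commute less_imp_le)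
    qed
    then have "(w \<circ> \<phi>) \<longlonglongrightarrow> p" using h0(2) LIMSEQ_subseq_LIMSEQ by blast
    then have lim: "(\<lambda>n. (w (\<phi> n), h (\<phi> n))) \<longlonglongrightarrow> (p, h0)"
      using h0(3) by (auto intro!: tendsto_Pair simp: o_def)
    have Ql: "(\<lambda>n. Q (w (\<phi> n)) (h (\<phi> n))) \<longlonglongrightarrow> Q p h0"
      using isCont_tendsto_compose[OF Qc lim] by simp
    have Bl: "(\<lambda>n. B (w (\<phi> n)) (h (\<phi> n))) \<longlonglongrightarrow> B p h0"
      using isCont_tendsto_compose[OF Bc lim] by simp
    have invs: "(\<lambda>n. 1 / real (Suc (\<phi> n))) \<longlonglongrightarrow> 0"
      using LIMSEQ_subseq_LIMSEQ[OF inv0 h0(2)] by (simp add: o_def)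
    have "Q p h0 \<le> 0"
    proof (rule LIMSEQ_le[OF Ql invs], intro exI allI impI)
      fix n
      have "0 \<le> real (Suc (\<phi> n)) * (norm (B (w (\<phi> n)) (h (\<phi> n))))\<^sup>2" by simp
      then show "Q (w (\<phi> n)) (h (\<phi> n)) \<le> 1 / real (Suc (\<phi> n))" using wh(3)[of "\<phi> n"] by linarith
    qed
    moreover have "(norm (B p h0))\<^sup>2 \<le> 0"
    proof (rule LIMSEQ_le)
      show "(\<lambda>n. (norm (B (w (\<phi> n)) (h (\<phi> n))))\<^sup>2) \<longlonglongrightarrow> (norm (B p h0))\<^sup>2" by (intro tendsto_intros Bl)
      have "(\<lambda>n. 1 / real (Suc (\<phi> n)) * (1 / real (Suc (\<phi> n)) - Q (w (\<phi> n)) (h (\<phi> n)))) \<longlonglongrightarrow> 0 * (0 - Q p h0)"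
        by (intro tendsto_intros invs Ql)
      then show "(\<lambda>n. 1 / real (Suc (\<phi> n)) * (1 / real (Suc (\<phi> n)) - Q (w (\<phi> n)) (h (\<phi> n)))) \<longlonglongrightarrow> 0" by simp
      show "\<exists>N. \<forall>n\<ge>N. (norm (B (w (\<phi> n)) (h (\<phi> n))))\<^sup>2 \<le> 1 / real (Suc (\<phi> n)) * (1 / real (Suc (\<phi> n)) - Q (w (\<phi> n)) (h (\<phi> n)))"
      proof (intro exI allI impI)
        fix n
        have "real (Suc (\<phi> n)) * (norm (B (w (\<phi> n)) (h (\<phi> n))))\<^sup>2 \<le> 1 / real (Suc (\<phi> n)) - Q (w (\<phi> n)) (h (\<phi> n))"
          using wh(3)[of "\<phi> n"] by linarith
        then have "1 / real (Suc (\<phi> n)) * (real (Suc (\<phi> n)) * (norm (B (w (\<phi> n)) (h (\<phi> n))))\<^sup>2)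
          \<le> 1 / real (Suc (\<phi> n)) * (1 / real (Suc (\<phi> n)) - Q (w (\<phi> n)) (h (\<phi> n)))"
          by (rule mult_left_mono) simp
        then show "(norm (B (w (\<phi> n)) (h (\<phi> n))))\<^sup>2 \<le> 1 / real (Suc (\<phi> n)) * (1 / real (Suc (\<phi> n)) - Q (w (\<phi> n)) (h (\<phi> n)))"
          by simp
      qed
    qed
    then have "B p h0 = 0" by simp
    moreover have "h0 \<noteq> 0" using h0(1) by auto
    ultimately show False using pos[of h0] by simp
  qed
  then obtain n :: nat where n: "\<And>w h. w \<in> ball p (1 / Suc n) \<Longrightarrow> norm h = 1 \<Longrightarrow> 1 / Suc n \<le> Q w h + Suc n * (norm (B w h))\<^sup>2"
    by blast
  show ?thesis
  proof (rule that[of "1 / Suc n" "Suc n" "1 / Suc n"])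
    fix w h assume w: "w \<in> ball p (1 / real (Suc n))" and S: "w \<in> S"
    show "1 / real (Suc n) * (norm h)\<^sup>2 \<le> Q w h + real (Suc n) * (norm (B w h))\<^sup>2"
    proof (cases "h = 0")
      case True
      then show ?thesis using Qh[OF S, of 0 0] by simp
    next
      case False
      define k where "k = (1 / norm h) *\<^sub>R h"
      have hk: "h = norm h *\<^sub>R k" "norm k = 1" using False by (auto simp: k_def)
      have "(norm h)\<^sup>2 * (1 / Suc n) \<le> (norm h)\<^sup>2 * (Q w k + Suc n * (norm (B w k))\<^sup>2)"
        using n[OF w hk(2)] by (intro mult_left_mono) auto
      also have "\<dots> = Q w (norm h *\<^sub>R k) + Suc n * (norm (B w (norm h *\<^sub>R k)))\<^sup>2"
        by (simp add: Qh[OF S] Bh[OF S] power_mult_distrib algebra_simps)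
      finally show ?thesis using hk(1) by (simp add: algebra_simps)
    qed
  qed auto
qed

text \<open>Second-order sufficiency with strict complementarity, for \<open>I\<close> the set of active inequalities. For a feasible
  displacement \<open>h\<close>, the first-order term is \<open>\<Sum>i\<in>I. l\<^sub>i t\<^sub>i\<close> with \<open>t\<^sub>i = - (A h)\<^sub>i \<ge> 0\<close>; being linear in small numbers
  \<open>t\<^sub>i\<close>, it dominates the penalty \<open>M t\<^sub>i\<^sup>2 / 2\<close>. This gives a local minimum with an explicit radius.\<close>

lemma qp_local_min_sufficient:
  fixes H :: "'z::euclidean_space \<Rightarrow> 'z" and A :: "'z \<Rightarrow> real^'m::finite" and E :: "'z \<Rightarrow> 'y::real_inner"
  assumes H: "linear H" "\<And>d e. d \<bullet> H e = e \<bullet> H d" and A: "bounded_linear A" and E: "linear E"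
    and kkt: "\<And>h. (b + H d) \<bullet> h + A h \<bullet> l + E h \<bullet> m = 0"
    and feas: "E d + k1 = 0" "A d + k0 \<le> 0"
    and act: "\<And>i. i \<in> I \<Longrightarrow> (A d + k0) $ i = 0 \<and> 0 < l $ i" "\<And>i. i \<notin> I \<Longrightarrow> l $ i = 0"
    and pd: "\<And>h. E h = 0 \<Longrightarrow> 0 \<le> h \<bullet> H h + M * (\<Sum>i\<in>I. (A h $ i)\<^sup>2)" and M: "0 < M"
  shows "\<exists>r>0. \<forall>e. A e + k0 \<le> 0 \<and> E e + k1 = 0 \<and> dist e d < r \<longrightarrow>
     b \<bullet> d + 1/2 * (d \<bullet> H d) \<le> b \<bullet> e + 1/2 * (e \<bullet> H e)"
proof -
  obtain K where K: "0 < K" "\<And>h. norm (A h) \<le> norm h * K" using bounded_linear.pos_bounded[OF A] by blast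
  have "\<exists>s>0. \<forall>i\<in>I. s \<le> l $ i"
  proof (intro exI conjI ballI)
    show "0 < Min (insert 1 ((\<lambda>i. l $ i) ` I))" using act(1) by (subst Min_gr_iff) auto
    show "Min (insert 1 ((\<lambda>i. l $ i) ` I)) \<le> l $ i" if "i \<in> I" for i using that by (intro Min_le) auto
  qed
  then obtain s where s: "0 < s" "\<And>i. i \<in> I \<Longrightarrow> s \<le> l $ i" by blast
  show ?thesis
  proof (intro exI conjI allI impI)
    show "0 < 2 * s / (M * K)" using s M K by simp
    fix e assume e: "A e + k0 \<le> 0 \<and> E e + k1 = 0 \<and> dist e d < 2 * s / (M * K)"
    define h where "h = e - d"
    have ed: "e = d + h" by (simp add: h_def)
    have E0: "E h = 0"
    proof -
      have "E h = (E e + k1) - (E d + k1)" using linear_diff[OF E] by (simp add: h_def)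
      then show ?thesis using e feas by simp
    qed
    have Ah: "A h = A e - A d" using linear_diff[OF bounded_linear.linear[OF A]] by (simp add: h_def)
    have summand: "0 \<le> - (A h $ i * l $ i) - 1/2 * M * (A h $ i)\<^sup>2" if i: "i \<in> I" for i
    proof -
      define t where "t = - (A h $ i)"
      have "(A e + k0) $ i \<le> 0" using e by (simp add: less_eq_vec_def)
      then have t0: "0 \<le> t" using act(1)[OF i] Ah by (simp add: t_def)
      have "t \<le> norm (A h)" using component_le_norm_cart[of "A h" i] by (simp add: t_def)
      also have "\<dots> \<le> norm h * K" by (rule K)
      also have "\<dots> \<le> 2 * s / (M * K) * K" using e K by (intro mult_right_mono) (auto simp: h_def dist_norm)
      finally have "M * t \<le> 2 * s" using M K by (simp add: field_simps)
      then have "t * (M * t) \<le> t * (2 * l $ i)" using s(2)[OF i] t0 by (intro mult_left_mono) auto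
      then show ?thesis unfolding t_def by (simp add: power2_eq_square algebra_simps)
    qed
    have "A h \<bullet> l = (\<Sum>i\<in>I. A h $ i * l $ i)"
      unfolding inner_vec_def by (rule sum.mono_neutral_cong_right) (auto simp: act(2))
    moreover have "0 \<le> (\<Sum>i\<in>I. - (A h $ i * l $ i) - 1/2 * M * (A h $ i)\<^sup>2)" by (intro sum_nonneg summand)
    ultimately have Ahl: "1/2 * (M * (\<Sum>i\<in>I. (A h $ i)\<^sup>2)) \<le> - (A h \<bullet> l)"
      by (simp add: sum_subtractf sum_negf sum_distrib_left sum_divide_distrib)
    have "(b + H d) \<bullet> h = - (A h \<bullet> l)" using kkt[of h] E0 by simp
    moreover have "b \<bullet> e + 1/2 * (e \<bullet> H e) - (b \<bullet> d + 1/2 * (d \<bullet> H d)) = (b + H d) \<bullet> h + 1/2 * (h \<bullet> H h)"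
      using H(2)[of d h] inner_commute[of h "H d"]
      by (simp add: ed linear_add[OF H(1)] inner_add_left inner_add_right algebra_simps)
    moreover have "0 \<le> h \<bullet> H h + M * (\<Sum>i\<in>I. (A h $ i)\<^sup>2)" by (rule pd[OF E0])
    ultimately show "b \<bullet> d + 1/2 * (d \<bullet> H d) \<le> b \<bullet> e + 1/2 * (e \<bullet> H e)" using Ahl by linarith
  qed
qed

section \<open>The barrier parameter update\<close>

lemma mu_next_pos: "0 < cmu1 A \<Longrightarrow> 0 < \<mu> \<Longrightarrow> 0 < mu_next A \<mu>"
  by (simp add: mu_next_def)

lemma mu_next_le_powr:
  assumes "0 < \<mu>" shows "mu_next A \<mu> \<le> \<mu> * \<mu> powr (cmu2 A - 1)"
  using assms powr_mult_base[of \<mu> "cmu2 A - 1"] by (simp add: mu_next_def)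

lemma powr_small:
  assumes "0 < a" "0 < (\<delta>::real)"
  shows "\<exists>m>0. \<forall>\<mu>. 0 < \<mu> \<and> \<mu> \<le> m \<longrightarrow> \<mu> powr a \<le> \<delta>"
proof (intro exI conjI allI impI)
  show "0 < \<delta> powr (1 / a)" using assms by simp
  fix \<mu> assume m: "0 < \<mu> \<and> \<mu> \<le> \<delta> powr (1 / a)"
  then have "\<mu> powr a \<le> (\<delta> powr (1 / a)) powr a" using assms by (intro powr_mono2) auto
  also have "\<dots> = \<delta>" using assms by (simp add: powr_powr)
  finally show "\<mu> powr a \<le> \<delta>" .
qed

text \<open>The update is superlinear because \<open>c\<^sub>\<mu>\<^sub>,\<^sub>2 > 1\<close>.\<close>

lemma mu_next_small:
  assumes "1 < cmu2 A" "0 < \<delta>"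
  shows "\<exists>m>0. \<forall>\<mu>. 0 < \<mu> \<and> \<mu> \<le> m \<longrightarrow> mu_next A \<mu> \<le> \<delta> * \<mu>"
proof -
  obtain m where m: "0 < m" "\<And>\<mu>. 0 < \<mu> \<Longrightarrow> \<mu> \<le> m \<Longrightarrow> \<mu> powr (cmu2 A - 1) \<le> \<delta>"
    using powr_small[of "cmu2 A - 1" \<delta>] assms by auto
  have "mu_next A \<mu> \<le> \<delta> * \<mu>" if h: "0 < \<mu>" "\<mu> \<le> m" for \<mu>
  proof -
    have "mu_next A \<mu> \<le> \<mu> * \<mu> powr (cmu2 A - 1)" by (rule mu_next_le_powr[OF h(1)])
    also have "\<dots> \<le> \<mu> * \<delta>" using m(2)[OF h] h by (intro mult_left_mono) auto
    finally show ?thesis by (simp add: mult.commute)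
  qed
  then show ?thesis using m(1) by blast
qed

text \<open>The update is slower than quadratic because \<open>c\<^sub>\<mu>\<^sub>,\<^sub>2 < 2\<close>, so a residual of order \<open>\<mu>\<^sup>2\<close> is negligible at the next
  barrier parameter.\<close>

lemma mu_square_small:
  assumes "0 < cmu1 A" "cmu2 A < 2" "0 < \<delta>"
  shows "\<exists>m>0. \<forall>\<mu>. 0 < \<mu> \<and> \<mu> \<le> m \<longrightarrow> \<mu>\<^sup>2 \<le> \<delta> * mu_next A \<mu>"
proof -
  obtain m where m: "0 < m" "\<And>\<mu>. 0 < \<mu> \<Longrightarrow> \<mu> \<le> m \<Longrightarrow> \<mu> powr (2 - cmu2 A) \<le> \<delta>"
    using powr_small[of "2 - cmu2 A" \<delta>] assms by auto
  have "\<mu>\<^sup>2 \<le> \<delta> * mu_next A \<mu>" if h: "0 < \<mu>" "\<mu> \<le> min m (\<delta> * cmu1 A)" for \<mu>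
  proof -
    have "\<mu>\<^sup>2 = \<mu> powr (2 - cmu2 A) * \<mu> powr cmu2 A" using h by (simp add: powr_add[symmetric])
    also have "\<dots> \<le> \<delta> * \<mu> powr cmu2 A" using m(2)[of \<mu>] h by (intro mult_right_mono) auto
    finally have 1: "\<mu>\<^sup>2 \<le> \<delta> * \<mu> powr cmu2 A" .
    have 2: "\<mu>\<^sup>2 \<le> \<delta> * (cmu1 A * \<mu>)" using h by (simp add: power2_eq_square)
    show ?thesis unfolding mu_next_def using 1 2 by (auto simp: min_def)
  qed
  then show ?thesis using m(1) assms by (intro exI[of _ "min m (\<delta> * cmu1 A)"]) auto
qed



section \<open>The two-stage problem as one nonlinear program\<close>

text \<open>In the variables \<open>z = (x, y\<^sub>1, xt\<^sub>1, s\<^sub>1)\<close> the Lagrangian is that of the objective \<open>zobj\<close> with the constraints \<open>zcon\<close> and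
  the multipliers \<open>(\<lambda>\<^sub>0, \<lambda>\<^sub>1, \<eta>\<^sub>1)\<close>. All partial gradients and the Hessian of the quadratic program come from this
  single function of \<open>z\<close>.\<close>

definition zobj :: "('n0::finite, 'n1::finite, 'm0::finite, 'm1::finite) two_stage \<Rightarrow> ('n0, 'n1, 'm1) zpoint \<Rightarrow> real" where
  "zobj P z = f0 P (fst z) + f1 P (fst (snd z)) (fst (snd (snd z)))"

definition zcon :: "('n0::finite, 'n1::finite, 'm0::finite, 'm1::finite) two_stage \<Rightarrow> ('n0, 'n1, 'm1) zpoint
    \<Rightarrow> (real^'m0) \<times> (real^'m1) \<times> (real^'n0)" where
  "zcon P z = (c0 P (fst z), ctil P z)"

lemma lagrangian_eq:
  "lagrangian P ((x, l0, s0), (y, xt, s1, l1, e1)) = zobj P (x, y, xt, s1) + zcon P (x, y, xt, s1) \<bullet> (l0, l1, e1)"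
  by (simp add: zobj_def zcon_def)

lemma C2_data_zobj_zcon:
  assumes "C2_lipschitz_near (f0 P) x" "C2_lipschitz_near (\<lambda>(y', x'). f1 P y' x') (y, xt)"
    "C2_lipschitz_near (c0 P) x" "C2_lipschitz_near (\<lambda>(y', x'). c1 P y' x') (y, xt)"
  obtains f' f'' c' c'' where "C2_data (zobj P) f' f'' (x, y, xt, s)" "C2_data (zcon P) c' c'' (x, y, xt, s)"
proof -
  obtain a' a'' where a: "C2_data (f0 P) a' a'' x" by (rule C2_lipschitz_near_imp_data[OF assms(1)])
  obtain b' b'' where b: "C2_data (\<lambda>(y', x'). f1 P y' x') b' b'' (y, xt)" by (rule C2_lipschitz_near_imp_data[OF assms(2)])
  obtain g' g'' where g: "C2_data (c0 P) g' g'' x" by (rule C2_lipschitz_near_imp_data[OF assms(3)])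
  obtain k' k'' where k: "C2_data (\<lambda>(y', x'). c1 P y' x') k' k'' (y, xt)" by (rule C2_lipschitz_near_imp_data[OF assms(4)])
  let ?z = "(x, y, xt, s)" and ?\<pi> = "\<lambda>z::('a,'b,'d) zpoint. (fst (snd z), fst (snd (snd z)))"
  have pi: "bounded_linear ?\<pi>" by (intro bounded_linear_intros)
  have fst: "bounded_linear (fst :: ('a,'b,'d) zpoint \<Rightarrow> _)" by (rule bounded_linear_fst)
  have "C2_data (f0 P) a' a'' (fst ?z)" using a by simp
  note 1 = C2_data_comp_linear[OF fst this]
  have "C2_data (\<lambda>(y', x'). f1 P y' x') b' b'' (?\<pi> ?z)" using b by simp
  note 2 = C2_data_comp_linear[OF pi this]
  have "C2_data (c0 P) g' g'' (fst ?z)" using g by simp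
  note 3 = C2_data_comp_linear[OF fst this]
  have "C2_data (\<lambda>(y', x'). c1 P y' x') k' k'' (?\<pi> ?z)" using k by simp
  note 4 = C2_data_comp_linear[OF pi this]
  have i1: "bounded_linear (\<lambda>a. (a, 0))" "bounded_linear (\<lambda>a. (0, a, 0))" by (intro bounded_linear_intros)+
  have i2: "bounded_linear (\<lambda>z::('a,'b,'d) zpoint. (0, snd (snd (snd z)), fst (snd (snd z)) - fst z))"
    by (intro bounded_linear_intros)
  note 5 = C2_data_add[OF C2_data_add[OF C2_data_linear_comp[OF i1(1) 3] C2_data_linear_comp[OF i1(2) 4]] C2_data_linear[OF i2]]
  have e1: "zobj P = (\<lambda>z. f0 P (fst z) + (\<lambda>(y', x'). f1 P y' x') (?\<pi> z))"
    by (auto simp: zobj_def)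
  have e2: "zcon P = (\<lambda>z. ((c0 P (fst z), 0) + (0, (\<lambda>(y', x'). c1 P y' x') (?\<pi> z), 0))
      + (0, snd (snd (snd z)), fst (snd (snd z)) - fst z))"
    by (auto simp: zcon_def)
  show ?thesis using that C2_data_add[OF 1 2] 5 unfolding e1 e2 by blast
qed

text \<open>The three blocks depend on \<open>x\<close>, on \<open>(y\<^sub>1, xt\<^sub>1, s\<^sub>1)\<close> and on \<open>(x, xt\<^sub>1)\<close>. Restricting \<open>zcon\<close> to the variables of a
  block shows that \<open>c\<^sub>0\<close> and \<open>c\<^sub>1\<close> are differentiable, and the chain rule then identifies the derivative.\<close>

lemma zcon_derivative:
  fixes P :: "('n0::finite, 'n1::finite, 'm0::finite, 'm1::finite) two_stage"
  assumes D: "(zcon P has_derivative D) (at (x, y, xt, s))"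
  defines "D0 \<equiv> frechet_derivative (c0 P) (at x)"
    and "D1 \<equiv> frechet_derivative (\<lambda>(y', x'). c1 P y' x') (at (y, xt))"
  shows "(c0 P has_derivative D0) (at x)"
    and "((\<lambda>(y', x'). c1 P y' x') has_derivative D1) (at (y, xt))"
    and "D (hx, hy, hxt, hs) = (D0 hx, D1 (hy, hxt) + hs, hxt - hx)"
proof -
  have i: "((\<lambda>x'. (x', y, xt, s)) has_derivative (\<lambda>h. (h, 0, 0, 0))) (at x)"
    by (auto intro!: derivative_eq_intros simp: zero_prod_def)
  have "((\<lambda>x'. fst (zcon P (x', y, xt, s))) has_derivative (\<lambda>h. fst (D (h, 0, 0, 0)))) (at x)"
    by (rule has_derivative_fst[OF has_derivative_compose[OF i D]])
  then have "c0 P differentiable (at x)" by (auto simp: zcon_def differentiable_def)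
  then show c0: "(c0 P has_derivative D0) (at x)" unfolding D0_def by (simp add: frechet_derivative_works[symmetric])
  have i: "((\<lambda>q. (x, fst q, snd q, s)) has_derivative (\<lambda>h. (0, fst h, snd h, 0))) (at (y, xt))"
    by (auto intro!: derivative_eq_intros simp: zero_prod_def)
  have "((\<lambda>q. fst (snd (zcon P (x, fst q, snd q, s))) - s) has_derivative (\<lambda>h. fst (snd (D (0, fst h, snd h, 0))) - 0)) (at (y, xt))"
    by (intro has_derivative_diff has_derivative_fst has_derivative_snd has_derivative_const)
       (use has_derivative_compose[OF i, of "zcon P" D] D in simp)
  moreover have "(\<lambda>q. fst (snd (zcon P (x, fst q, snd q, s))) - s) = (\<lambda>(y', x'). c1 P y' x')"
    by (auto simp: zcon_def)
  ultimately have "(\<lambda>(y', x'). c1 P y' x') differentiable (at (y, xt))" by (auto simp: differentiable_def)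
  then show c1: "((\<lambda>(y', x'). c1 P y' x') has_derivative D1) (at (y, xt))" unfolding D1_def by (simp add: frechet_derivative_works[symmetric])
  let ?z = "(x, y, xt, s)"
  have p0: "((\<lambda>z. fst z) has_derivative (\<lambda>h. fst h)) (at ?z)"
    by (auto intro!: derivative_eq_intros simp: zero_prod_def)
  have p1: "((\<lambda>z. (fst (snd z), fst (snd (snd z)))) has_derivative (\<lambda>h. (fst (snd h), fst (snd (snd h))))) (at ?z)"
    by (auto intro!: derivative_eq_intros simp: zero_prod_def)
  have "((\<lambda>z. (c0 P (fst z), (\<lambda>(y', x'). c1 P y' x') (fst (snd z), fst (snd (snd z))) + snd (snd (snd z)),
           fst (snd (snd z)) - fst z)) has_derivative
         (\<lambda>h. (D0 (fst h), D1 (fst (snd h), fst (snd (snd h))) + snd (snd (snd h)), fst (snd (snd h)) - fst h))) (at ?z)"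
    by (intro has_derivative_Pair has_derivative_add has_derivative_diff has_derivative_fst has_derivative_snd has_derivative_ident
        has_derivative_compose[OF p0, of "c0 P"] has_derivative_compose[OF p1, of "\<lambda>(y', x'). c1 P y' x'"])
       (use c0 c1 in simp_all)
  moreover have "(\<lambda>z. (c0 P (fst z), (\<lambda>(y', x'). c1 P y' x') (fst (snd z), fst (snd (snd z))) + snd (snd (snd z)),
           fst (snd (snd z)) - fst z)) = zcon P"
    by (auto simp: zcon_def)
  ultimately have "(zcon P has_derivative
         (\<lambda>h. (D0 (fst h), D1 (fst (snd h), fst (snd (snd h))) + snd (snd (snd h)), fst (snd (snd h)) - fst h))) (at ?z)"
    by simp
  from has_derivative_unique[OF D this] show "D (hx, hy, hxt, hs) = (D0 hx, D1 (hy, hxt) + hs, hxt - hx)"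
    by simp
qed

lemma zobj_derivative_slack:
  assumes D: "(zobj P has_derivative D) (at (x, y, xt, s))"
  shows "D (0, 0, 0, h) = 0"
proof -
  have i: "((\<lambda>t::real. (x, y, xt, s + t *\<^sub>R h)) has_derivative (\<lambda>t. (0, 0, 0, t *\<^sub>R h))) (at 0)"
    by (auto intro!: derivative_eq_intros simp: zero_prod_def)
  have "((\<lambda>t. zobj P (x, y, xt, s + t *\<^sub>R h)) has_derivative (\<lambda>t. D (0, 0, 0, t *\<^sub>R h))) (at 0)"
    by (rule has_derivative_compose[OF i]) (use D in simp)
  then have "((\<lambda>t::real. zobj P (x, y, xt, s)) has_derivative (\<lambda>t. D (0, 0, 0, t *\<^sub>R h))) (at 0)"
    by (simp add: zobj_def)
  from has_derivative_unique[OF this has_derivative_const] have "(\<lambda>t::real. D (0, 0, 0, t *\<^sub>R h)) = (\<lambda>_. 0)" .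
  from fun_cong[OF this, of 1] show ?thesis by simp
qed

text \<open>The last part identifies the copy with the original: gradients with respect to \<open>x\<close> and \<open>xt\<^sub>1\<close> add up in the
  undecomposed problem.\<close>

lemma GDERIV_partial:
  assumes "GDERIV \<Phi> (x, y, xt, s) :> (gx, gy, gxt, gs)"
  shows "GDERIV (\<lambda>x'. \<Phi> (x', y, xt, s)) x :> gx" "GDERIV (\<lambda>y'. \<Phi> (x, y', xt, s)) y :> gy"
    "GDERIV (\<lambda>xt'. \<Phi> (x, y, xt', s)) xt :> gxt"
    "x = xt \<Longrightarrow> GDERIV (\<lambda>(x', y'). \<Phi> (x', y', x', s)) (x, y) :> (gx + gxt, gy)"
proof -
  have D: "(\<Phi> has_derivative (\<lambda>h. h \<bullet> (gx, gy, gxt, gs))) (at (x, y, xt, s))"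
    using assms unfolding gderiv_def .
  have i: "((\<lambda>x'. (x', y, xt, s)) has_derivative (\<lambda>h. (h, 0, 0, 0))) (at x)"
    by (auto intro!: derivative_eq_intros simp: zero_prod_def)
  show "GDERIV (\<lambda>x'. \<Phi> (x', y, xt, s)) x :> gx"
    using has_derivative_compose[OF i D] unfolding gderiv_def by simp
  have i: "((\<lambda>y'. (x, y', xt, s)) has_derivative (\<lambda>h. (0, h, 0, 0))) (at y)"
    by (auto intro!: derivative_eq_intros simp: zero_prod_def)
  show "GDERIV (\<lambda>y'. \<Phi> (x, y', xt, s)) y :> gy"
    using has_derivative_compose[OF i D] unfolding gderiv_def by simp
  have i: "((\<lambda>xt'. (x, y, xt', s)) has_derivative (\<lambda>h. (0, 0, h, 0))) (at xt)"
    by (auto intro!: derivative_eq_intros simp: zero_prod_def)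
  show "GDERIV (\<lambda>xt'. \<Phi> (x, y, xt', s)) xt :> gxt"
    using has_derivative_compose[OF i D] unfolding gderiv_def by simp
  assume x: "x = xt"
  have i: "((\<lambda>q. (fst q, snd q, fst q, s)) has_derivative (\<lambda>h. (fst h, snd h, fst h, 0))) (at (x, y))"
    by (auto intro!: derivative_eq_intros simp: zero_prod_def)
  have "(\<Phi> has_derivative (\<lambda>h. h \<bullet> (gx, gy, gxt, gs))) (at (fst (x, y), snd (x, y), fst (x, y), s))"
    using D x by simp
  from has_derivative_compose[OF i this]
  show "GDERIV (\<lambda>(x', y'). \<Phi> (x', y', x', s)) (x, y) :> (gx + gxt, gy)"
    unfolding gderiv_def case_prod_beta' by (simp add: inner_prod_def inner_add_right algebra_simps)
qed

fun wmult :: "('n0::finite, 'n1::finite, 'm0::finite, 'm1::finite) wpoint \<Rightarrow> (real^'m0) \<times> (real^'m1) \<times> (real^'n0)" where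
  "wmult ((x, l0, s0), (y, xt, s1, l1, e1)) = (l0, l1, e1)"

fun slack1 :: "('n0::finite, 'n1::finite, 'm0::finite, 'm1::finite) wpoint \<Rightarrow> real^'m1" where
  "slack1 ((x, l0, s0), (y, xt, s1, l1, e1)) = s1"

fun mult1 :: "('n0::finite, 'n1::finite, 'm0::finite, 'm1::finite) wpoint \<Rightarrow> real^'m1" where
  "mult1 ((x, l0, s0), (y, xt, s1, l1, e1)) = l1"

definition select :: "'m set \<Rightarrow> real^'m \<Rightarrow> real^'m \<Rightarrow> real^'m" where
  "select I a b = (\<chi> i. if i \<in> I then a $ i else b $ i)"

text \<open>Everything in the optimality system other than derivatives, constraint values and products is linear and is collected
  here. The residual is arranged in the shape of \<open>wpoint\<close>, so that it is an endomorphism and injectivity of its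
  derivative gives surjectivity.\<close>

fun assemble :: "'m0 set \<Rightarrow> ('n0::finite, 'n1::finite, 'm1::finite) zpoint
    \<times> ((real^'m0::finite) \<times> (real^'m1) \<times> (real^'n0)) \<times> (real^'m1) \<times> ('n0, 'n1, 'm0, 'm1) wpoint
    \<Rightarrow> ('n0, 'n1, 'm0, 'm1) wpoint" where
  "assemble I ((gx, gy, gxt, gs), (k0, k1, ke), m, ((x, l0, s0), v)) =
     ((gx, k0 + s0, select I s0 l0), (gy, gxt, m, k1, ke))"

lemma bounded_linear_zpart: "bounded_linear zpart"
proof -
  have *: "zpart = (\<lambda>w. (fst (fst w), fst (snd w), fst (snd (snd w)), fst (snd (snd (snd w)))))"
    by (auto simp: fun_eq_iff)
  show ?thesis unfolding * by (intro bounded_linear_intros)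
qed

lemma bounded_linear_wmult: "bounded_linear wmult"
proof -
  have *: "wmult = (\<lambda>w. (fst (snd (fst w)), fst (snd (snd (snd (snd w)))), snd (snd (snd (snd (snd w))))))"
    by (auto simp: fun_eq_iff)
  show ?thesis unfolding * by (intro bounded_linear_intros)
qed

lemma bounded_linear_slack1: "bounded_linear slack1"
proof -
  have *: "slack1 = (\<lambda>w. fst (snd (snd (snd w))))" by (auto simp: fun_eq_iff)
  show ?thesis unfolding * by (intro bounded_linear_intros)
qed

lemma bounded_linear_mult1: "bounded_linear mult1"
proof -
  have *: "mult1 = (\<lambda>w. fst (snd (snd (snd (snd w)))))" by (auto simp: fun_eq_iff)
  show ?thesis unfolding * by (intro bounded_linear_intros)
qed

lemma bounded_linear_assemble: "bounded_linear (assemble I)"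
  unfolding linear_conv_bounded_linear[symmetric]
proof (rule linearI)
  show "assemble I (a + b) = assemble I a + assemble I b" for a b
    by (cases "(I, a)" rule: assemble.cases; cases "(I, b)" rule: assemble.cases)
       (auto simp: select_def vec_eq_iff)
  show "assemble I (r *\<^sub>R a) = r *\<^sub>R assemble I a" for r a
    by (cases "(I, a)" rule: assemble.cases) (auto simp: select_def vec_eq_iff scaleR_add_right)
qed

lemma bounded_bilinear_comp_mult: "bounded_bilinear (comp_mult :: real^'m::finite \<Rightarrow> _)"
  unfolding bilinear_conv_bounded_bilinear[symmetric] bilinear_def
  by (auto intro!: linearI simp: comp_mult_def vec_eq_iff algebra_simps)



section \<open>The smooth optimality system at the solution\<close>

lemma sum_UNIV_Plus: "(\<Sum>k\<in>UNIV. g k) = (\<Sum>i\<in>UNIV. g (Inl i)) + (\<Sum>j\<in>UNIV. g (Inr j))"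
  for g :: "'a::finite + 'b::finite \<Rightarrow> 'c::comm_monoid_add"
proof -
  have "(\<Sum>k\<in>UNIV. g k) = (\<Sum>k\<in>UNIV <+> UNIV. g k)" by simp
  also have "\<dots> = (\<Sum>i\<in>UNIV. g (Inl i)) + (\<Sum>j\<in>UNIV. g (Inr j))"
    by (subst sum.Plus) auto
  finally show ?thesis .
qed

lemma nlp_licq_imp_zero:
  fixes g :: "'i::finite \<Rightarrow> 'p::real_inner \<Rightarrow> real"
  assumes licq: "nlp_licq g p" and off: "\<And>i. i \<notin> nlp_active g p \<Longrightarrow> u i = 0"
    and zero: "(\<Sum>i\<in>UNIV. u i *\<^sub>R grad (g i) p) = 0"
  shows "u i = 0"
proof (cases "i \<in> nlp_active g p")
  case True
  let ?A = "nlp_active g p" and ?v = "\<lambda>i. grad (g i) p"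
  have inj: "inj_on ?v ?A" and ind: "independent (?v ` ?A)" using licq by (auto simp: nlp_licq_def)
  have "(\<Sum>a\<in>?v ` ?A. u (inv_into ?A ?v a) *\<^sub>R a) = (\<Sum>i\<in>?A. u i *\<^sub>R ?v i)"
    by (subst sum.reindex[OF inj]) (auto intro!: sum.cong simp: inv_into_f_f[OF inj])
  also have "\<dots> = (\<Sum>i\<in>UNIV. u i *\<^sub>R ?v i)"
    by (rule sum.mono_neutral_left) (auto simp: off)
  finally have "(\<Sum>a\<in>?v ` ?A. u (inv_into ?A ?v a) *\<^sub>R a) = 0" using zero by simp
  from independentD[OF ind _ _ this, of "?v i"] have "u (inv_into ?A ?v (?v i)) = 0" using True by auto
  then show ?thesis using inv_into_f_f[OF inj True] by simp
qed (rule off)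

lemma bounded_linear_filterlim_nhds:
  assumes "bounded_linear h" shows "filterlim h (nhds (h p)) (nhds p)"
proof -
  have "isCont h p" using assms by (rule linear_continuous_at)
  then show ?thesis by (simp add: isCont_def tendsto_at_iff_tendsto_nhds)
qed

text \<open>The derivatives of \<open>zobj\<close> and \<open>zcon\<close> are fixed once, so that all of the following speaks of the same
  functions.\<close>

locale primal_dual_solution =
  fixes P :: "('n0::finite, 'n1::finite, 'm0::finite, 'm1::finite) two_stage"
    and xs l0s s0s ys s1s l1s e1s
    and f' f'' c' c''
  assumes loc: "local_assumption P ((xs, l0s, s0s), (ys, xs, s1s, l1s, e1s))"
    and data: "C2_data (zobj P) f' f'' (xs, ys, xs, s1s)" "C2_data (zcon P) c' c'' (xs, ys, xs, s1s)"
begin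

abbreviation "zs \<equiv> (xs, ys, xs, s1s)"
abbreviation "ls \<equiv> (l0s, l1s, e1s)"
abbreviation "wst \<equiv> ((xs, l0s, s0s), (ys, xs, s1s, l1s, e1s))"

text \<open>The active constraints of the first and of the second stage.\<close>

definition "I0 = {i. s0s $ i = 0}"
definition "I1 = {j. s1s $ j = 0}"

definition regular :: "('n0, 'n1, 'm1) zpoint \<Rightarrow> bool" where
  "regular z \<longleftrightarrow> C2_data (zobj P) f' f'' z \<and> C2_data (zcon P) c' c'' z"

text \<open>The smooth substitute for \<open>F\<^sup>C\<close> at \<open>\<mu> = 0\<close>: the max-min block is replaced by \<open>s\<^sub>0\<close> at active and by \<open>\<lambda>\<^sub>0\<close> at
  inactive constraints.\<close>

definition G :: "('n0, 'n1, 'm0, 'm1) wpoint \<Rightarrow> ('n0, 'n1, 'm0, 'm1) wpoint" where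
  "G w = assemble I0 (lagr_grad f' c' (zpart w) (wmult w), zcon P (zpart w), comp_mult (slack1 w) (mult1 w), w)"

definition G' :: "('n0, 'n1, 'm0, 'm1) wpoint \<Rightarrow> ('n0, 'n1, 'm0, 'm1) wpoint \<Rightarrow> ('n0, 'n1, 'm0, 'm1) wpoint" where
  "G' w d = assemble I0 (lagr_hess f'' c'' (zpart w) (wmult w) (zpart d) + adj (c' (zpart w)) (wmult d),
     c' (zpart w) (zpart d), comp_mult (slack1 w) (mult1 d) + comp_mult (slack1 d) (mult1 w), d)"

text \<open>The direction in which the barrier parameter shifts the system: \<open>F\<^sup>C(w;\<mu>) = 0\<close> becomes \<open>G w = \<mu> *\<^sub>R barrier_dir\<close>.\<close>

definition barrier_dir :: "('n0, 'n1, 'm0, 'm1) wpoint" where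
  "barrier_dir = ((0, 0, 0), (0, 0, (\<chi> j. 1), 0, 0))"

lemma slacks: "c0 P xs = - s0s" "c1 P ys xs = - s1s"
  using loc by auto

lemma multipliers0: "0 \<le> s0s $ i" "0 \<le> l0s $ i" "i \<in> I0 \<Longrightarrow> 0 < l0s $ i" "i \<notin> I0 \<Longrightarrow> l0s $ i = 0" "i \<notin> I0 \<Longrightarrow> 0 < s0s $ i"
proof -
  have k: "nlp_kkt (joint_obj P) (joint_con P) (xs, ys) (joint_mult l0s l1s)"
    and sc: "nlp_strict_complementarity (joint_con P) (xs, ys) (joint_mult l0s l1s)" using loc by auto
  have 1: "joint_con P (Inl i) (xs, ys) \<le> 0" "0 \<le> joint_mult l0s l1s (Inl i)" "joint_mult l0s l1s (Inl i) * joint_con P (Inl i) (xs, ys) = 0"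
    using k unfolding nlp_kkt_def nlp_feasible_def by blast+
  have 2: "Inl i \<in> nlp_active (joint_con P) (xs, ys) \<Longrightarrow> 0 < joint_mult l0s l1s (Inl i)"
    using sc unfolding nlp_strict_complementarity_def by blast
  show "0 \<le> s0s $ i" "0 \<le> l0s $ i" using 1 by (auto simp: slacks joint_mult_def)
  show "i \<in> I0 \<Longrightarrow> 0 < l0s $ i" using 2 by (auto simp: slacks joint_mult_def I0_def nlp_active_def)
  show "i \<notin> I0 \<Longrightarrow> l0s $ i = 0" using 1 by (auto simp: slacks joint_mult_def I0_def)
  show "i \<notin> I0 \<Longrightarrow> 0 < s0s $ i" using 1 by (auto simp: slacks I0_def)
qed

lemma multipliers1: "0 \<le> s1s $ j" "0 \<le> l1s $ j" "j \<in> I1 \<Longrightarrow> 0 < l1s $ j" "j \<notin> I1 \<Longrightarrow> l1s $ j = 0" "j \<notin> I1 \<Longrightarrow> 0 < s1s $ j"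
proof -
  have k: "nlp_kkt (joint_obj P) (joint_con P) (xs, ys) (joint_mult l0s l1s)"
    and sc: "nlp_strict_complementarity (joint_con P) (xs, ys) (joint_mult l0s l1s)" using loc by auto
  have 1: "joint_con P (Inr j) (xs, ys) \<le> 0" "0 \<le> joint_mult l0s l1s (Inr j)" "joint_mult l0s l1s (Inr j) * joint_con P (Inr j) (xs, ys) = 0"
    using k unfolding nlp_kkt_def nlp_feasible_def by blast+
  have 2: "Inr j \<in> nlp_active (joint_con P) (xs, ys) \<Longrightarrow> 0 < joint_mult l0s l1s (Inr j)"
    using sc unfolding nlp_strict_complementarity_def by blast
  show "0 \<le> s1s $ j" "0 \<le> l1s $ j" using 1 by (auto simp: slacks joint_mult_def)
  show "j \<in> I1 \<Longrightarrow> 0 < l1s $ j" using 2 by (auto simp: slacks joint_mult_def I1_def nlp_active_def)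
  show "j \<notin> I1 \<Longrightarrow> l1s $ j = 0" using 1 by (auto simp: slacks joint_mult_def I1_def)
  show "j \<notin> I1 \<Longrightarrow> 0 < s1s $ j" using 1 by (auto simp: slacks I1_def)
qed

lemma regular_zs: "regular zs" using data by (simp add: regular_def)

lemma regular_nearby: assumes "regular z" shows "\<forall>\<^sub>F q in nhds z. regular q"
proof -
  have "\<forall>\<^sub>F q in nhds z. C2_data (zobj P) f' f'' q" "\<forall>\<^sub>F q in nhds z. C2_data (zcon P) c' c'' q"
    using assms C2_data_nearby unfolding regular_def by blast+
  then show ?thesis by eventually_elim (simp add: regular_def)
qed

lemma regular_near_solution: "\<forall>\<^sub>F w in nhds wst. regular (zpart w)"
proof -
  have "filterlim zpart (nhds zs) (nhds wst)"
    using bounded_linear_filterlim_nhds[OF bounded_linear_zpart, of wst] by simp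
  from eventually_compose_filterlim[OF regular_nearby[OF regular_zs] this] show ?thesis .
qed

lemma con_derivative:
  assumes "regular (x, y, xt, s)"
  shows "(c0 P has_derivative frechet_derivative (c0 P) (at x)) (at x)"
    and "((\<lambda>(y', x'). c1 P y' x') has_derivative frechet_derivative (\<lambda>(y', x'). c1 P y' x') (at (y, xt))) (at (y, xt))"
    and "c' (x, y, xt, s) (hx, hy, hxt, hs) = (frechet_derivative (c0 P) (at x) hx,
           frechet_derivative (\<lambda>(y', x'). c1 P y' x') (at (y, xt)) (hy, hxt) + hs, hxt - hx)"
proof -
  have "C2_data (zcon P) c' c'' (x, y, xt, s)" using assms by (simp add: regular_def)
  note D = zcon_derivative[OF C2_dataD(1)[OF this]]
  show "(c0 P has_derivative frechet_derivative (c0 P) (at x)) (at x)" by (rule D(1))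
  show "((\<lambda>(y', x'). c1 P y' x') has_derivative frechet_derivative (\<lambda>(y', x'). c1 P y' x') (at (y, xt))) (at (y, xt))"
    by (rule D(2))
  show "c' (x, y, xt, s) (hx, hy, hxt, hs) = (frechet_derivative (c0 P) (at x) hx,
           frechet_derivative (\<lambda>(y', x'). c1 P y' x') (at (y, xt)) (hy, hxt) + hs, hxt - hx)"
    by (rule D(3))
qed

lemma derivative_slack:
  assumes "regular z" shows "f' z (0, 0, 0, h) = 0" "c' z (0, 0, 0, h) = (0, h, 0)"
proof -
  obtain x y xt s where z: "z = (x, y, xt, s)" by (cases z)
  show "f' z (0, 0, 0, h) = 0"
    unfolding z by (rule zobj_derivative_slack[OF C2_dataD(1)[of "zobj P" f' f'']]) (use assms in \<open>simp add: z regular_def\<close>)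
  show "c' z (0, 0, 0, h) = (0, h, 0)"
    using con_derivative(3)[of x y xt s 0 0 0 h] linear_0[OF has_derivative_linear[OF con_derivative(1)[of x y xt s]]]
      linear_0[OF has_derivative_linear[OF con_derivative(2)[of x y xt s]]] assms
    unfolding z by (simp add: zero_prod_def)
qed

lemma lagr_grad_inner: "lagr_grad f' c' z l \<bullet> d = f' z d + c' z d \<bullet> l"
  by (simp add: lagr_grad_def inner_add_left adj_inner)

lemma lagr_grad_slack:
  assumes "regular z" shows "lagr_grad f' c' z (l0, l1, e1) \<bullet> (0, 0, 0, h) = h \<bullet> l1"
  using derivative_slack[OF assms] by (simp add: lagr_grad_inner)

text \<open>The slack component of the gradient of the Lagrangian is \<open>\<lambda>\<^sub>1\<close>, hence constant in \<open>z\<close>, so the Hessian does not see the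
  slacks.\<close>

lemma lagr_hess_slack:
  assumes z: "regular z" shows "(0, 0, 0, h) \<bullet> lagr_hess f'' c'' z l d = 0"
proof -
  obtain l0 l1 e1 where l: "l = (l0, l1, e1)" by (cases l)
  have "((\<lambda>q. (0, 0, 0, h) \<bullet> lagr_grad f' c' q l) has_derivative (\<lambda>d. (0, 0, 0, h) \<bullet> lagr_hess f'' c'' z l d)) (at z)"
    by (rule has_derivative_inner_right[OF lagr_grad_has_derivative]) (use z in \<open>auto simp: regular_def\<close>)
  moreover have ev: "\<forall>\<^sub>F q in nhds z. h \<bullet> l1 = (0, 0, 0, h) \<bullet> lagr_grad f' c' q l"
    using regular_nearby[OF z] by eventually_elim (metis inner_commute l lagr_grad_slack)
  have "((\<lambda>q. (0, 0, 0, h) \<bullet> lagr_grad f' c' q l) has_derivative (\<lambda>d. 0)) (at z)"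
    by (rule has_derivative_transform_eventually[of "\<lambda>_. h \<bullet> l1"])
       (use ev eventually_nhds_x_imp_x[OF ev] in \<open>auto simp: eventually_at_filter elim: eventually_mono\<close>)
  ultimately show ?thesis using has_derivative_unique by (metis (no_types))
qed

lemma hess_symmetric:
  assumes "regular z" shows "d \<bullet> lagr_hess f'' c'' z l e = e \<bullet> lagr_hess f'' c'' z l d"
  using assms lagr_hess_symmetric unfolding regular_def by blast

lemma linear_hess:
  assumes "regular z" shows "linear (lagr_hess f'' c'' z l)"
  using assms bounded_linear_lagr_hess bounded_linear.linear unfolding regular_def by blast

lemma hess_slack_free:
  assumes z: "regular z"
  shows "(x, y, xt, s) \<bullet> lagr_hess f'' c'' z l (x, y, xt, s) = (x, y, xt, 0) \<bullet> lagr_hess f'' c'' z l (x, y, xt, 0)"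
proof -
  have e: "(x, y, xt, s) = (x, y, xt, 0) + (0, 0, 0, s)" by simp
  have 0: "d \<bullet> lagr_hess f'' c'' z l (0, 0, 0, s) = 0" for d
    using hess_symmetric[OF z, of d l "(0, 0, 0, s)"] lagr_hess_slack[OF z] by simp
  show ?thesis
    unfolding e linear_add[OF linear_hess[OF z]] inner_add_left inner_add_right 0 lagr_hess_slack[OF z] by simp
qed

lemma C1_G: "C1_lipschitz_near G G' wst"
proof -
  have zp: "zpart wst = zs" and wm: "wmult wst = ls" by simp_all
  have f1: "C1_lipschitz_near f' f'' (zpart wst)" and c1: "C1_lipschitz_near c' c'' (zpart wst)"
    and c0: "C1_lipschitz_near (zcon P) (\<lambda>q. blinfun_apply (c' q)) (zpart wst)"
    using data C2_dataD(3)[OF data(2)] by (auto simp: C2_data_def)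
  have a: "C1_lipschitz_near (\<lambda>w. adj (f' (zpart w)) 1) (\<lambda>w d. adj (f'' (zpart w) (zpart d)) 1) wst"
    by (rule C1_lipschitz_near_linear_comp[OF adj.bounded_linear_left C1_lipschitz_near_comp_linear[OF bounded_linear_zpart f1]])
  have b: "C1_lipschitz_near (\<lambda>w. adj (c' (zpart w)) (wmult w))
     (\<lambda>w d. adj (c' (zpart w)) (wmult d) + adj (c'' (zpart w) (zpart d)) (wmult w)) wst"
    by (rule C1_lipschitz_near_bilinear[OF bounded_bilinear_adj C1_lipschitz_near_comp_linear[OF bounded_linear_zpart c1]
          C1_lipschitz_near_linear[OF bounded_linear_wmult]])
  have m: "C1_lipschitz_near (\<lambda>w. comp_mult (slack1 w) (mult1 w))
     (\<lambda>w d. comp_mult (slack1 w) (mult1 d) + comp_mult (slack1 d) (mult1 w)) wst"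
    by (rule C1_lipschitz_near_bilinear[OF bounded_bilinear_comp_mult C1_lipschitz_near_linear[OF bounded_linear_slack1]
          C1_lipschitz_near_linear[OF bounded_linear_mult1]])
  have "C1_lipschitz_near (\<lambda>w. assemble I0 (adj (f' (zpart w)) 1 + adj (c' (zpart w)) (wmult w), zcon P (zpart w), comp_mult (slack1 w) (mult1 w), w))
    (\<lambda>w d. assemble I0 (adj (f'' (zpart w) (zpart d)) 1 + (adj (c' (zpart w)) (wmult d) + adj (c'' (zpart w) (zpart d)) (wmult w)),
       c' (zpart w) (zpart d), comp_mult (slack1 w) (mult1 d) + comp_mult (slack1 d) (mult1 w), d)) wst"
    by (intro C1_lipschitz_near_linear_comp[OF bounded_linear_assemble] C1_lipschitz_near_Pair C1_lipschitz_near_add a b m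
        C1_lipschitz_near_comp_linear[OF bounded_linear_zpart c0] C1_lipschitz_near_linear[OF bounded_linear_ident])
  moreover have "G = (\<lambda>w. assemble I0 (adj (f' (zpart w)) 1 + adj (c' (zpart w)) (wmult w), zcon P (zpart w), comp_mult (slack1 w) (mult1 w), w))"
    by (simp add: fun_eq_iff G_def lagr_grad_def)
  moreover have "G' = (\<lambda>w d. assemble I0 (adj (f'' (zpart w) (zpart d)) 1 + (adj (c' (zpart w)) (wmult d) + adj (c'' (zpart w) (zpart d)) (wmult w)),
       c' (zpart w) (zpart d), comp_mult (slack1 w) (mult1 d) + comp_mult (slack1 d) (mult1 w), d))"
    by (simp add: fun_eq_iff G'_def lagr_hess_def ac_simps)
  ultimately show ?thesis by simp
qed

lemma FC_eq:
  assumes r: "regular (x, y, xt, s)" and g: "lagr_grad f' c' (x, y, xt, s) (l0, l, e) = (gx, gy, gxt, gs)"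
  shows "FC P \<mu> ((x, l0, s0), (y, xt, s, l, e)) =
    (gx, c0 P x + s0, (\<chi> i. Max {min (s0 $ i) (l0 $ i), - s0 $ i, - l0 $ i}),
      (gy, gxt, comp_mult s l - (\<chi> j. \<mu>), c1 P y xt + s, xt - x))"
proof -
  have D: "GDERIV (\<lambda>z. zobj P z + zcon P z \<bullet> (l0, l, e)) (x, y, xt, s) :> (gx, gy, gxt, gs)"
    using lagrangian_GDERIV[of "zobj P" f' f'' _ "zcon P" c' c'' "(l0, l, e)"] r unfolding regular_def g[symmetric] by blast
  show ?thesis
    using grad_eq[OF GDERIV_partial(1)[OF D]] grad_eq[OF GDERIV_partial(2)[OF D]] grad_eq[OF GDERIV_partial(3)[OF D]]
    by (simp only: FC.simps F1.simps lagrangian_eq)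
qed

end



lemma grad_inner_eq:
  fixes f :: "'a::euclidean_space \<Rightarrow> real"
  assumes "(f has_derivative \<phi>) (at p)"
  shows "h \<bullet> grad f p = \<phi> h"
proof -
  have bl: "bounded_linear \<phi>" by (rule has_derivative_bounded_linear[OF assms])
  have e: "\<phi> h = h \<bullet> adj (Blinfun \<phi>) 1" for h
    by (simp add: adj_inner' bounded_linear_Blinfun_apply[OF bl])
  then have "\<phi> = (\<lambda>h. h \<bullet> adj (Blinfun \<phi>) 1)" by (rule ext)
  then have D: "GDERIV f p :> adj (Blinfun \<phi>) 1" using assms unfolding gderiv_def by simp
  show "h \<bullet> grad f p = \<phi> h" using grad_eq[OF D] e by simp
qed

lemma component_le_norm_wpoint:
  fixes d :: "('n0::finite, 'n1::finite, 'm0::finite, 'm1::finite) wpoint"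
  assumes "d = ((dx, dl0, ds0), (dy, dxt, ds, dl, de))"
  shows "\<bar>dl0 $ i\<bar> \<le> norm d" "\<bar>ds0 $ i\<bar> \<le> norm d" "\<bar>ds $ j\<bar> \<le> norm d" "\<bar>dl $ j\<bar> \<le> norm d"
proof -
  have "norm dl0 \<le> norm d" "norm ds0 \<le> norm d"
    unfolding assms
    by (rule order_trans[OF norm_fst_le order_trans[OF norm_snd_le norm_fst_le]])
       (rule order_trans[OF norm_snd_le order_trans[OF norm_snd_le norm_fst_le]])
  then show "\<bar>dl0 $ i\<bar> \<le> norm d" "\<bar>ds0 $ i\<bar> \<le> norm d"
    using component_le_norm_cart order_trans by blast+
  have "norm ds \<le> norm d" "norm dl \<le> norm d"
    unfolding assms
    by (rule order_trans[OF norm_fst_le order_trans[OF norm_snd_le order_trans[OF norm_snd_le norm_snd_le]]])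
       (rule order_trans[OF norm_fst_le order_trans[OF norm_snd_le order_trans[OF norm_snd_le order_trans[OF norm_snd_le norm_snd_le]]]])
  then show "\<bar>ds $ j\<bar> \<le> norm d" "\<bar>dl $ j\<bar> \<le> norm d"
    using component_le_norm_cart order_trans by blast+
qed

lemma norm_vec_cong: "(\<And>i. \<bar>a $ i\<bar> = \<bar>b $ i\<bar>) \<Longrightarrow> norm a = norm (b :: real^'m::finite)"
  by (simp add: norm_vec_def)

context primal_dual_solution
begin

text \<open>These finitely many quantities are positive by strict complementarity. Within distance \<open>\<rho>\<close> of the solution each of
  them stays above \<open>\<rho>\<close> while its partner, zero at the solution, stays below, so the active sets can be read off.\<close>

lemma ex_gap: "\<exists>\<rho>>0. (\<forall>i\<in>I0. 2 * \<rho> \<le> l0s $ i) \<and> (\<forall>i\<in>-I0. 2 * \<rho> \<le> s0s $ i) \<and>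
   (\<forall>j\<in>I1. 2 * \<rho> \<le> l1s $ j) \<and> (\<forall>j\<in>-I1. 2 * \<rho> \<le> s1s $ j)"
proof -
  let ?S = "insert 1 ((\<lambda>i. l0s $ i) ` I0 \<union> (\<lambda>i. s0s $ i) ` (-I0) \<union> (\<lambda>j. l1s $ j) ` I1 \<union> (\<lambda>j. s1s $ j) ` (-I1))"
  have "0 < Min ?S" using multipliers0 multipliers1 by (subst Min_gr_iff) auto
  moreover have "Min ?S \<le> l0s $ i" if "i \<in> I0" for i using that by (intro Min_le) auto
  moreover have "Min ?S \<le> s0s $ i" if "i \<in> -I0" for i using that by (intro Min_le) auto
  moreover have "Min ?S \<le> l1s $ j" if "j \<in> I1" for j using that by (intro Min_le) auto
  moreover have "Min ?S \<le> s1s $ j" if "j \<in> -I1" for j using that by (intro Min_le) auto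
  ultimately show ?thesis by (intro exI[of _ "Min ?S / 2"]) auto
qed

definition "gap = (SOME \<rho>. 0 < \<rho> \<and> (\<forall>i\<in>I0. 2 * \<rho> \<le> l0s $ i) \<and> (\<forall>i\<in>-I0. 2 * \<rho> \<le> s0s $ i) \<and>
   (\<forall>j\<in>I1. 2 * \<rho> \<le> l1s $ j) \<and> (\<forall>j\<in>-I1. 2 * \<rho> \<le> s1s $ j))"

lemma gap:
  "0 < gap" "i \<in> I0 \<Longrightarrow> 2 * gap \<le> l0s $ i" "i \<notin> I0 \<Longrightarrow> 2 * gap \<le> s0s $ i"
  "j \<in> I1 \<Longrightarrow> 2 * gap \<le> l1s $ j" "j \<notin> I1 \<Longrightarrow> 2 * gap \<le> s1s $ j"
  using someI_ex[OF ex_gap] unfolding gap_def[symmetric] by auto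

lemma components_near:
  assumes "w = ((x, l0, s0), (y, xt, s, l, e))"
  shows "\<bar>l0 $ i - l0s $ i\<bar> \<le> norm (w - wst)" "\<bar>s0 $ i - s0s $ i\<bar> \<le> norm (w - wst)"
    "\<bar>s $ j - s1s $ j\<bar> \<le> norm (w - wst)" "\<bar>l $ j - l1s $ j\<bar> \<le> norm (w - wst)"
  using component_le_norm_wpoint[of "w - wst" "x - xs" "l0 - l0s" "s0 - s0s" "y - ys" "xt - xs" "s - s1s" "l - l1s" "e - e1s"]
  unfolding assms by simp_all

text \<open>Within the gap, the max-min expression is \<open>\<bar>s\<^sub>0\<^sub>i\<bar>\<close> at an active and \<open>\<bar>\<lambda>\<^sub>0\<^sub>i\<bar>\<close> at an inactive constraint; a change of
  sign in a component does not affect the Euclidean norm.\<close>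

lemma norm_FC:
  assumes r: "regular (zpart w)" and n: "norm (w - wst) < gap"
  shows "norm (FC P \<mu> w) = norm (G w - \<mu> *\<^sub>R barrier_dir)"
proof -
  obtain x l0 s0 y xt s l e where w: "w = ((x, l0, s0), (y, xt, s, l, e))" by (cases w rule: zpart.cases)
  obtain gx gy gxt gs where g: "lagr_grad f' c' (x, y, xt, s) (l0, l, e) = (gx, gy, gxt, gs)" by (metis prod_cases4)
  have r': "regular (x, y, xt, s)" using r w by simp
  let ?m = "(\<chi> i. Max {min (s0 $ i) (l0 $ i), - s0 $ i, - l0 $ i}) :: real^'m0"
  have "norm ?m = norm (select I0 s0 l0)"
  proof (rule norm_vec_cong)
    fix i
    have a: "\<bar>l0 $ i - l0s $ i\<bar> < gap" "\<bar>s0 $ i - s0s $ i\<bar> < gap"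
      using components_near[OF w] n by (meson order.strict_trans1)+
    show "\<bar>?m $ i\<bar> = \<bar>select I0 s0 l0 $ i\<bar>"
    proof (cases "i \<in> I0")
      case True
      then have "s0s $ i = 0" by (simp add: I0_def)
      then show ?thesis using True gap(2)[OF True] a by (auto simp: select_def)
    next
      case False
      then show ?thesis using gap(3)[OF False] multipliers0(4)[OF False] a by (auto simp: select_def)
    qed
  qed
  moreover have "comp_mult s l - (\<chi> j. \<mu>) = comp_mult s l - \<mu> *\<^sub>R (\<chi> j. 1)"
    by (simp add: vec_eq_iff)
  ultimately show ?thesis
    unfolding w FC_eq[OF r' g]
    by (simp add: G_def g zcon_def barrier_dir_def norm_Pair)
qed

text \<open>The Lagrangian of the undecomposed problem, to which the optimality assumptions refer. It is the Lagrangian in \<open>z\<close>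
  restricted to \<open>xt\<^sub>1 = x\<close> and constant slacks, up to the constant \<open>s\<^sub>1\<^sup>* \<bullet> \<lambda>\<^sub>1\<^sup>*\<close>.\<close>

definition joint_lagr :: "(real^'n0) \<times> (real^'n1) \<Rightarrow> real" where
  "joint_lagr = nlp_lagrangian (joint_obj P) (joint_con P) (joint_mult l0s l1s)"

lemma joint_lagr_eq:
  "joint_lagr = (\<lambda>q. (\<lambda>(x', y'). (\<lambda>z. zobj P z + zcon P z \<bullet> ls) (x', y', x', s1s)) q - s1s \<bullet> l1s)"
proof
  fix q :: "(real^'n0) \<times> (real^'n1)"
  obtain x y where q: "q = (x, y)" by (cases q)
  show "joint_lagr q = (\<lambda>(x', y'). (\<lambda>z. zobj P z + zcon P z \<bullet> ls) (x', y', x', s1s)) q - s1s \<bullet> l1s"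
    by (simp add: q joint_lagr_def nlp_lagrangian_def sum_UNIV_Plus joint_mult_def zobj_def zcon_def inner_vec_def[of "c0 P x"]
        inner_vec_def[of "c1 P y x"] inner_add_left mult.commute)
qed

fun fold_copy :: "('n0, 'n1, 'm1) zpoint \<Rightarrow> (real^'n0) \<times> (real^'n1)" where
  "fold_copy (gx, gy, gxt, gs) = (gx + gxt, gy)"

lemma joint_lagr_grad:
  assumes "regular (x, y, x, s1s)"
  shows "GDERIV joint_lagr (x, y) :> fold_copy (lagr_grad f' c' (x, y, x, s1s) ls)"
proof -
  obtain gx gy gxt gs where g: "lagr_grad f' c' (x, y, x, s1s) ls = (gx, gy, gxt, gs)" by (metis prod_cases4)
  have D: "GDERIV (\<lambda>z. zobj P z + zcon P z \<bullet> ls) (x, y, x, s1s) :> (gx, gy, gxt, gs)"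
    using lagrangian_GDERIV[of "zobj P" f' f'' _ "zcon P" c' c'' ls] assms unfolding regular_def g[symmetric] by blast
  from GDERIV_diff[OF GDERIV_partial(4)[OF D refl] GDERIV_const]
  show ?thesis unfolding joint_lagr_eq g by simp
qed

text \<open>Stationarity of the undecomposed Lagrangian gives only that the components for \<open>x\<close> and \<open>xt\<^sub>1\<close> cancel; the definition of
  \<open>\<eta>\<^sub>1\<^sup>*\<close> makes the one for \<open>xt\<^sub>1\<close> vanish separately.\<close>

lemma lagr_grad_solution: "lagr_grad f' c' zs ls = (0, 0, 0, l1s)"
proof -
  obtain gx gy gxt gs where g: "lagr_grad f' c' zs ls = (gx, gy, gxt, gs)" by (metis prod_cases4)
  have D: "GDERIV (\<lambda>z. zobj P z + zcon P z \<bullet> ls) zs :> (gx, gy, gxt, gs)"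
    using lagrangian_GDERIV[OF data, of ls] unfolding g .
  have "nlp_kkt (joint_obj P) (joint_con P) (xs, ys) (joint_mult l0s l1s)" using loc by auto
  then have "grad joint_lagr (xs, ys) = 0" unfolding nlp_kkt_def joint_lagr_def by simp
  with grad_eq[OF joint_lagr_grad[OF regular_zs]] have 1: "gx + gxt = 0" "gy = 0"
    unfolding g by (simp_all add: zero_prod_def)
  have D3: "GDERIV (\<lambda>xt'. zobj P (xs, ys, xt', s1s) + zcon P (xs, ys, xt', s1s) \<bullet> ls) xs :> gxt"
    using GDERIV_partial(3)[OF D] .
  have lin: "GDERIV (\<lambda>x'. x' \<bullet> e1s) xs :> e1s"
    unfolding gderiv_def by (auto intro!: derivative_eq_intros)
  have "(\<lambda>x'. f1 P ys x' + c1 P ys x' \<bullet> l1s)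
     = (\<lambda>x'. (zobj P (xs, ys, x', s1s) + zcon P (xs, ys, x', s1s) \<bullet> ls - x' \<bullet> e1s)
          - (f0 P xs + c0 P xs \<bullet> l0s + s1s \<bullet> l1s - xs \<bullet> e1s))"
    by (simp add: fun_eq_iff zobj_def zcon_def inner_add_left inner_diff_left)
  with GDERIV_diff[OF GDERIV_diff[OF D3 lin] GDERIV_const]
  have "GDERIV (\<lambda>x'. f1 P ys x' + c1 P ys x' \<bullet> l1s) xs :> gxt - e1s" by simp
  from grad_eq[OF this] have "e1s = - (gxt - e1s)" using loc by simp
  then have 2: "gxt = 0" by simp
  have "gs \<bullet> h = l1s \<bullet> h" for h
    using lagr_grad_slack[OF regular_zs, of l0s l1s e1s h] unfolding g by (simp add: inner_commute)
  then have "gs = l1s" using vector_eq_rdot by blast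
  then show ?thesis using g 1 2 by simp
qed

lemma G_solution: "G wst = 0"
proof -
  have "select I0 s0s l0s = 0" using multipliers0(4) by (auto simp: select_def vec_eq_iff I0_def)
  moreover have "comp_mult s1s l1s = 0" using multipliers1(4) by (auto simp: comp_mult_def vec_eq_iff I1_def)
  ultimately show ?thesis
    by (simp add: G_def lagr_grad_solution zcon_def slacks zero_prod_def)
qed

lemma joint_con_grad:
  "(hx, hy) \<bullet> grad (joint_con P (Inl i)) (xs, ys) = fst (c' zs (hx, hy, hx, 0)) $ i"
  "(hx, hy) \<bullet> grad (joint_con P (Inr j)) (xs, ys) = fst (snd (c' zs (hx, hy, hx, 0))) $ j"
proof -
  have i: "((\<lambda>q. (fst q, snd q, fst q, s1s)) has_derivative (\<lambda>h. (fst h, snd h, fst h, 0))) (at (xs, ys))"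
    by (auto intro!: derivative_eq_intros simp: zero_prod_def)
  have "(zcon P has_derivative c' zs) (at (fst (xs, ys), snd (xs, ys), fst (xs, ys), s1s))"
    using C2_dataD(1)[OF data(2)] by simp
  note D = has_derivative_compose[OF i this]
  have "((\<lambda>q. fst (zcon P (fst q, snd q, fst q, s1s)) $ i) has_derivative
     (\<lambda>h. fst (c' zs (fst h, snd h, fst h, 0)) $ i)) (at (xs, ys))"
    by (rule bounded_linear.has_derivative[OF bounded_linear_vec_nth has_derivative_fst[OF D]])
  moreover have "(\<lambda>q. fst (zcon P (fst q, snd q, fst q, s1s)) $ i) = joint_con P (Inl i)"
    by (auto simp: zcon_def)
  ultimately have "(joint_con P (Inl i) has_derivative (\<lambda>h. fst (c' zs (fst h, snd h, fst h, 0)) $ i)) (at (xs, ys))"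
    by simp
  from grad_inner_eq[OF this, of "(hx, hy)"]
  show "(hx, hy) \<bullet> grad (joint_con P (Inl i)) (xs, ys) = fst (c' zs (hx, hy, hx, 0)) $ i" by simp
  have "((\<lambda>q. fst (snd (zcon P (fst q, snd q, fst q, s1s))) $ j - s1s $ j) has_derivative
     (\<lambda>h. fst (snd (c' zs (fst h, snd h, fst h, 0))) $ j - 0)) (at (xs, ys))"
    by (intro has_derivative_diff has_derivative_const
         bounded_linear.has_derivative[OF bounded_linear_vec_nth has_derivative_fst[OF has_derivative_snd[OF D]]])
  moreover have "(\<lambda>q. fst (snd (zcon P (fst q, snd q, fst q, s1s))) $ j - s1s $ j) = joint_con P (Inr j)"
    by (auto simp: zcon_def)
  ultimately have "(joint_con P (Inr j) has_derivative (\<lambda>h. fst (snd (c' zs (fst h, snd h, fst h, 0))) $ j)) (at (xs, ys))"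
    by simp
  from grad_inner_eq[OF this, of "(hx, hy)"]
  show "(hx, hy) \<bullet> grad (joint_con P (Inr j)) (xs, ys) = fst (snd (c' zs (hx, hy, hx, 0))) $ j" by simp
qed

lemma joint_active: "Inl i \<in> nlp_active (joint_con P) (xs, ys) \<longleftrightarrow> i \<in> I0"
  "Inr j \<in> nlp_active (joint_con P) (xs, ys) \<longleftrightarrow> j \<in> I1"
  by (auto simp: nlp_active_def I0_def I1_def slacks)

text \<open>Second-order sufficiency transferred to \<open>z\<close>. By strict complementarity the critical cone is the subspace on which
  the active constraint gradients vanish.\<close>

lemma sosc:
  assumes d: "dx \<noteq> 0 \<or> dy \<noteq> 0"
    and a0: "\<And>i. i \<in> I0 \<Longrightarrow> fst (c' zs (dx, dy, dx, 0)) $ i = 0"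
    and a1: "\<And>j. j \<in> I1 \<Longrightarrow> fst (snd (c' zs (dx, dy, dx, 0))) $ j = 0"
  shows "0 < (dx, dy, dx, 0) \<bullet> lagr_hess f'' c'' zs ls (dx, dy, dx, 0)"
proof -
  have i: "((\<lambda>q. (fst q, snd q, fst q, s1s)) has_derivative (\<lambda>h. (fst h, snd h, fst h, 0))) (at (xs, ys))"
    by (auto intro!: derivative_eq_intros simp: zero_prod_def)
  have ff: "fold_copy = (\<lambda>g. (fst g + fst (snd (snd g)), fst (snd g)))"
    by (auto simp: fun_eq_iff)
  have bl: "bounded_linear fold_copy" unfolding ff by (intro bounded_linear_intros)
  have "((\<lambda>z. lagr_grad f' c' z ls) has_derivative lagr_hess f'' c'' zs ls) (at (fst (xs, ys), snd (xs, ys), fst (xs, ys), s1s))"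
    using lagr_grad_has_derivative[OF data] by simp
  note D = bounded_linear.has_derivative[OF bl has_derivative_compose[OF i this]]
  have lim: "filterlim (\<lambda>q. (fst q, snd q, fst q, s1s)) (nhds zs) (nhds (xs, ys))"
    using has_derivative_continuous[OF i] iffD1[OF tendsto_at_iff_tendsto_nhds, of "\<lambda>q. (fst q, snd q, fst q, s1s)" "(xs, ys)"]
    unfolding isCont_def by simp
  have ev: "\<forall>\<^sub>F q in nhds (xs, ys). grad joint_lagr q = fold_copy (lagr_grad f' c' (fst q, snd q, fst q, s1s) ls)"
    using eventually_compose_filterlim[OF regular_nearby[OF regular_zs] lim]
  proof eventually_elim
    case (elim q)
    from grad_eq[OF joint_lagr_grad[OF elim]] show ?case by simp
  qed
  have "(grad joint_lagr has_derivative (\<lambda>h. fold_copy (lagr_hess f'' c'' zs ls (fst h, snd h, fst h, 0)))) (at (xs, ys))"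
    by (rule has_derivative_transform_eventually[OF D])
       (use ev eventually_nhds_x_imp_x[OF ev] in \<open>auto simp: eventually_at_filter elim: eventually_mono\<close>)
  from fun_cong[OF frechet_derivative_at[OF this], of "(dx, dy)"]
  have H: "hess joint_lagr (xs, ys) (dx, dy) = fold_copy (lagr_hess f'' c'' zs ls (dx, dy, dx, 0))"
    unfolding hess_def by simp
  have "(dx, dy) \<in> nlp_critical_cone (joint_con P) (xs, ys) (joint_mult l0s l1s)"
    unfolding nlp_critical_cone_def
  proof (intro CollectI ballI)
    fix k assume k: "k \<in> nlp_active (joint_con P) (xs, ys)"
    have "grad (joint_con P k) (xs, ys) \<bullet> (dx, dy) = 0"
    proof (cases k)
      case (Inl i)
      then show ?thesis using k a0[of i] joint_con_grad(1)[of dx dy i] by (simp add: joint_active inner_commute)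
    next
      case (Inr j)
      then show ?thesis using k a1[of j] joint_con_grad(2)[of dx dy j] by (simp add: joint_active inner_commute)
    qed
    then show "grad (joint_con P k) (xs, ys) \<bullet> (dx, dy) \<le> 0 \<and>
       (0 < joint_mult l0s l1s k \<longrightarrow> grad (joint_con P k) (xs, ys) \<bullet> (dx, dy) = 0)" by simp
  qed
  moreover have "nlp_sosc (joint_obj P) (joint_con P) (xs, ys) (joint_mult l0s l1s)" using loc by auto
  moreover have "(dx, dy) \<noteq> 0" using d by (auto simp: zero_prod_def)
  ultimately have "0 < (dx, dy) \<bullet> hess joint_lagr (xs, ys) (dx, dy)"
    unfolding nlp_sosc_def joint_lagr_def by blast
  moreover obtain gx gy gxt gs where g: "lagr_hess f'' c'' zs ls (dx, dy, dx, 0) = (gx, gy, gxt, gs)" by (metis prod_cases4)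
  ultimately show ?thesis by (simp add: H g inner_add_right)
qed

lemma licq:
  assumes off: "\<And>i. i \<notin> I0 \<Longrightarrow> u0 $ i = 0" "\<And>j. j \<notin> I1 \<Longrightarrow> u1 $ j = 0"
    and zero: "\<And>hx hy. fst (c' zs (hx, hy, hx, 0)) \<bullet> u0 + fst (snd (c' zs (hx, hy, hx, 0))) \<bullet> u1 = 0"
  shows "u0 = 0" "u1 = 0"
proof -
  let ?u = "case_sum (\<lambda>i. u0 $ i) (\<lambda>j. u1 $ j)"
  define v where "v = (\<Sum>k\<in>UNIV. ?u k *\<^sub>R grad (joint_con P k) (xs, ys))"
  have "h \<bullet> v = 0" for h
  proof -
    obtain hx hy where h: "h = (hx, hy)" by (cases h)
    have "h \<bullet> v = fst (c' zs (hx, hy, hx, 0)) \<bullet> u0 + fst (snd (c' zs (hx, hy, hx, 0))) \<bullet> u1"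
      unfolding v_def h sum_UNIV_Plus inner_add_right inner_sum_right inner_scaleR_right joint_con_grad
      by (simp add: inner_vec_def mult.commute)
    then show ?thesis using zero by simp
  qed
  then have v: "v = 0" by (metis inner_eq_zero_iff)
  have "nlp_licq (joint_con P) (xs, ys)" using loc by auto
  moreover have "?u k = 0" if "k \<notin> nlp_active (joint_con P) (xs, ys)" for k
    using that off by (cases k) (auto simp: joint_active)
  ultimately have u: "?u k = 0" for k using v unfolding v_def by (rule nlp_licq_imp_zero)
  show "u0 = 0" using u[of "Inl _"] by (simp add: vec_eq_iff)
  show "u1 = 0" using u[of "Inr _"] by (simp add: vec_eq_iff)
qed

text \<open>The usual argument for KKT matrices. Complementarity makes \<open>ds\<^sub>0 \<bullet> dl\<^sub>0\<close> and \<open>ds\<^sub>1 \<bullet> dl\<^sub>1\<close> vanish, so pairing the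
  linearized stationarity condition with the primal part leaves the Hessian form of a critical direction,
  which must then be zero. The remaining condition on the multipliers is excluded by LICQ.\<close>

lemma G'_injective:
  assumes "G' wst d = 0"
  shows "d = 0"
proof -
  obtain dx dl0 ds0 dy dxt ds dl de where d: "d = ((dx, dl0, ds0), (dy, dxt, ds, dl, de))" by (cases d rule: zpart.cases)
  obtain D0 D1 where D01: "linear D0" "linear D1"
    and c': "\<And>hx hy hxt hs. c' zs (hx, hy, hxt, hs) = (D0 hx, D1 (hy, hxt) + hs, hxt - hx)"
    using con_derivative[OF regular_zs] has_derivative_linear by metis
  let ?dz = "(dx, dy, dxt, ds)" and ?dl = "(dl0, dl, de)"
  define V where "V = lagr_hess f'' c'' zs ls ?dz + adj (c' zs) ?dl"
  obtain vx vy vxt vs where V: "V = (vx, vy, vxt, vs)" by (metis prod_cases4)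
  have "assemble I0 (V, c' zs ?dz, comp_mult s1s dl + comp_mult ds l1s, d) = 0"
    using assms by (simp add: G'_def d V_def)
  then have e: "vx = 0" "vy = 0" "vxt = 0" "D0 dx + ds0 = 0" "D1 (dy, dxt) + ds = 0" "dxt = dx"
    "select I0 ds0 dl0 = 0" "comp_mult s1s dl + comp_mult ds l1s = 0"
    by (auto simp: d V c' zero_prod_def)
  have s0: "i \<in> I0 \<Longrightarrow> ds0 $ i = 0" "i \<notin> I0 \<Longrightarrow> dl0 $ i = 0" for i
    using arg_cong[OF e(7), of "\<lambda>v. v $ i"] by (auto simp: select_def)
  have s1: "s1s $ j * dl $ j + ds $ j * l1s $ j = 0" for j
    using arg_cong[OF e(8), of "\<lambda>v. v $ j"] by (auto simp: comp_mult_def)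
  have s1a: "j \<in> I1 \<Longrightarrow> ds $ j = 0" for j
    using s1[of j] multipliers1(3)[of j] by (auto simp: I1_def)
  have s1b: "j \<notin> I1 \<Longrightarrow> dl $ j = 0" for j
    using s1[of j] multipliers1(4,5)[of j] by auto
  have p0: "ds0 \<bullet> dl0 = 0" unfolding inner_vec_def using s0 by (intro sum.neutral) (metis inner_real_def mult_zero_left mult_zero_right)
  have p1: "ds \<bullet> dl = 0" unfolding inner_vec_def using s1a s1b by (intro sum.neutral) (metis inner_real_def mult_zero_left mult_zero_right)
  have Vin: "h \<bullet> V = h \<bullet> lagr_hess f'' c'' zs ls ?dz + c' zs h \<bullet> ?dl" for h
    by (simp add: V_def inner_add_right adj_inner')
  have "h \<bullet> vs = h \<bullet> dl" for h
    using Vin[of "(0, 0, 0, h)"] lagr_hess_slack[OF regular_zs] derivative_slack(2)[OF regular_zs] by (simp add: V)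
  then have vs: "vs = dl" using vector_eq_ldot by blast
  have D0dx: "D0 dx = - ds0" "D1 (dy, dx) = - ds" using e(4,5) unfolding e(6) by (simp_all add: eq_neg_iff_add_eq_0)
  have "?dz \<bullet> V = 0" using p1 by (simp add: V e vs)
  then have Q: "?dz \<bullet> lagr_hess f'' c'' zs ls ?dz = 0"
    unfolding Vin using p0 by (simp add: c' D0dx e(6))
  have z: "dx = 0 \<and> dy = 0"
  proof (rule ccontr)
    assume "\<not> ?thesis"
    then have "dx \<noteq> 0 \<or> dy \<noteq> 0" by blast
    from sosc[OF this] have "0 < (dx, dy, dx, 0) \<bullet> lagr_hess f'' c'' zs ls (dx, dy, dx, 0)"
      using s0(1) s1a D0dx by (simp add: c' e(6))
    then show False using Q hess_slack_free[OF regular_zs, of dx dy dx ds ls] e(6) by simp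
  qed
  have ds: "ds = 0" "ds0 = 0"
    using D0dx z e(6) linear_0[OF D01(1)] linear_0[OF D01(2)] by (simp_all add: zero_prod_def)
  have H0: "lagr_hess f'' c'' zs ls ?dz = 0"
    using z ds e(6) linear_0[OF linear_hess[OF regular_zs]] by (simp add: zero_prod_def)
  have c0: "c' zs h \<bullet> ?dl = snd (snd (snd h)) \<bullet> dl" for h
    using Vin[of h] by (cases h) (simp add: H0 V e(1-3) vs)
  have "dl0 = 0 \<and> dl = 0"
  proof -
    have "fst (c' zs (hx, hy, hx, 0)) \<bullet> dl0 + fst (snd (c' zs (hx, hy, hx, 0))) \<bullet> dl = 0" for hx hy
      using c0[of "(hx, hy, hx, 0)"] by (simp add: c')
    from licq[of dl0 dl, OF s0(2) s1b this] show ?thesis by blast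
  qed
  moreover have "de = 0"
  proof -
    have "de \<bullet> de = 0"
      using c0[of "(de, 0, 0, 0)"] calculation by (simp add: c')
    then show ?thesis by simp
  qed
  ultimately show ?thesis using z ds e(6) by (simp add: d zero_prod_def)
qed

end



section \<open>The extrapolation step as a Newton step\<close>

lemma C1_lipschitz_near_isCont_derivative:
  assumes "C1_lipschitz_near g g' p"
  shows "isCont (\<lambda>(q, d). g' q d) (p, d0)"
proof -
  from assms obtain r K where rK: "0 < r" "0 \<le> K"
    and der: "\<And>q. q \<in> ball p r \<Longrightarrow> (g has_derivative g' q) (at q)"
    and lip: "\<And>q q' d. q \<in> ball p r \<Longrightarrow> q' \<in> ball p r \<Longrightarrow> norm (g' q d - g' q' d) \<le> K * norm (q - q') * norm d"
    unfolding C1_lipschitz_near_def by blast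
  have pb: "p \<in> ball p r" using rK by simp
  have bl: "bounded_linear (g' p)" using der[OF pb] by (rule has_derivative_bounded_linear)
  have t1: "(fst \<longlongrightarrow> p) (at (p, d0))" and t2: "(snd \<longlongrightarrow> d0) (at (p, d0))"
    using tendsto_fst[OF tendsto_ident_at, of "(p, d0)" UNIV] tendsto_snd[OF tendsto_ident_at, of "(p, d0)" UNIV] by auto
  have "((\<lambda>u. g' (fst u) (snd u) - g' p (snd u)) \<longlongrightarrow> 0) (at (p, d0))"
  proof (rule Lim_null_comparison)
    have "\<forall>\<^sub>F u in at (p, d0). fst u \<in> ball p r"
      by (rule topological_tendstoD[OF t1 open_ball pb])
    then show "\<forall>\<^sub>F u in at (p, d0). norm (g' (fst u) (snd u) - g' p (snd u)) \<le> K * norm (fst u - p) * norm (snd u)"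
      by eventually_elim (rule lip[OF _ pb])
    have "((\<lambda>u. K * norm (fst u - p) * norm (snd u)) \<longlongrightarrow> K * norm (p - p) * norm d0) (at (p, d0))"
      by (intro tendsto_intros t1 t2)
    then show "((\<lambda>u. K * norm (fst u - p) * norm (snd u)) \<longlongrightarrow> 0) (at (p, d0))" by simp
  qed
  moreover have "((\<lambda>u. g' p (snd u)) \<longlongrightarrow> g' p d0) (at (p, d0))"
    by (rule bounded_linear.tendsto[OF bl t2])
  ultimately have "((\<lambda>u. (g' (fst u) (snd u) - g' p (snd u)) + g' p (snd u)) \<longlongrightarrow> 0 + g' p d0) (at (p, d0))"
    by (rule tendsto_add)
  then show ?thesis by (simp add: isCont_def case_prod_beta')
qed

context primal_dual_solution
begin

text \<open>The Hessian of the extrapolation quadratic program, including the primal-dual barrier term.\<close>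

fun barrier_hess :: "('n0, 'n1, 'm0, 'm1) wpoint \<Rightarrow> ('n0, 'n1, 'm1) zpoint \<Rightarrow> ('n0, 'n1, 'm1) zpoint" where
  "barrier_hess w (dx, dy, dxt, ds) = lagr_hess f'' c'' (zpart w) (wmult w) (dx, dy, dxt, ds)
     + (0, 0, 0, \<chi> j. (mult1 w $ j / slack1 w $ j) * ds $ j)"

definition barrier_grad :: "real \<Rightarrow> ('n0, 'n1, 'm1) zpoint \<Rightarrow> ('n0, 'n1, 'm1) zpoint" where
  "barrier_grad \<mu> z = adj (f' z) 1 + (0, 0, 0, \<chi> j. - \<mu> / snd (snd (snd z)) $ j)"

lemma grad_phi:
  assumes r: "regular (x, y, xt, s)" and s: "\<And>j. 0 < s $ j"
  shows "grad (phi P \<mu>) (x, y, xt, s) = barrier_grad \<mu> (x, y, xt, s)"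
proof (rule grad_eq)
  have f: "(zobj P has_derivative f' (x, y, xt, s)) (at (x, y, xt, s))"
    using C2_dataD(1)[of "zobj P" f' f''] r by (simp add: regular_def)
  have p: "((\<lambda>z. snd (snd (snd z)) $ j) has_derivative (\<lambda>d. snd (snd (snd d)) $ j)) (at (x, y, xt, s))" for j
    by (rule bounded_linear_imp_has_derivative) (intro bounded_linear_intros bounded_linear_compose[OF bounded_linear_vec_nth])
  have l: "((\<lambda>z. ln (snd (snd (snd z)) $ j)) has_derivative (\<lambda>d. snd (snd (snd d)) $ j / s $ j)) (at (x, y, xt, s))" for j
    using has_derivative_ln[OF _ p, of j] s[of j] by (simp add: divide_inverse)
  have "((\<lambda>z. zobj P z - \<mu> * (\<Sum>j\<in>UNIV. ln (snd (snd (snd z)) $ j))) has_derivative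
     (\<lambda>d. f' (x, y, xt, s) d - \<mu> * (\<Sum>j\<in>UNIV. snd (snd (snd d)) $ j / s $ j))) (at (x, y, xt, s))"
    by (intro has_derivative_diff f has_derivative_mult_right has_derivative_sum l)
  moreover have "(\<lambda>z. zobj P z - \<mu> * (\<Sum>j\<in>UNIV. ln (snd (snd (snd z)) $ j))) = phi P \<mu>"
    by (auto simp: fun_eq_iff zobj_def)
  moreover have "(\<lambda>d. f' (x, y, xt, s) d - \<mu> * (\<Sum>j\<in>UNIV. snd (snd (snd d)) $ j / s $ j)) = (\<lambda>d. d \<bullet> barrier_grad \<mu> (x, y, xt, s))"
  proof
    fix d :: "('n0, 'n1, 'm1) zpoint"
    obtain a b c ds where d: "d = (a, b, c, ds)" by (cases d)
    have "\<mu> * (\<Sum>j\<in>UNIV. ds $ j / s $ j) = - (\<Sum>j\<in>UNIV. ds $ j * (- \<mu> / s $ j))"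
      by (simp add: sum_distrib_left sum_negf[symmetric] mult.commute)
    then show "f' (x, y, xt, s) d - \<mu> * (\<Sum>j\<in>UNIV. snd (snd (snd d)) $ j / s $ j) = d \<bullet> barrier_grad \<mu> (x, y, xt, s)"
      by (simp add: barrier_grad_def inner_add_right adj_inner' d inner_vec_def)
  qed
  ultimately show "GDERIV (phi P \<mu>) (x, y, xt, s) :> barrier_grad \<mu> (x, y, xt, s)"
    unfolding gderiv_def by simp
qed

text \<open>In these terms the quadratic program has the form treated by \<open>qp_local_min_sufficient\<close>.\<close>

lemma qp_obj_eq:
  assumes r: "regular (x, y, xt, s)" and s: "\<And>j. 0 < s $ j" and w: "w = ((x, l0, s0), (y, xt, s, l, e))"
  shows "qp_obj P \<mu> w d = barrier_grad \<mu> (x, y, xt, s) \<bullet> d + 1/2 * (d \<bullet> barrier_hess w d)"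
proof -
  obtain dx dy dxt ds where d: "d = (dx, dy, dxt, ds)" by (cases d)
  have L: "(\<lambda>(x', y', xt', s1'). lagrangian P ((x', l0, s0), (y', xt', s1', l, e))) = (\<lambda>z. zobj P z + zcon P z \<bullet> (l0, l, e))"
    by (simp add: fun_eq_iff lagrangian_eq del: lagrangian.simps)
  have h: "hess (\<lambda>z. zobj P z + zcon P z \<bullet> (l0, l, e)) (x, y, xt, s) = lagr_hess f'' c'' (x, y, xt, s) (l0, l, e)"
    using lagrangian_hess[of "zobj P" f' f'' _ "zcon P" c' c''] r by (simp add: regular_def)
  have q: "(\<Sum>j\<in>UNIV. ds $ j * (l $ j / s $ j) * ds $ j) = ds \<bullet> (\<chi> j. (l $ j / s $ j) * ds $ j)"
    by (simp add: inner_vec_def mult.assoc)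
  show ?thesis
    unfolding w d qp_obj.simps Let_def L h grad_phi[OF r s] q barrier_hess.simps
    by (simp add: inner_add_right del: inner_Pair) (simp add: algebra_simps)
qed

lemma qp_constraints_eq:
  assumes r: "regular (x, y, xt, s)" and w: "w = ((x, l0, s0), (y, xt, s, l, e))"
  shows "qp_ineq P w d = fst (c' (x, y, xt, s) d) + c0 P x" "qp_eq P w d = snd (c' (x, y, xt, s) d) + ctil P (x, y, xt, s)"
proof -
  have c: "(zcon P has_derivative c' (x, y, xt, s)) (at (x, y, xt, s))"
    using C2_dataD(1)[of "zcon P" c' c''] r by (simp add: regular_def)
  have "(\<lambda>z. snd (zcon P z)) = ctil P" by (simp add: fun_eq_iff zcon_def)
  with has_derivative_snd[OF c] have "(ctil P has_derivative (\<lambda>d. snd (c' (x, y, xt, s) d))) (at (x, y, xt, s))" by simp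
  from frechet_derivative_at[OF this, symmetric] show "qp_eq P w d = snd (c' (x, y, xt, s) d) + ctil P (x, y, xt, s)"
    by (simp add: qp_eq_def w del: ctil.simps)
  show "qp_ineq P w d = fst (c' (x, y, xt, s) d) + c0 P x"
    by (cases d) (simp add: qp_ineq_def w con_derivative(3)[OF r])
qed

lemma linear_barrier_hess:
  assumes "regular (zpart w)" shows "linear (barrier_hess w)"
proof -
  have e: "barrier_hess w = (\<lambda>d. lagr_hess f'' c'' (zpart w) (wmult w) d + (0, 0, 0, \<chi> j. (mult1 w $ j / slack1 w $ j) * snd (snd (snd d)) $ j))"
    by (auto simp: fun_eq_iff)
  have "linear (\<lambda>d::('n0, 'n1, 'm1) zpoint. (0, 0, 0, \<chi> j. (mult1 w $ j / slack1 w $ j) * snd (snd (snd d)) $ j) :: ('n0, 'n1, 'm1) zpoint)"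
    by (rule linearI) (auto simp: vec_eq_iff algebra_simps)
  then show ?thesis unfolding e by (intro linear_compose_add linear_hess assms)
qed

lemma barrier_hess_symmetric:
  assumes "regular (zpart w)" shows "d \<bullet> barrier_hess w d' = d' \<bullet> barrier_hess w d"
proof -
  obtain a b c g where d: "d = (a, b, c, g)" by (cases d)
  obtain a' b' c' g' where d': "d' = (a', b', c', g')" by (cases d')
  have "(\<Sum>j\<in>UNIV. g $ j * (mult1 w $ j * g' $ j / slack1 w $ j)) = (\<Sum>j\<in>UNIV. g' $ j * (mult1 w $ j * g $ j / slack1 w $ j))"
    by (intro sum.cong) auto
  then show ?thesis
    using hess_symmetric[OF assms, of d "wmult w" d'] unfolding d d' barrier_hess.simps inner_add_right
    by (simp add: inner_vec_def[where ?'b = 'm1])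
qed

lemma qp_multipliers_iff:
  assumes r: "regular (x, y, xt, s)" and s: "\<And>j. 0 < s $ j" and w: "w = ((x, l0, s0), (y, xt, s, l, e))"
  shows "qp_multipliers P \<mu> w dz l0p l1p e1p \<longleftrightarrow>
    barrier_grad \<mu> (x, y, xt, s) + barrier_hess w dz + adj (c' (x, y, xt, s)) (l0p, l1p, e1p) = 0 \<and>
    0 \<le> l0p \<and> comp_mult l0p (fst (c' (x, y, xt, s) dz) + c0 P x) = 0"
proof -
  let ?z = "(x, y, xt, s)" and ?b = "barrier_grad \<mu> (x, y, xt, s)" and ?C = "blinfun_apply (c' (x, y, xt, s))"
  have rw: "regular (zpart w)" using r w by simp
  have bl: "bounded_linear (barrier_hess w)" using linear_barrier_hess[OF rw] linear_conv_bounded_linear by blast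
  have B: "(barrier_hess w has_derivative barrier_hess w) (at dz)" by (rule bounded_linear_imp_has_derivative[OF bl])
  have C: "(?C has_derivative ?C) (at dz)" by (rule bounded_linear_imp_has_derivative[OF blinfun.bounded_linear_right])
  have 1: "((\<lambda>d. ?b \<bullet> d + 1/2 * (d \<bullet> barrier_hess w d)) has_derivative
        (\<lambda>h. ?b \<bullet> h + 1/2 * (dz \<bullet> barrier_hess w h + h \<bullet> barrier_hess w dz))) (at dz)"
    by (intro has_derivative_add has_derivative_mult_right has_derivative_inner_right has_derivative_inner has_derivative_ident B)
  have 2: "((\<lambda>d. (fst (?C d) + c0 P x) \<bullet> l0p) has_derivative (\<lambda>h. (fst (?C h) + 0) \<bullet> l0p)) (at dz)"
    by (intro has_derivative_inner_left has_derivative_add has_derivative_fst C has_derivative_const)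
  have 3: "((\<lambda>d. (snd (?C d) + ctil P ?z) \<bullet> (l1p, e1p)) has_derivative (\<lambda>h. (snd (?C h) + 0) \<bullet> (l1p, e1p))) (at dz)"
    by (intro has_derivative_inner_left has_derivative_add has_derivative_snd C has_derivative_const)
  have "(\<lambda>d. qp_obj P \<mu> w d + qp_ineq P w d \<bullet> l0p + qp_eq P w d \<bullet> (l1p, e1p)) =
     (\<lambda>d. (?b \<bullet> d + 1/2 * (d \<bullet> barrier_hess w d)) + (fst (?C d) + c0 P x) \<bullet> l0p + (snd (?C d) + ctil P ?z) \<bullet> (l1p, e1p))"
    by (intro ext) (simp only: qp_obj_eq[OF r s w] qp_constraints_eq[OF r w])
  moreover have "(\<lambda>h. (?b \<bullet> h + 1/2 * (dz \<bullet> barrier_hess w h + h \<bullet> barrier_hess w dz)) + (fst (?C h) + 0) \<bullet> l0p + (snd (?C h) + 0) \<bullet> (l1p, e1p))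
     = (\<lambda>h. h \<bullet> (?b + barrier_hess w dz + adj (c' ?z) (l0p, l1p, e1p)))"
  proof
    fix h
    have e: "?C h \<bullet> (l0p, l1p, e1p) = fst (?C h) \<bullet> l0p + snd (?C h) \<bullet> (l1p, e1p)"
      by (cases "?C h") simp
    show "(?b \<bullet> h + 1/2 * (dz \<bullet> barrier_hess w h + h \<bullet> barrier_hess w dz)) + (fst (?C h) + 0) \<bullet> l0p + (snd (?C h) + 0) \<bullet> (l1p, e1p)
       = h \<bullet> (?b + barrier_hess w dz + adj (c' ?z) (l0p, l1p, e1p))"
      unfolding inner_add_right adj_inner' e barrier_hess_symmetric[OF rw, of dz h]
      by (simp add: inner_commute[of h ?b])
  qed
  ultimately have "GDERIV (\<lambda>d. qp_obj P \<mu> w d + qp_ineq P w d \<bullet> l0p + qp_eq P w d \<bullet> (l1p, e1p)) dz :>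
     ?b + barrier_hess w dz + adj (c' ?z) (l0p, l1p, e1p)"
    using has_derivative_add[OF has_derivative_add[OF 1 2] 3] unfolding gderiv_def by simp
  from grad_eq[OF this] show ?thesis
    unfolding qp_multipliers_def qp_constraints_eq[OF r w] by simp
qed

text \<open>Stationarity of the quadratic program and the Newton equation differ only in the slack component: there, the former is
  the linearization of \<open>s\<^sub>1 \<circ> \<lambda>\<^sub>1 = \<mu>\<close> divided by \<open>s\<^sub>1\<close>.\<close>

lemma newton_components:
  assumes r: "regular (x, y, xt, s)" and s: "\<And>j. 0 < s $ j" and w: "w = ((x, l0, s0), (y, xt, s, l, e))"
    and d: "d = ((dx, dl0, ds0), (dy, dxt, ds, dl, de))"
  shows "G w + G' w d = \<mu> *\<^sub>R barrier_dir \<longleftrightarrow>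
    barrier_grad \<mu> (x, y, xt, s) + barrier_hess w (dx, dy, dxt, ds) + adj (c' (x, y, xt, s)) (l0 + dl0, l + dl, e + de) = 0 \<and>
    fst (c' (x, y, xt, s) (dx, dy, dxt, ds)) + c0 P x + (s0 + ds0) = 0 \<and>
    snd (c' (x, y, xt, s) (dx, dy, dxt, ds)) + ctil P (x, y, xt, s) = 0 \<and>
    select I0 (s0 + ds0) (l0 + dl0) = 0"
proof -
  let ?z = "(x, y, xt, s)" and ?dz = "(dx, dy, dxt, ds)"
  \<comment> \<open>Both sides contain this linearized gradient of the Lagrangian without barrier terms; its slack component is the new \<open>\<lambda>\<^sub>1\<close>.\<close>
  define R where "R = adj (f' ?z) 1 + lagr_hess f'' c'' ?z (l0, l, e) ?dz + adj (c' ?z) (l0 + dl0, l + dl, e + de)"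
  obtain rx ry rxt rs where R: "R = (rx, ry, rxt, rs)" by (cases R)
  have "h \<bullet> rs = h \<bullet> (l + dl)" for h
  proof -
    have "(0, 0, 0, h) \<bullet> R = h \<bullet> (l + dl)"
      unfolding R_def inner_add_right adj_inner' lagr_hess_slack[OF r] derivative_slack[OF r] by (simp add: inner_add_right)
    then show ?thesis by (simp add: R)
  qed
  then have rs: "rs = l + dl" using vector_eq_ldot by blast
  obtain k0 k1 ke where k: "c' ?z ?dz = (k0, k1, ke)" by (cases "c' ?z ?dz")
  have grads: "lagr_grad f' c' ?z (l0, l, e) + (lagr_hess f'' c'' ?z (l0, l, e) ?dz + adj (c' ?z) (dl0, dl, de)) = R"
  proof -
    have "(l0 + dl0, l + dl, e + de) = (l0, l, e) + (dl0, dl, de)" by simp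
    then show ?thesis by (simp only: R_def lagr_grad_def adj.add_right) (simp add: ac_simps)
  qed
  have "G w + G' w d = assemble I0 (R, zcon P ?z + c' ?z ?dz, comp_mult s l + (comp_mult s dl + comp_mult ds l), w + d)"
    unfolding G_def G'_def linear_add[OF bounded_linear.linear[OF bounded_linear_assemble], symmetric]
    by (simp only: w d zpart.simps wmult.simps slack1.simps mult1.simps add_Pair grads)
  also have "\<dots> = ((rx, c0 P x + k0 + (s0 + ds0), select I0 (s0 + ds0) (l0 + dl0)),
       (ry, rxt, comp_mult s l + (comp_mult s dl + comp_mult ds l), (c1 P y xt + s) + k1, (xt - x) + ke))"
    by (simp add: R k w d zcon_def)
  finally have N: "G w + G' w d = \<mu> *\<^sub>R barrier_dir \<longleftrightarrow>
      rx = 0 \<and> c0 P x + k0 + (s0 + ds0) = 0 \<and> select I0 (s0 + ds0) (l0 + dl0) = 0 \<and> ry = 0 \<and> rxt = 0 \<and>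
      comp_mult s l + (comp_mult s dl + comp_mult ds l) = \<mu> *\<^sub>R (\<chi> j. 1) \<and> (c1 P y xt + s) + k1 = 0 \<and> (xt - x) + ke = 0"
    by (auto simp: barrier_dir_def)
  have "barrier_grad \<mu> ?z + barrier_hess w ?dz + adj (c' ?z) (l0 + dl0, l + dl, e + de)
     = R + (0, 0, 0, (\<chi> j. - \<mu> / s $ j) + (\<chi> j. (l $ j / s $ j) * ds $ j))"
    by (simp add: barrier_grad_def R_def w del: add_Pair) (simp add: ac_simps)
  also have "\<dots> = (rx, ry, rxt, (l + dl) + ((\<chi> j. - \<mu> / s $ j) + (\<chi> j. (l $ j / s $ j) * ds $ j)))"
    by (simp add: R rs)
  finally have K: "barrier_grad \<mu> ?z + barrier_hess w ?dz + adj (c' ?z) (l0 + dl0, l + dl, e + de) = 0 \<longleftrightarrow>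
     rx = 0 \<and> ry = 0 \<and> rxt = 0 \<and> (l + dl) + ((\<chi> j. - \<mu> / s $ j) + (\<chi> j. (l $ j / s $ j) * ds $ j)) = 0"
    by (simp add: zero_prod_def)
  have "s $ j * l $ j + (s $ j * dl $ j + ds $ j * l $ j) = \<mu> \<longleftrightarrow>
      (l $ j + dl $ j) + (- \<mu> / s $ j + (l $ j / s $ j) * ds $ j) = 0" for j
    using s[of j] by (auto simp: field_simps)
  then have C: "comp_mult s l + (comp_mult s dl + comp_mult ds l) = \<mu> *\<^sub>R (\<chi> j. 1) \<longleftrightarrow>
     (l + dl) + ((\<chi> j. - \<mu> / s $ j) + (\<chi> j. (l $ j / s $ j) * ds $ j)) = 0"
    by (simp add: vec_eq_iff comp_mult_def)
  show ?thesis unfolding N K C k by (auto simp: zero_prod_def add.commute add.left_commute)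
qed

text \<open>If the step leads near the solution, the new \<open>\<lambda>\<^sub>0\<close> is positive at active constraints and the new \<open>s\<^sub>0\<close> at inactive ones.
  Complementarity of the quadratic program then annihilates the other factor, which is what the selected block
  of the Newton equation says.\<close>

lemma qp_step_imp_newton:
  assumes r: "regular (x, y, xt, s)" and s: "\<And>j. 0 < s $ j" and w: "w = ((x, l0, s0), (y, xt, s, l, e))"
    and step: "qp_step P \<mu> w d" and near: "norm (w + d - wst) < gap"
  shows "G w + G' w d = \<mu> *\<^sub>R barrier_dir"
proof -
  from step obtain dz l0p l1p e1p where st: "qp_local_min P \<mu> w dz" "qp_multipliers P \<mu> w dz l0p l1p e1p"
    "d = primal_dual_step P w dz l0p l1p e1p" unfolding qp_step_def by blast
  obtain dx dy dxt ds where dz: "dz = (dx, dy, dxt, ds)" by (cases dz)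
  let ?q = "fst (c' (x, y, xt, s) dz) + c0 P x"
  have d: "d = ((dx, l0p - l0, - ?q - s0), (dy, dxt, ds, l1p - l, e1p - e))"
    using st(3) qp_constraints_eq(1)[OF r w] unfolding w dz by simp
  have "qp_feasible P w dz" using st(1) by (simp add: qp_local_min_def)
  then have feas: "?q \<le> 0" "snd (c' (x, y, xt, s) dz) + ctil P (x, y, xt, s) = 0"
    unfolding qp_feasible_def qp_constraints_eq[OF r w] by auto
  have mult: "barrier_grad \<mu> (x, y, xt, s) + barrier_hess w dz + adj (c' (x, y, xt, s)) (l0p, l1p, e1p) = 0"
    "0 \<le> l0p" "comp_mult l0p ?q = 0"
    using st(2) unfolding qp_multipliers_iff[OF r s w] by auto
  have wd: "w + d = ((x + dx, l0p, - ?q), (y + dy, xt + dxt, s + ds, l1p, e1p))"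
    by (simp add: w d)
  have "select I0 (- ?q) l0p = 0"
    unfolding vec_eq_iff
  proof
    fix i
    have c: "l0p $ i * ?q $ i = 0" using mult(3) by (simp add: comp_mult_def vec_eq_iff)
    have n: "\<bar>l0p $ i - l0s $ i\<bar> < gap" "\<bar>(- ?q) $ i - s0s $ i\<bar> < gap"
      using components_near(1,2)[OF wd, of i] near by linarith+
    show "select I0 (- ?q) l0p $ i = 0 $ i"
    proof (cases "i \<in> I0")
      case True
      then have "0 < l0p $ i" using gap(1) gap(2)[OF True] n by linarith
      then show ?thesis using c True by (simp add: select_def)
    next
      case False
      then have "?q $ i < 0" using gap(1) gap(3)[OF False] n by auto
      then show ?thesis using c False by (simp add: select_def)
    qed
  qed
  then show ?thesis
    unfolding newton_components[OF r s w d] using mult(1) feas(2) by (simp add: dz)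
qed

text \<open>Conversely, the Newton equation annihilates one factor and nearness makes the other one positive: strict
  complementarity holds at the Newton point. The curvature condition makes it a local
  minimum although the program need not be convex.\<close>

lemma newton_imp_qp_step:
  assumes r: "regular (x, y, xt, s)" and s: "\<And>j. 0 < s $ j" and w: "w = ((x, l0, s0), (y, xt, s, l, e))"
    and M: "0 < M" and curv: "\<And>h. snd (c' (x, y, xt, s) h) = 0 \<Longrightarrow>
       0 \<le> h \<bullet> barrier_hess w h + M * (\<Sum>i\<in>I0. (fst (c' (x, y, xt, s) h) $ i)\<^sup>2)"
    and newton: "G w + G' w d = \<mu> *\<^sub>R barrier_dir" and near: "norm (w + d - wst) < gap"
  shows "qp_step P \<mu> w d"
proof -
  obtain dx dl0 ds0 dy dxt ds dl de where d: "d = ((dx, dl0, ds0), (dy, dxt, ds, dl, de))" by (cases d rule: zpart.cases)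
  let ?dz = "(dx, dy, dxt, ds)" and ?C = "blinfun_apply (c' (x, y, xt, s))"
  have rw: "regular (zpart w)" using r w by simp
  have wd: "w + d = ((x + dx, l0 + dl0, s0 + ds0), (y + dy, xt + dxt, s + ds, l + dl, e + de))"
    by (simp add: w d)
  note nc = iffD1[OF newton_components[OF r s w d] newton]
  from nc have kkt: "barrier_grad \<mu> (x, y, xt, s) + barrier_hess w ?dz + adj (c' (x, y, xt, s)) (l0 + dl0, l + dl, e + de) = 0"
    and c0: "fst (?C ?dz) + c0 P x + (s0 + ds0) = 0" and ce: "snd (?C ?dz) + ctil P (x, y, xt, s) = 0"
    and sel: "select I0 (s0 + ds0) (l0 + dl0) = 0" by blast+
  have q: "fst (?C ?dz) + c0 P x = - (s0 + ds0)" using c0 by (simp only: eq_neg_iff_add_eq_0)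
  have comps: "i \<in> I0 \<Longrightarrow> (s0 + ds0) $ i = 0 \<and> 0 < (l0 + dl0) $ i" "i \<notin> I0 \<Longrightarrow> (l0 + dl0) $ i = 0 \<and> 0 < (s0 + ds0) $ i" for i
  proof -
    have n: "\<bar>(l0 + dl0) $ i - l0s $ i\<bar> < gap" "\<bar>(s0 + ds0) $ i - s0s $ i\<bar> < gap"
      using components_near(1,2)[OF wd, of i] near by linarith+
    have sl: "select I0 (s0 + ds0) (l0 + dl0) $ i = 0" using sel by simp
    show "i \<in> I0 \<Longrightarrow> (s0 + ds0) $ i = 0 \<and> 0 < (l0 + dl0) $ i"
      using sl gap(1) gap(2)[of i] n by (simp add: select_def)
    show "i \<notin> I0 \<Longrightarrow> (l0 + dl0) $ i = 0 \<and> 0 < (s0 + ds0) $ i"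
      using sl gap(1) gap(3)[of i] n by (simp add: select_def)
  qed
  have l0p: "0 \<le> l0 + dl0" unfolding less_eq_vec_def
    using comps by (metis less_eq_real_def zero_index order_refl)
  have s0p: "0 \<le> s0 + ds0" unfolding less_eq_vec_def
    using comps by (metis less_eq_real_def zero_index order_refl)
  have q0: "- (s0 + ds0) \<le> 0"
    unfolding less_eq_vec_def
  proof
    fix i
    have "0 \<le> (s0 + ds0) $ i" using s0p by (simp add: less_eq_vec_def)
    then show "(- (s0 + ds0)) $ i \<le> 0 $ i" by simp
  qed
  have cm: "comp_mult (l0 + dl0) (- (s0 + ds0)) = 0"
    unfolding vec_eq_iff
  proof
    fix i
    show "comp_mult (l0 + dl0) (- (s0 + ds0)) $ i = 0 $ i"
      using comps[of i] by (cases "i \<in> I0") (auto simp: comp_mult_def)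
  qed
  have "qp_multipliers P \<mu> w ?dz (l0 + dl0) (l + dl) (e + de)"
    unfolding qp_multipliers_iff[OF r s w] q
    using kkt l0p cm by blast
  moreover have "qp_local_min P \<mu> w ?dz"
    unfolding qp_local_min_def
  proof
    show "qp_feasible P w ?dz"
      unfolding qp_feasible_def qp_constraints_eq[OF r w] q using ce q0 by blast
    have "\<exists>\<rho>>0. \<forall>e'. fst (?C e') + c0 P x \<le> 0 \<and> snd (?C e') + ctil P (x, y, xt, s) = 0 \<and> dist e' ?dz < \<rho> \<longrightarrow>
       barrier_grad \<mu> (x, y, xt, s) \<bullet> ?dz + 1/2 * (?dz \<bullet> barrier_hess w ?dz)
         \<le> barrier_grad \<mu> (x, y, xt, s) \<bullet> e' + 1/2 * (e' \<bullet> barrier_hess w e')"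
    proof (rule qp_local_min_sufficient[where l="l0 + dl0" and m="(l + dl, e + de)" and I=I0 and M=M])
      show "linear (barrier_hess w)" by (rule linear_barrier_hess[OF rw])
      show "d \<bullet> barrier_hess w e = e \<bullet> barrier_hess w d" for d e by (rule barrier_hess_symmetric[OF rw])
      show "bounded_linear (\<lambda>e. fst (?C e))" by (intro bounded_linear_intros)
      show "linear (\<lambda>e. snd (?C e))" by (rule bounded_linear.linear) (intro bounded_linear_intros)
      show "(barrier_grad \<mu> (x, y, xt, s) + barrier_hess w ?dz) \<bullet> h + fst (?C h) \<bullet> (l0 + dl0) + snd (?C h) \<bullet> (l + dl, e + de) = 0" for h
      proof -
        have "?C h \<bullet> (l0 + dl0, l + dl, e + de) = fst (?C h) \<bullet> (l0 + dl0) + snd (?C h) \<bullet> (l + dl, e + de)"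
          by (cases "?C h") simp
        then have "(barrier_grad \<mu> (x, y, xt, s) + barrier_hess w ?dz) \<bullet> h + fst (?C h) \<bullet> (l0 + dl0) + snd (?C h) \<bullet> (l + dl, e + de)
          = (barrier_grad \<mu> (x, y, xt, s) + barrier_hess w ?dz + adj (c' (x, y, xt, s)) (l0 + dl0, l + dl, e + de)) \<bullet> h"
          by (simp only: inner_add_left adj_inner)
        then show ?thesis unfolding kkt by simp
      qed
      show "snd (?C ?dz) + ctil P (x, y, xt, s) = 0" by (rule ce)
      show "fst (?C ?dz) + c0 P x \<le> 0" unfolding q by (rule q0)
      show "(fst (?C ?dz) + c0 P x) $ i = 0 \<and> 0 < (l0 + dl0) $ i" if "i \<in> I0" for i
        unfolding q using comps(1)[OF that] by simp
      show "(l0 + dl0) $ i = 0" if "i \<notin> I0" for i using comps(2)[OF that] by simp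
      show "0 \<le> h \<bullet> barrier_hess w h + M * (\<Sum>i\<in>I0. (fst (?C h) $ i)\<^sup>2)" if "snd (?C h) = 0" for h
        by (rule curv[OF that])
    qed (rule M)
    then show "\<exists>r>0. \<forall>dz'. qp_feasible P w dz' \<and> dist dz' ?dz < r \<longrightarrow> qp_obj P \<mu> w ?dz \<le> qp_obj P \<mu> w dz'"
      unfolding qp_feasible_def qp_constraints_eq[OF r w] qp_obj_eq[OF r s w] by simp
  qed
  moreover have "d = primal_dual_step P w ?dz (l0 + dl0) (l + dl) (e + de)"
    using q qp_constraints_eq(1)[OF r w, of ?dz] unfolding w d by simp
  ultimately show ?thesis unfolding qp_step_def by blast
qed

lemma norm_select_zero: "(norm (select I a 0))\<^sup>2 = (\<Sum>i\<in>I. (a $ i)\<^sup>2)"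
proof -
  have "(norm (select I a 0))\<^sup>2 = (\<Sum>i\<in>UNIV. (select I a 0 $ i)\<^sup>2)"
    unfolding power2_norm_eq_inner inner_vec_def by (simp add: power2_eq_square)
  also have "\<dots> = (\<Sum>i\<in>I. (a $ i)\<^sup>2)"
    by (rule sum.mono_neutral_cong_right) (auto simp: select_def)
  finally show ?thesis .
qed

text \<open>Finsler's lemma provides positive definiteness after penalizing the violation of active constraints. For the second
  stage the penalty is supplied by the barrier term, since \<open>\<lambda>\<^sub>1\<^sub>j / s\<^sub>1\<^sub>j\<close> exceeds any \<open>M\<close> near the solution when \<open>j\<close> is
  active; for the first stage it is kept explicit.\<close>

lemma curvature:
  obtains \<rho> M where "0 < \<rho>" "0 < M"
    "\<And>x l0 s0 y xt s l e h. norm (((x, l0, s0), (y, xt, s, l, e)) - wst) < \<rho> \<Longrightarrow> (\<And>j. 0 < s $ j) \<Longrightarrow> (\<And>j. 0 < l $ j) \<Longrightarrow>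
       snd (c' (x, y, xt, s) h) = 0 \<Longrightarrow>
       0 \<le> h \<bullet> barrier_hess ((x, l0, s0), (y, xt, s, l, e)) h + M * (\<Sum>i\<in>I0. (fst (c' (x, y, xt, s) h) $ i)\<^sup>2)"
proof -
  let ?Q = "\<lambda>w h. h \<bullet> lagr_hess f'' c'' (zpart w) (wmult w) h"
  define T where "T v ds = (select I0 (fst v) 0, snd v, select I1 ds 0)"
    for v :: "(real^'m0) \<times> (real^'m1) \<times> (real^'n0)" and ds :: "real^'m1"
  let ?B = "\<lambda>w h. T (c' (zpart w) h) (snd (snd (snd h)))"
  have f1: "C1_lipschitz_near f' f'' zs" and c1: "C1_lipschitz_near c' c'' zs" using data by (auto simp: C2_data_def)
  have c0: "C1_lipschitz_near (zcon P) (\<lambda>q. blinfun_apply (c' q)) zs" by (rule C2_dataD(3)[OF data(2)])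
  have blu: "bounded_linear (\<lambda>u::('n0, 'n1, 'm0, 'm1) wpoint \<times> ('n0, 'n1, 'm1) zpoint. (zpart (fst u), snd u))"
    by (intro bounded_linear_Pair bounded_linear_compose[OF bounded_linear_zpart] bounded_linear_fst bounded_linear_snd)
  have cont: "isCont (\<lambda>u. g' (zpart (fst u)) (snd u)) (wst, h)" if "C1_lipschitz_near g g' zs"
    for g :: "('n0, 'n1, 'm1) zpoint \<Rightarrow> 'x::real_normed_vector" and g' h
  proof -
    have "isCont (\<lambda>(q, d). g' q d) ((\<lambda>u. (zpart (fst u), snd u)) (wst, h))"
      using C1_lipschitz_near_isCont_derivative[OF that] by simp
    from isCont_o2[OF linear_continuous_at[OF blu] this] show ?thesis by simp
  qed
  have blT: "bounded_linear (\<lambda>u. T (fst u) (snd u))"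
    unfolding linear_conv_bounded_linear[symmetric]
    by (rule linearI) (auto simp: T_def select_def vec_eq_iff)
  have blw: "bounded_linear (\<lambda>u::('n0, 'n1, 'm0, 'm1) wpoint \<times> ('n0, 'n1, 'm1) zpoint. wmult (fst u))"
    by (intro bounded_linear_compose[OF bounded_linear_wmult] bounded_linear_fst)
  have blh: "bounded_linear (\<lambda>u::('n0, 'n1, 'm0, 'm1) wpoint \<times> ('n0, 'n1, 'm1) zpoint. snd (snd (snd (snd u))))"
    by (intro bounded_linear_intros)
  define S where "S = {w :: ('n0, 'n1, 'm0, 'm1) wpoint. regular (zpart w)}"
  obtain r M \<kappa> where r: "0 < r" "0 < M" "0 < \<kappa>"
    "\<And>w h. w \<in> ball wst r \<Longrightarrow> w \<in> S \<Longrightarrow> \<kappa> * (norm h)\<^sup>2 \<le> ?Q w h + M * (norm (?B w h))\<^sup>2"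
  proof (rule finsler_uniform[where Q="?Q" and p=wst and B="?B" and S=S])
    fix h :: "('n0, 'n1, 'm1) zpoint"
    have snd: "isCont snd (wst, h)" by (rule linear_continuous_at[OF bounded_linear_snd])
    have "isCont (\<lambda>u. f'' (zpart (fst u)) (snd u) (snd u) + c'' (zpart (fst u)) (snd u) (snd u) \<bullet> wmult (fst u)) (wst, h)"
      by (intro continuous_add continuous_inner blinfun.continuous cont[OF f1] cont[OF c1] snd linear_continuous_at[OF blw])
    then show "isCont (\<lambda>(w, h). ?Q w h) (wst, h)" by (simp add: case_prod_beta' lagr_hess_inner)
    have "isCont (\<lambda>u. (c' (zpart (fst u)) (snd u), snd (snd (snd (snd u))))) (wst, h)"
      by (intro continuous_Pair cont[OF c0] linear_continuous_at[OF blh])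
    from isCont_o2[OF this linear_continuous_at[OF blT]]
    show "isCont (\<lambda>(w, h). ?B w h) (wst, h)" by (simp add: case_prod_beta')
  next
    fix w :: "('n0, 'n1, 'm0, 'm1) wpoint" and t :: real and h assume "w \<in> S"
    then have "regular (zpart w)" by (simp add: S_def)
    then show "?Q w (t *\<^sub>R h) = t\<^sup>2 * ?Q w h"
      by (simp add: linear_scale[OF linear_hess] power2_eq_square)
  next
    fix w :: "('n0, 'n1, 'm0, 'm1) wpoint" and t :: real and h
    show "?B w (t *\<^sub>R h) = t *\<^sub>R ?B w h"
      using linear_scale[OF bounded_linear.linear[OF blT], of t "(c' (zpart w) h, snd (snd (snd h)))"]
      by (simp add: blinfun.scaleR_right)
  next
    fix h :: "('n0, 'n1, 'm1) zpoint" assume h0: "h \<noteq> 0" and B0: "?B wst h = 0"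
    obtain dx dy dxt ds where h: "h = (dx, dy, dxt, ds)" by (cases h)
    obtain D0 D1 where D01: "linear D0" "linear D1"
      and c': "\<And>hx hy hxt hs. c' zs (hx, hy, hxt, hs) = (D0 hx, D1 (hy, hxt) + hs, hxt - hx)"
      using con_derivative[OF regular_zs] has_derivative_linear by metis
    have e: "select I0 (D0 dx) 0 = 0" "D1 (dy, dxt) + ds = 0" "dxt = dx" "select I1 ds 0 = 0"
      using B0 by (auto simp: T_def h c' zero_prod_def)
    have i0: "D0 dx $ i = 0" if "i \<in> I0" for i
      using arg_cong[OF e(1), of "\<lambda>v. v $ i"] that by (simp add: select_def)
    have i1: "ds $ j = 0" if "j \<in> I1" for j
      using arg_cong[OF e(4), of "\<lambda>v. v $ j"] that by (simp add: select_def)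
    have D1: "D1 (dy, dx) = - ds" using e(2) unfolding e(3) by (simp add: eq_neg_iff_add_eq_0)
    have "dx \<noteq> 0 \<or> dy \<noteq> 0"
    proof (rule ccontr)
      assume "\<not> ?thesis"
      then have "dx = 0" "dy = 0" by auto
      then have "ds = 0" using D1 linear_0[OF D01(2)] by (simp add: zero_prod_def)
      then show False using h0 h e(3) \<open>dx = 0\<close> \<open>dy = 0\<close> by (simp add: zero_prod_def)
    qed
    from sosc[OF this] have "0 < (dx, dy, dx, 0) \<bullet> lagr_hess f'' c'' zs ls (dx, dy, dx, 0)"
      using i0 i1 D1 by (simp add: c')
    then show "0 < ?Q wst h"
      using hess_slack_free[OF regular_zs, of dx dy dx ds ls] by (simp add: h e(3))
  qed blast
  obtain r2 where r2: "0 < r2" "\<And>w. dist w wst < r2 \<Longrightarrow> regular (zpart w)"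
    using regular_near_solution unfolding eventually_nhds_metric by blast
  define \<rho> where "\<rho> = min (min r r2) (min gap (gap / M))"
  show ?thesis
  proof (rule that[of \<rho> M])
    show "0 < \<rho>" "0 < M" using r r2 gap(1) by (auto simp: \<rho>_def)
    fix x l0 s0 y xt s l e h
    let ?w = "((x, l0, s0), (y, xt, s, l, e)) :: ('n0, 'n1, 'm0, 'm1) wpoint"
    assume n: "norm (?w - wst) < \<rho>" and s: "\<And>j. 0 < s $ j" and l: "\<And>j. 0 < l $ j"
      and E: "snd (c' (x, y, xt, s) h) = 0"
    obtain dx dy dxt ds where h: "h = (dx, dy, dxt, ds)" by (cases h)
    have dist: "dist ?w wst < r" "dist ?w wst < r2" using n unfolding \<rho>_def dist_norm by linarith+
    have w: "?w \<in> ball wst r" "?w \<in> S"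
      using dist(1) r2(2)[OF dist(2)] unfolding S_def mem_ball dist_commute[of wst] by blast+
    have T: "(norm (?B ?w h))\<^sup>2 = (\<Sum>i\<in>I0. (fst (c' (x, y, xt, s) h) $ i)\<^sup>2) + (\<Sum>j\<in>I1. (ds $ j)\<^sup>2)"
    proof -
      have "(norm (a, 0 :: (real^'m1) \<times> (real^'n0), b))\<^sup>2 = (norm a)\<^sup>2 + (norm b)\<^sup>2" for a :: "real^'m0" and b :: "real^'m1"
        by (simp add: power2_norm_eq_inner)
      then show ?thesis using E by (simp add: T_def norm_select_zero h)
    qed
    have "M * (\<Sum>j\<in>I1. (ds $ j)\<^sup>2) = (\<Sum>j\<in>I1. M * (ds $ j)\<^sup>2)" by (simp add: sum_distrib_left)
    also have "\<dots> \<le> (\<Sum>j\<in>I1. (l $ j / s $ j) * (ds $ j)\<^sup>2)"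
    proof (intro sum_mono mult_right_mono)
      fix j assume j: "j \<in> I1"
      have "\<bar>s $ j - s1s $ j\<bar> < gap / M" "\<bar>l $ j - l1s $ j\<bar> < gap"
        using components_near(3,4)[OF refl, where x=x and ?l0.0=l0 and ?s0.0=s0 and y=y and xt=xt and s=s and l=l and e=e and j=j] n
        unfolding \<rho>_def by linarith+
      then have "s $ j < gap / M" "gap < l $ j" using j gap(4)[OF j] by (auto simp: I1_def)
      then have "M * s $ j \<le> l $ j" using r(2) by (simp add: field_simps)
      then show "M \<le> l $ j / s $ j" using s[of j] by (simp add: field_simps)
    qed auto
    also have "\<dots> \<le> (\<Sum>j\<in>UNIV. (l $ j / s $ j) * (ds $ j)\<^sup>2)"
      using s l by (intro sum_mono2) (auto intro!: mult_nonneg_nonneg divide_nonneg_nonneg simp: less_imp_le)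
    also have "\<dots> = ds \<bullet> (\<chi> j. (l $ j / s $ j) * ds $ j)"
      by (simp add: inner_vec_def power2_eq_square ac_simps)
    finally have 1: "M * (\<Sum>j\<in>I1. (ds $ j)\<^sup>2) \<le> ds \<bullet> (\<chi> j. (l $ j / s $ j) * ds $ j)" .
    have 2: "h \<bullet> barrier_hess ?w h = ?Q ?w h + ds \<bullet> (\<chi> j. (l $ j / s $ j) * ds $ j)"
      unfolding h barrier_hess.simps inner_add_right by simp
    have "0 \<le> \<kappa> * (norm h)\<^sup>2" using r(3) by simp
    also have "\<dots> \<le> ?Q ?w h + M * (norm (?B ?w h))\<^sup>2" by (rule r(4)[OF w])
    finally show "0 \<le> h \<bullet> barrier_hess ?w h + M * (\<Sum>i\<in>I0. (fst (c' (x, y, xt, s) h) $ i)\<^sup>2)"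
      using 1 2 unfolding T by (simp add: algebra_simps)
  qed
qed

end



section \<open>One pass through the loop\<close>

text \<open>One complementary pair, with \<open>a\<close> the member that stays away from zero and \<open>b\<close> the one that vanishes at the solution.
  The lower bound on the new product keeps \<open>b'\<close> above \<open>\<mu>' / (2 N)\<close>, while \<open>\<tau> b\<close> is at most \<open>\<mu>'\<close> times a small
  number.\<close>

lemma fraction_to_boundary:
  fixes a a' b b' :: real
  assumes mu: "0 < \<mu>'" and tau: "0 \<le> \<tau>" "\<tau> \<le> \<mu>'" and a': "0 < g" "g \<le> a'" "a' \<le> N" and a: "0 \<le> a" "a \<le> N"
    and b: "b \<le> K" and prd: "\<mu>' / 2 \<le> a' * b'" and small: "\<mu>' * N \<le> g" "2 * N * K \<le> 1" and K: "0 \<le> K"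
  shows "\<tau> * a \<le> a'" "\<tau> * b \<le> b'" "0 < b'"
proof -
  have N: "0 < N" using a' by linarith
  have "\<tau> * a \<le> \<mu>' * N" using tau a by (intro mult_mono) auto
  then show "\<tau> * a \<le> a'" using small(1) a' by linarith
  have pos: "0 < a' * b'" using prd mu by linarith
  then show b': "0 < b'" using a' by (simp add: zero_less_mult_iff)
  have "\<tau> * b \<le> \<tau> * K" using tau b by (intro mult_left_mono) auto
  also have "\<dots> \<le> \<mu>' * K" using tau K by (intro mult_right_mono) auto
  also have "\<mu>' * K \<le> b'"
  proof -
    have "(2 * N) * (\<mu>' * K) = \<mu>' * (2 * N * K)" by simp
    also have "\<dots> \<le> \<mu>' * 1" using small(2) mu by (intro mult_left_mono) auto
    also have "\<dots> \<le> 2 * (a' * b')" using prd by simp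
    also have "\<dots> \<le> (2 * N) * b'" using a' b' by (simp add: mult_right_mono)
    finally show ?thesis using N by simp
  qed
  finally show "\<tau> * b \<le> b'" .
qed

text \<open>The part of \<open>valid_input\<close> that does not mention the initial barrier parameter.\<close>

definition admissible :: "params \<Rightarrow> bool" where
  "admissible A \<longleftrightarrow> 0 < cmu1 A \<and> cmu1 A < 1 \<and> 1 < cmu2 A \<and> cmu2 A < 2 \<and> 0 < cbar A \<and> 0 < taumax A"

fun interior_pair :: "('n0::finite, 'n1::finite, 'm0::finite, 'm1::finite) wpoint \<Rightarrow> bool" where
  "interior_pair ((x, l0, s0), (y, xt, s, l, e)) \<longleftrightarrow> (\<forall>j. 0 < s $ j) \<and> (\<forall>j. 0 < l $ j)"

lemma is_step_size_one:
  assumes "1 \<in> step_sizes \<tau> w d"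
  shows "is_step_size \<tau> w d \<alpha> \<longleftrightarrow> \<alpha> = 1"
proof -
  have "\<beta> \<le> 1" if "\<beta> \<in> step_sizes \<tau> w d" for \<beta>
    using that by (cases "(\<tau>, w, d)" rule: step_sizes.cases) auto
  then show ?thesis using assms unfolding is_step_size_def by (meson order_antisym)
qed

context primal_dual_solution
begin

lemma barrier_dir_pos: "0 < norm barrier_dir"
proof -
  have "barrier_dir \<noteq> 0" by (simp add: barrier_dir_def zero_prod_def vec_eq_iff)
  then show ?thesis by simp
qed

text \<open>The constants depend on the problem and the parameters only. The two-sided bound on the new distance is what turns the
  behaviour of the barrier parameters into a rate of convergence.\<close>

lemma one_step:
  assumes A: "admissible A"
  obtains r \<mu>b K \<kappa> where "0 < r" "0 < \<mu>b" "0 < K" "0 < \<kappa>"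
    "\<And>w \<mu>. 0 < \<mu> \<Longrightarrow> \<mu> \<le> \<mu>b \<Longrightarrow> norm (w - wst) < r \<Longrightarrow> interior_pair w \<Longrightarrow> theta P \<mu> w \<le> cbar A * \<mu> \<Longrightarrow>
       \<exists>d. (\<forall>d'. extrapolation_step P (mu_next A \<mu>) w d' \<longleftrightarrow> d' = d) \<and>
           (\<forall>\<alpha>. is_step_size (tau A \<mu>) w d \<alpha> \<longleftrightarrow> \<alpha> = 1) \<and>
           norm (w + d - wst) < r \<and> interior_pair (w + d) \<and> theta P (mu_next A \<mu>) (w + d) \<le> cbar A * mu_next A \<mu> \<and>
           norm (w + d - wst) \<le> K * mu_next A \<mu> \<and> \<kappa> * mu_next A \<mu> \<le> norm (w + d - wst)"
proof -
  have par: "0 < cmu1 A" "cmu1 A < 1" "1 < cmu2 A" "cmu2 A < 2" "0 < cbar A" "0 < taumax A"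
    using A by (auto simp: admissible_def)
  obtain r1 C where C: "0 < r1" "0 < C"
    "\<And>w. w \<in> ball wst r1 \<Longrightarrow> linear (G' w)"
    "\<And>w d. w \<in> ball wst r1 \<Longrightarrow> norm d \<le> C * norm (G' w d)"
    "\<And>w y. w \<in> ball wst r1 \<Longrightarrow> \<exists>d. G' w d = y"
    "\<And>w. w \<in> ball wst r1 \<Longrightarrow> norm (w - wst) \<le> C * norm (G w)"
    "\<And>w. w \<in> ball wst r1 \<Longrightarrow> norm (G w) \<le> C * norm (w - wst)"
    "\<And>w w'. w \<in> ball wst r1 \<Longrightarrow> w' \<in> ball wst r1 \<Longrightarrow> norm (G w' - G w - G' w (w' - w)) \<le> C * (norm (w' - w))\<^sup>2"
    using newton_neighbourhood[OF C1_G G_solution G'_injective] by blast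
  obtain r2 M where curv: "0 < r2" "0 < M"
    "\<And>x l0 s0 y xt s l e h. norm (((x, l0, s0), (y, xt, s, l, e)) - wst) < r2 \<Longrightarrow> (\<And>j. 0 < s $ j) \<Longrightarrow> (\<And>j. 0 < l $ j) \<Longrightarrow>
       snd (c' (x, y, xt, s) h) = 0 \<Longrightarrow>
       0 \<le> h \<bullet> barrier_hess ((x, l0, s0), (y, xt, s, l, e)) h + M * (\<Sum>i\<in>I0. (fst (c' (x, y, xt, s) h) $ i)\<^sup>2)"
    by (rule curvature) blast
  obtain r3 where r3: "0 < r3" "\<And>w. dist w wst < r3 \<Longrightarrow> regular (zpart w)"
    using regular_near_solution unfolding eventually_nhds_metric by blast
  define r where "r = min (min r1 r2) (min r3 gap)"
  have r: "0 < r" "r \<le> r1" "r \<le> r2" "r \<le> r3" "r \<le> gap" using C(1) curv(1) r3(1) gap(1) by (auto simp: r_def)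
  define b where "b = norm barrier_dir"
  have b: "0 < b" using barrier_dir_pos by (simp add: b_def)
  \<comment> \<open>Bounds both the distance to the solution and the Newton step by \<open>K1 * \<mu>\<close>.\<close>
  define K1 where "K1 = C * (cbar A + 2 * b)"
  have K1: "0 < K1" using C(2) par b by (simp add: K1_def)
  define N where "N = norm wst + gap"
  have N: "0 < N" using gap(1) by (simp add: N_def add_nonneg_pos)
  \<comment> \<open>Makes the new residual, at most \<open>C * (K1 * \<mu>)\<^sup>2\<close>, small in three ways: it passes the loop test, it is at most half of the shift \<open>\<nu> *\<^sub>R barrier_dir\<close>, and it changes the products \<open>s\<^sub>1\<^sub>j \<lambda>\<^sub>1\<^sub>j = \<nu>\<close> by at most \<open>\<nu> / 2\<close>.\<close>
  define \<delta> where "\<delta> = min (cbar A) (min (b / 2) (1 / 2)) / (C * K1\<^sup>2)"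
  have \<delta>: "0 < \<delta>" using C(2) K1 par b by (simp add: \<delta>_def)
  obtain m where m: "0 < m" "\<And>\<mu>. 0 < \<mu> \<Longrightarrow> \<mu> \<le> m \<Longrightarrow> \<mu>\<^sup>2 \<le> \<delta> * mu_next A \<mu>"
    using mu_square_small[OF par(1,4) \<delta>] by blast
  define \<mu>b where "\<mu>b = min (min m (r / (4 * K1))) (min (gap / N) (1 / (4 * N * K1)))"
  have \<mu>b: "0 < \<mu>b" using m(1) r(1) K1 N gap(1) by (simp add: \<mu>b_def)
  have \<mu>b_le: "\<mu>b \<le> m" "\<mu>b \<le> r / (4 * K1)" "\<mu>b \<le> gap / N" "\<mu>b \<le> 1 / (4 * N * K1)"
    by (simp_all add: \<mu>b_def)
  show ?thesis
  proof (rule that[of r \<mu>b "2 * K1" "b / (2 * C)"])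
    show "0 < r" "0 < \<mu>b" "0 < 2 * K1" "0 < b / (2 * C)" using r \<mu>b K1 b C(2) by auto
    fix w \<mu>
    assume mu: "0 < \<mu>" "\<mu> \<le> \<mu>b" and wr: "norm (w - wst) < r" and int: "interior_pair w" and th: "theta P \<mu> w \<le> cbar A * \<mu>"
    define \<nu> where "\<nu> = mu_next A \<mu>"
    have \<nu>: "0 < \<nu>" "\<nu> \<le> \<mu>"
    proof -
      show "0 < \<nu>" using mu_next_pos[OF par(1) mu(1)] by (simp add: \<nu>_def)
      have "\<nu> \<le> cmu1 A * \<mu>" by (simp add: \<nu>_def mu_next_def)
      also have "\<dots> \<le> 1 * \<mu>" using par mu by (intro mult_right_mono) auto
      finally show "\<nu> \<le> \<mu>" by simp
    qed
    have K1mu: "4 * K1 * \<mu> \<le> r"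
    proof -
      have "\<mu> \<le> r / (4 * K1)" using mu(2) \<mu>b_le(2) by linarith
      then show ?thesis using K1 by (simp add: field_simps)
    qed
    have ball: "v \<in> ball wst r1" "regular (zpart v)" "norm (v - wst) < r2" "norm (v - wst) < gap" if "norm (v - wst) < r" for v
    proof -
      have d: "dist v wst < r" using that by (simp only: dist_norm)
      then show "v \<in> ball wst r1" using r by (simp only: mem_ball dist_commute[of wst])
      show "regular (zpart v)" using d r by (intro r3(2)) linarith
      show "norm (v - wst) < r2" "norm (v - wst) < gap" using that r by linarith+
    qed
    have thG: "theta P t v = norm (G v - t *\<^sub>R barrier_dir)" if "norm (v - wst) < r" for v t
      unfolding theta_def by (rule norm_FC[OF ball(2,4)[OF that]])
    have Gw: "norm (G w) \<le> (cbar A + b) * \<mu>"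
    proof -
      have "norm (G w) \<le> norm (G w - \<mu> *\<^sub>R barrier_dir) + norm (\<mu> *\<^sub>R barrier_dir)"
        using norm_triangle_sub[of "G w" "\<mu> *\<^sub>R barrier_dir"] by simp
      also have "norm (\<mu> *\<^sub>R barrier_dir) = b * \<mu>" using mu by (simp add: b_def)
      finally show ?thesis using th thG[OF wr, of \<mu>] by (simp add: algebra_simps)
    qed
    have w_near: "norm (w - wst) \<le> K1 * \<mu>"
    proof -
      have "norm (w - wst) \<le> C * norm (G w)" by (rule C(6)[OF ball(1)[OF wr]])
      also have "\<dots> \<le> C * ((cbar A + 2 * b) * \<mu>)"
        using order_trans[OF Gw mult_right_mono[of "cbar A + b" "cbar A + 2 * b" \<mu>]] C(2) mu(1) b
        by (intro mult_left_mono) auto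
      finally show ?thesis by (simp add: K1_def mult.assoc)
    qed
    obtain d where d: "G' w d = \<nu> *\<^sub>R barrier_dir - G w" using C(5)[OF ball(1)[OF wr]] by blast
    have newton: "G w + G' w d = \<nu> *\<^sub>R barrier_dir" by (simp add: d)
    have dn: "norm d \<le> K1 * \<mu>"
    proof -
      have "norm d \<le> C * norm (\<nu> *\<^sub>R barrier_dir - G w)" using C(4)[OF ball(1)[OF wr], of d] by (simp add: d)
      also have "norm (\<nu> *\<^sub>R barrier_dir - G w) \<le> norm (\<nu> *\<^sub>R barrier_dir) + norm (G w)" by (rule norm_triangle_ineq4)
      also have "norm (\<nu> *\<^sub>R barrier_dir) \<le> b * \<mu>" using \<nu> b by (simp add: b_def mult.commute mult_left_mono)
      also have "b * \<mu> + norm (G w) \<le> (cbar A + 2 * b) * \<mu>" using Gw by (simp add: algebra_simps)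
      finally show ?thesis using C(2) by (simp add: K1_def mult.assoc mult_left_mono)
    qed
    have near: "norm (w + d' - wst) < r" if "norm d' \<le> K1 * \<mu>" for d'
    proof -
      have "norm (w + d' - wst) \<le> norm (w - wst) + norm d'"
        using norm_triangle_ineq[of "w - wst" d'] by (simp add: algebra_simps)
      also have "\<dots> \<le> 2 * K1 * \<mu>" using w_near that by simp
      also have "\<dots> < 4 * K1 * \<mu>" using K1 mu by simp
      finally show ?thesis using K1mu by linarith
    qed
    have w'r: "norm (w + d - wst) < r" by (rule near[OF dn])
    note w'b = ball[OF w'r]
    have res: "norm (G (w + d) - \<nu> *\<^sub>R barrier_dir) \<le> min (cbar A) (min (b / 2) (1 / 2)) * \<nu>"
    proof -
      have "norm (G (w + d) - \<nu> *\<^sub>R barrier_dir) = norm (G (w + d) - G w - G' w (w + d - w))"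
        using d by (simp add: algebra_simps)
      also have "\<dots> \<le> C * (norm (w + d - w))\<^sup>2" by (rule C(8)[OF ball(1)[OF wr] w'b(1)])
      also have "\<dots> \<le> C * (K1 * \<mu>)\<^sup>2" using dn C(2) by (intro mult_left_mono power_mono) auto
      also have "\<dots> = (C * K1\<^sup>2) * \<mu>\<^sup>2" by (simp add: power_mult_distrib)
      also have "\<dots> \<le> (C * K1\<^sup>2) * (\<delta> * \<nu>)"
        using m(2)[OF mu(1)] mu(2) \<mu>b_le(1) C(2) unfolding \<nu>_def by (intro mult_left_mono) auto
      also have "\<dots> = min (cbar A) (min (b / 2) (1 / 2)) * \<nu>" using C(2) K1 by (simp add: \<delta>_def)
      finally show ?thesis .
    qed
    have res1: "norm (G (w + d) - \<nu> *\<^sub>R barrier_dir) \<le> cbar A * \<nu>"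
      and res2: "norm (G (w + d) - \<nu> *\<^sub>R barrier_dir) \<le> b / 2 * \<nu>"
      and res3: "norm (G (w + d) - \<nu> *\<^sub>R barrier_dir) \<le> 1 / 2 * \<nu>"
      by (rule order_trans[OF res mult_right_mono]; use \<nu>(1) in simp)+
    obtain x l0 s0 y xt s l e where w: "w = ((x, l0, s0), (y, xt, s, l, e))" by (cases w rule: zpart.cases)
    obtain dx dl0 ds0 dy dxt ds dl de where dd: "d = ((dx, dl0, ds0), (dy, dxt, ds, dl, de))" by (cases d rule: zpart.cases)
    have wd: "w + d = ((x + dx, l0 + dl0, s0 + ds0), (y + dy, xt + dxt, s + ds, l + dl, e + de))" by (simp add: w dd)
    have sl: "\<And>j. 0 < s $ j" "\<And>j. 0 < l $ j" using int by (auto simp: w)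
    have reg: "regular (x, y, xt, s)" using ball(2)[OF wr] by (simp add: w)
    have extr: "extrapolation_step P \<nu> w d' \<longleftrightarrow> d' = d" for d'
    proof -
      \<comment> \<open>A competitor that is not longer than the Newton step also leads near the solution, hence solves the same linear system.\<close>
      have uniq: "d' = d" if "qp_step P \<nu> w d'" "norm d' \<le> norm d" for d'
      proof -
        have "norm (w + d' - wst) < gap" using near[of d'] that(2) dn r(5) by linarith
        from qp_step_imp_newton[OF reg sl(1) w that(1) this]
        have "G' w d' = \<nu> *\<^sub>R barrier_dir - G w" by (simp add: eq_diff_eq add.commute)
        then have "G' w (d' - d) = 0" using d linear_diff[OF C(3)[OF ball(1)[OF wr]]] by simp
        then have "norm (d' - d) \<le> C * 0" using C(4)[OF ball(1)[OF wr], of "d' - d"] by simp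
        then show ?thesis by simp
      qed
      have "qp_step P \<nu> w d"
      proof (rule newton_imp_qp_step[OF reg sl(1) w curv(2) _ newton w'b(4)])
        show "0 \<le> h \<bullet> barrier_hess w h + M * (\<Sum>i\<in>I0. (fst (c' (x, y, xt, s) h) $ i)\<^sup>2)"
          if "snd (c' (x, y, xt, s) h) = 0" for h
          unfolding w by (rule curv(3)) (use ball(3)[OF wr] sl that in \<open>simp_all add: w\<close>)
      qed
      then show ?thesis unfolding extrapolation_step_def using uniq by (metis linear order_refl)
    qed
    have \<tau>: "0 < tau A \<mu>" "tau A \<mu> \<le> \<nu>" using par \<nu> by (auto simp: tau_def \<nu>_def)
    have \<nu>N: "\<nu> * N \<le> gap"
    proof -
      have "\<nu> \<le> gap / N" using \<nu>(2) mu(2) \<mu>b_le(3) by linarith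
      then show ?thesis using N by (simp add: field_simps)
    qed
    have NK: "2 * N * (2 * K1 * \<mu>) \<le> 1"
    proof -
      have "\<mu> \<le> 1 / (4 * N * K1)" using mu(2) \<mu>b_le(4) by linarith
      then show ?thesis using N K1 by (simp add: field_simps)
    qed
    have comp: "tau A \<mu> * s $ j \<le> (s + ds) $ j \<and> tau A \<mu> * l $ j \<le> (l + dl) $ j \<and> 0 < (s + ds) $ j \<and> 0 < (l + dl) $ j" for j
    proof -
      have prd: "\<nu> / 2 \<le> (s + ds) $ j * (l + dl) $ j"
      proof -
        obtain gx gy gxt gs where g: "lagr_grad f' c' (zpart (w + d)) (wmult (w + d)) = (gx, gy, gxt, gs)" by (metis prod_cases4)
        obtain k0 k1 ke where k: "zcon P (zpart (w + d)) = (k0, k1, ke)" by (metis prod_cases3)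
        have "G (w + d) - \<nu> *\<^sub>R barrier_dir = ((gx, k0 + (s0 + ds0), select I0 (s0 + ds0) (l0 + dl0)),
           (gy, gxt, comp_mult (s + ds) (l + dl) - \<nu> *\<^sub>R (\<chi> j. 1), k1, ke))"
          unfolding G_def g k unfolding wd by (simp add: barrier_dir_def)
        from component_le_norm_wpoint(3)[OF this, of j] res3
        have "\<bar>(s + ds) $ j * (l + dl) $ j - \<nu>\<bar> \<le> 1 / 2 * \<nu>" by (simp add: comp_mult_def)
        then show ?thesis by linarith
      qed
      have n1: "\<bar>s $ j - s1s $ j\<bar> \<le> K1 * \<mu>" "\<bar>l $ j - l1s $ j\<bar> \<le> K1 * \<mu>"
        using components_near(3,4)[OF w, of j] w_near by linarith+
      have n2: "\<bar>s $ j - s1s $ j\<bar> < gap" "\<bar>l $ j - l1s $ j\<bar> < gap"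
        using components_near(3,4)[OF w, of j] ball(4)[OF wr] by linarith+
      have n3: "\<bar>(s + ds) $ j - s1s $ j\<bar> < gap" "\<bar>(l + dl) $ j - l1s $ j\<bar> < gap"
        using components_near(3,4)[OF wd, of j] w'b(4) by linarith+
      have st: "\<bar>s1s $ j\<bar> \<le> norm wst" "\<bar>l1s $ j\<bar> \<le> norm wst"
        using component_le_norm_wpoint(3,4)[OF refl, where dx=xs and ?dl0.0=l0s and ?ds0.0=s0s and dy=ys and dxt=xs and ds=s1s and dl=l1s and de=e1s and j=j]
        by blast+
      have K0: "0 \<le> 2 * K1 * \<mu>" "K1 * \<mu> \<le> 2 * K1 * \<mu>" using K1 mu by auto
      show ?thesis
      proof (cases "j \<in> I1")
        case True
        have z: "s1s $ j = 0" "2 * gap \<le> l1s $ j" using True gap(4) by (auto simp: I1_def)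
        have pr: "gap \<le> (l + dl) $ j" "(l + dl) $ j \<le> N" "0 \<le> l $ j" "l $ j \<le> N" "s $ j \<le> 2 * K1 * \<mu>"
          using st(2) z n1(1) n2(2) n3(2) sl(2)[of j] K0(2) unfolding N_def by linarith+
        note frac = fraction_to_boundary[OF \<nu>(1) less_imp_le[OF \<tau>(1)] \<tau>(2) gap(1) pr prd[unfolded mult.commute[of "(s + ds) $ j"]] \<nu>N NK K0(1)]
        show ?thesis using frac n3(2) z gap(1) by linarith
      next
        case False
        have z: "l1s $ j = 0" "2 * gap \<le> s1s $ j" using multipliers1(4)[OF False] gap(5)[OF False] by auto
        have pr: "gap \<le> (s + ds) $ j" "(s + ds) $ j \<le> N" "0 \<le> s $ j" "s $ j \<le> N" "l $ j \<le> 2 * K1 * \<mu>"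
          using st(1) z n1(2) n2(1) n3(1) sl(1)[of j] K0(2) unfolding N_def by linarith+
        note frac = fraction_to_boundary[OF \<nu>(1) less_imp_le[OF \<tau>(1)] \<tau>(2) gap(1) pr prd \<nu>N NK K0(1)]
        show ?thesis using frac n3(1) z gap(1) by linarith
      qed
    qed
    have "1 \<in> step_sizes (tau A \<mu>) w d"
      using comp by (simp add: w dd less_eq_vec_def)
    from is_step_size_one[OF this] have size: "\<forall>\<alpha>. is_step_size (tau A \<mu>) w d \<alpha> \<longleftrightarrow> \<alpha> = 1" by blast
    have int': "interior_pair (w + d)" unfolding wd interior_pair.simps using comp by blast
    have upper: "norm (w + d - wst) \<le> 2 * K1 * \<nu>"
    proof -
      have "norm (G (w + d)) \<le> norm (G (w + d) - \<nu> *\<^sub>R barrier_dir) + norm (\<nu> *\<^sub>R barrier_dir)"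
        using norm_triangle_sub[of "G (w + d)" "\<nu> *\<^sub>R barrier_dir"] by simp
      also have "norm (\<nu> *\<^sub>R barrier_dir) = b * \<nu>" using \<nu> by (simp add: b_def)
      finally have "norm (G (w + d)) \<le> 2 * b * \<nu>" using res2 mult_pos_pos[OF b \<nu>(1)] by linarith
      then have "C * norm (G (w + d)) \<le> C * (2 * b * \<nu>)" using C(2) by (intro mult_left_mono) auto
      moreover have "C * (2 * b * \<nu>) \<le> C * (2 * (cbar A + 2 * b) * \<nu>)"
        using C(2) b par \<nu>(1) by (intro mult_left_mono mult_right_mono) auto
      ultimately show ?thesis using C(6)[OF w'b(1)] by (simp add: K1_def mult.assoc mult.left_commute)
    qed
    have lower: "b / (2 * C) * \<nu> \<le> norm (w + d - wst)"
    proof -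
      have "b * \<nu> = norm (\<nu> *\<^sub>R barrier_dir)" using \<nu> by (simp add: b_def)
      also have "\<dots> \<le> norm (G (w + d)) + norm (G (w + d) - \<nu> *\<^sub>R barrier_dir)"
        using norm_triangle_sub[of "\<nu> *\<^sub>R barrier_dir" "G (w + d)"] by (simp add: norm_minus_commute)
      finally have "b * \<nu> / 2 \<le> C * norm (w + d - wst)" using res2 C(7)[OF w'b(1)] by simp
      then show ?thesis using C(2) by (simp add: field_simps)
    qed
    show "\<exists>d. (\<forall>d'. extrapolation_step P (mu_next A \<mu>) w d' \<longleftrightarrow> d' = d) \<and>
           (\<forall>\<alpha>. is_step_size (tau A \<mu>) w d \<alpha> \<longleftrightarrow> \<alpha> = 1) \<and>
           norm (w + d - wst) < r \<and> interior_pair (w + d) \<and> theta P (mu_next A \<mu>) (w + d) \<le> cbar A * mu_next A \<mu> \<and>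
           norm (w + d - wst) \<le> 2 * K1 * mu_next A \<mu> \<and> b / (2 * C) * mu_next A \<mu> \<le> norm (w + d - wst)"
      unfolding \<nu>_def[symmetric]
      by (intro exI[of _ d] conjI allI) (use extr size w'r int' upper lower res1 thG[OF w'r, of \<nu>] in auto)
  qed
qed

end

section \<open>Runs of the algorithm\<close>

fun config_mu :: "('n0::finite, 'n1::finite, 'm0::finite, 'm1::finite) config \<Rightarrow> real" where
  "config_mu (Step2 l u \<mu>) = \<mu>" | "config_mu (Step3 l w \<mu>) = \<mu>" | "config_mu (Step4 l w \<mu>) = \<mu>"

inductive_cases Step3_stepE: "alg_step P A sqp (Step3 l w \<mu>) c"
inductive_cases Step4_stepE: "alg_step P A sqp (Step4 l w \<mu>) c"
inductive_cases to_Step3E: "alg_step P A sqp c (Step3 l w \<mu>)"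

lemma run_mu_pos:
  assumes "valid_input A \<mu>0" "alg_run P A sqp u0 \<mu>0 \<sigma>"
  shows "0 < config_mu (\<sigma> n)"
proof (induction n)
  case 0
  then show ?case using assms by (simp add: alg_run_def valid_input_def)
next
  case (Suc n)
  have "alg_step P A sqp (\<sigma> n) (\<sigma> (Suc n)) \<or> \<sigma> (Suc n) = \<sigma> n" using assms(2) unfolding alg_run_def by blast
  then show ?case
  proof
    assume "alg_step P A sqp (\<sigma> n) (\<sigma> (Suc n))"
    then show ?case using Suc assms(1) by cases (auto simp: valid_input_def mu_next_pos)
  qed (use Suc in simp)
qed

lemma run_not_stuck:
  assumes "alg_run P A sqp u0 \<mu>0 \<sigma>" "alg_step P A sqp (\<sigma> n) c"
  shows "alg_step P A sqp (\<sigma> n) (\<sigma> (Suc n))"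
  using assms unfolding alg_run_def by blast

text \<open>Step 3 is only reached from Step 2, and the subproblem solver returns positive slacks whose products with the
  multipliers are all \<open>\<mu> > 0\<close>. This starts the interiority that the fraction-to-the-boundary rule maintains.\<close>

lemma Step3_interior:
  assumes v: "valid_input A \<mu>0" and run: "alg_run P A sqp u0 \<mu>0 \<sigma>" and feas: "feasibility_assumption P sqp \<sigma>"
    and k: "\<sigma> k = Step3 l w \<mu>"
  shows "interior_pair w" "\<sigma> (Suc k) = Step4 l w \<mu>" "0 < \<mu>"
proof -
  show mu: "0 < \<mu>" using run_mu_pos[OF v run, of k] k by simp
  have "alg_step P A sqp (\<sigma> k) (\<sigma> (Suc k))" by (rule run_not_stuck[OF run, of k "Step4 l w \<mu>"]) (simp add: k alg_step.enter)
  then show "\<sigma> (Suc k) = Step4 l w \<mu>" unfolding k by (rule Step3_stepE)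
  obtain n where n: "k = Suc n" using k run by (cases k) (auto simp: alg_run_def)
  have "alg_step P A sqp (\<sigma> n) (\<sigma> k)"
  proof (rule ccontr)
    assume no: "\<not> ?thesis"
    then have "\<sigma> n = \<sigma> k" "\<nexists>c. alg_step P A sqp (\<sigma> n) c" using run n unfolding alg_run_def by metis+
    then show False using k alg_step.enter by metis
  qed
  then have "alg_step P A sqp (\<sigma> n) (Step3 l w \<mu>)" by (simp add: k)
  then obtain ut evals x l0 s0 vs where s2: "\<sigma> n = Step2 l ut \<mu>" and w: "w = ((x, l0, s0), last vs)"
  and sqp: "sqp ut \<mu> evals (x, l0, s0)" and vs: "vs = map snd (filter (\<lambda>e. fst e = x) evals)" "vs \<noteq> []"
  by (rule to_Step3E) blast
  have "last vs \<in> set vs" using vs(2) by simp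
  then have "(x, last vs) \<in> set evals" unfolding vs(1) by auto
  then have kkt: "subproblem_kkt P \<mu> x (last vs)" using feas s2 sqp unfolding feasibility_assumption_def by blast
  obtain y xt s l1 e where v: "last vs = (y, xt, s, l1, e)" by (metis prod_cases5)
  have s: "\<And>j. 0 < s $ j" and c: "comp_mult s l1 - (\<chi> j. \<mu>) = 0"
    using kkt by (auto simp: v zero_prod_def)
  have "0 < l1 $ j" for j
  proof -
    have "s $ j * l1 $ j = \<mu>" using arg_cong[OF c, of "\<lambda>v. v $ j"] by (simp add: comp_mult_def)
    then show ?thesis using s[of j] mu by (metis zero_less_mult_pos)
  qed
  then show "interior_pair w" using s by (simp add: w v)
qed

theorem theorem6p3:
  fixes P :: "('n0::finite, 'n1::finite, 'm0::finite, 'm1::finite) two_stage"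
    and A :: params
    and wstar :: "('n0, 'n1, 'm0, 'm1) wpoint"
  assumes "local_assumption P wstar"
  shows "\<exists>\<epsilon>>0. \<exists>\<mu>bar>0.
    \<forall>(sqp :: ('n0, 'n1, 'm0, 'm1) sqp_method) u0 \<mu>0 \<sigma> k l w \<mu>.
      valid_input A \<mu>0 \<and> alg_run P A sqp u0 \<mu>0 \<sigma> \<and> feasibility_assumption P sqp \<sigma> \<and>
      \<sigma> k = Step3 l w \<mu> \<and> dist w wstar \<le> \<epsilon> \<and> \<mu> \<le> \<mu>bar \<and> theta P \<mu> w \<le> cbar A * \<mu>
      \<longrightarrow> (\<exists>ws \<mu>s. ws 0 = w \<and> \<mu>s 0 = \<mu> \<and>
             (\<forall>j. \<sigma> (Suc k + j) = Step4 (l + j) (ws j) (\<mu>s j) \<and>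
                  theta P (\<mu>s j) (ws j) \<le> cbar A * \<mu>s j) \<and>
             converges_superlinearly ws wstar)"
proof (cases "admissible A")
  case False
  then have "\<not> valid_input A \<mu>0" for \<mu>0 by (auto simp: admissible_def valid_input_def)
  then show ?thesis by (auto intro!: exI[of _ "1::real"])
next
  case A: True
  have par: "0 < cmu1 A" "cmu1 A < 1" "1 < cmu2 A" using A by (auto simp: admissible_def)
  obtain xs l0s s0s ys xts s1s l1s e1s where ws0: "wstar = ((xs, l0s, s0s), (ys, xts, s1s, l1s, e1s))"
    by (cases wstar rule: zpart.cases)
  have xts: "xts = xs" and la: "local_assumption P ((xs, l0s, s0s), (ys, xs, s1s, l1s, e1s))"
    using assms by (auto simp: ws0)
  have wstar: "wstar = ((xs, l0s, s0s), (ys, xs, s1s, l1s, e1s))" by (simp add: ws0 xts)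
  have "C2_lipschitz_near (f0 P) xs" "C2_lipschitz_near (\<lambda>(y', x'). f1 P y' x') (ys, xs)"
    "C2_lipschitz_near (c0 P) xs" "C2_lipschitz_near (\<lambda>(y', x'). c1 P y' x') (ys, xs)"
    using la by auto
  then obtain f' f'' c' c'' where
    "C2_data (zobj P) f' f'' (xs, ys, xs, s1s)" "C2_data (zcon P) c' c'' (xs, ys, xs, s1s)"
    by (rule C2_data_zobj_zcon)
  then interpret primal_dual_solution P xs l0s s0s ys s1s l1s e1s f' f'' c' c''
    using la by unfold_locales
  obtain r \<mu>b K \<kappa> where pos: "0 < r" "0 < \<mu>b" "0 < K" "0 < \<kappa>" and step:
    "\<And>w \<mu>. 0 < \<mu> \<Longrightarrow> \<mu> \<le> \<mu>b \<Longrightarrow> norm (w - wstar) < r \<Longrightarrow> interior_pair w \<Longrightarrow> theta P \<mu> w \<le> cbar A * \<mu> \<Longrightarrow>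
       \<exists>d. (\<forall>d'. extrapolation_step P (mu_next A \<mu>) w d' \<longleftrightarrow> d' = d) \<and>
           (\<forall>\<alpha>. is_step_size (tau A \<mu>) w d \<alpha> \<longleftrightarrow> \<alpha> = 1) \<and>
           norm (w + d - wstar) < r \<and> interior_pair (w + d) \<and> theta P (mu_next A \<mu>) (w + d) \<le> cbar A * mu_next A \<mu> \<and>
           norm (w + d - wstar) \<le> K * mu_next A \<mu> \<and> \<kappa> * mu_next A \<mu> \<le> norm (w + d - wstar)"
    unfolding wstar by (rule one_step[OF A]) blast
  have contract: "mu_next A \<mu> \<le> cmu1 A * \<mu>" for \<mu> by (simp add: mu_next_def)
  show ?thesis
  proof (rule exI[of _ "r / 2"], rule conjI[OF half_gt_zero[OF pos(1)]], rule exI[of _ \<mu>b], intro conjI allI impI)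
    show "0 < \<mu>b" by (rule pos(2))
    fix sqp :: "('n0, 'n1, 'm0, 'm1) sqp_method" and u0 \<mu>0 \<sigma> k l w \<mu>
    assume H: "valid_input A \<mu>0 \<and> alg_run P A sqp u0 \<mu>0 \<sigma> \<and> feasibility_assumption P sqp \<sigma> \<and>
      \<sigma> k = Step3 l w \<mu> \<and> dist w wstar \<le> r / 2 \<and> \<mu> \<le> \<mu>b \<and> theta P \<mu> w \<le> cbar A * \<mu>"
    then have run: "alg_run P A sqp u0 \<mu>0 \<sigma>" by blast
    have start: "interior_pair w" "\<sigma> (Suc k) = Step4 l w \<mu>" "0 < \<mu>"
      using Step3_interior[of A \<mu>0 P sqp u0 \<sigma> k l w \<mu>] H by blast+
    \<comment> \<open>The local estimates determine the next configuration, so a run that is here once is here forever.\<close>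
    define inv where "inv n v \<nu> \<longleftrightarrow> \<sigma> (Suc k + n) = Step4 (l + n) v \<nu> \<and> 0 < \<nu> \<and> \<nu> \<le> \<mu>b \<and>
      norm (v - wstar) < r \<and> interior_pair v \<and> theta P \<nu> v \<le> cbar A * \<nu>" for n v \<nu>
    have inv0: "inv 0 w \<mu>" using H start pos(1) unfolding inv_def by (simp add: dist_norm)
    have next_inv: "\<exists>v'. inv (Suc n) v' (mu_next A \<nu>) \<and> norm (v' - wstar) \<le> K * mu_next A \<nu> \<and>
        \<kappa> * mu_next A \<nu> \<le> norm (v' - wstar)" if i: "inv n v \<nu>" for n v \<nu>
    proof -
      have \<nu>: "0 < \<nu>" "\<nu> \<le> \<mu>b" and s4: "\<sigma> (Suc k + n) = Step4 (l + n) v \<nu>" and th: "theta P \<nu> v \<le> cbar A * \<nu>"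
        using i by (auto simp: inv_def)
      obtain d where d: "\<And>d'. extrapolation_step P (mu_next A \<nu>) v d' \<longleftrightarrow> d' = d" "\<And>\<alpha>. is_step_size (tau A \<nu>) v d \<alpha> \<longleftrightarrow> \<alpha> = 1"
        "norm (v + d - wstar) < r" "interior_pair (v + d)" "theta P (mu_next A \<nu>) (v + d) \<le> cbar A * mu_next A \<nu>"
        "norm (v + d - wstar) \<le> K * mu_next A \<nu>" "\<kappa> * mu_next A \<nu> \<le> norm (v + d - wstar)"
        using step[of \<nu> v] i unfolding inv_def by blast
      have "alg_step P A sqp (\<sigma> (Suc k + n)) (Step4 (Suc (l + n)) (v + 1 *\<^sub>R d) (mu_next A \<nu>))"
        unfolding s4 by (rule alg_step.loop[OF th]) (use d(1,2) in auto)
      then have "alg_step P A sqp (Step4 (l + n) v \<nu>) (\<sigma> (Suc (Suc k + n)))"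
        using run_not_stuck[OF run] s4 by metis
      then have "\<sigma> (Suc (Suc k + n)) = Step4 (Suc (l + n)) (v + d) (mu_next A \<nu>)"
        by (rule Step4_stepE) (use th d(1,2) in auto)
      moreover have "mu_next A \<nu> \<le> \<nu>"
        using order_trans[OF contract[of \<nu>] mult_right_mono[of "cmu1 A" 1 \<nu>]] par \<nu> by simp
      ultimately have "inv (Suc n) (v + d) (mu_next A \<nu>)"
        using d(3-5) mu_next_pos[OF par(1) \<nu>(1)] \<nu> unfolding inv_def by simp
      then show ?thesis using d(6,7) by blast
    qed
    have "\<exists>v \<nu>. inv n v \<nu>" for n
      by (induction n) (use inv0 next_inv in blast)+
    then obtain ws \<mu>s where inv: "\<And>n. inv n (ws n) (\<mu>s n)" by metis
    have unique: "v = ws n \<and> \<nu> = \<mu>s n" if "inv n v \<nu>" for n v \<nu>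
      using that inv[of n] unfolding inv_def by simp
    have rec: "\<mu>s (Suc n) = mu_next A (\<mu>s n)" "norm (ws (Suc n) - wstar) \<le> K * \<mu>s (Suc n)"
      "\<kappa> * \<mu>s (Suc n) \<le> norm (ws (Suc n) - wstar)" for n
      using next_inv[OF inv[of n]] unique[of "Suc n"] by metis+
    have \<mu>s_pos: "0 < \<mu>s n" for n using inv[of n] by (simp add: inv_def)
    have \<mu>s_bound: "\<mu>s n \<le> cmu1 A ^ n * \<mu>s 0" for n
    proof (induction n)
      case (Suc n)
      have "\<mu>s (Suc n) \<le> cmu1 A * \<mu>s n" unfolding rec(1) by (rule contract)
      also have "\<dots> \<le> cmu1 A * (cmu1 A ^ n * \<mu>s 0)" using Suc par by (intro mult_left_mono) auto
      finally show ?case by (simp add: mult.assoc)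
    qed simp
    have \<mu>s_lim: "\<mu>s \<longlonglongrightarrow> 0"
    proof (rule Lim_null_comparison)
      show "\<forall>\<^sub>F n in sequentially. norm (\<mu>s n) \<le> cmu1 A ^ n * \<mu>s 0"
        using \<mu>s_bound \<mu>s_pos by (intro always_eventually) (simp add: less_imp_le)
      have "(\<lambda>n. cmu1 A ^ n * \<mu>s 0) \<longlonglongrightarrow> 0 * \<mu>s 0"
        using par by (intro tendsto_intros LIMSEQ_power_zero) auto
      then show "(\<lambda>n. cmu1 A ^ n * \<mu>s 0) \<longlonglongrightarrow> 0" by simp
    qed
    have "ws \<longlonglongrightarrow> wstar"
    proof (rule LIMSEQ_imp_Suc, rule LIM_zero_cancel, rule Lim_null_comparison)
      show "\<forall>\<^sub>F n in sequentially. norm (ws (Suc n) - wstar) \<le> K * \<mu>s (Suc n)"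
        using rec(2) by (intro always_eventually) blast
      have "(\<lambda>n. K * \<mu>s (Suc n)) \<longlonglongrightarrow> K * 0" by (intro tendsto_intros LIMSEQ_Suc \<mu>s_lim)
      then show "(\<lambda>n. K * \<mu>s (Suc n)) \<longlonglongrightarrow> 0" by simp
    qed
    moreover have "(\<lambda>n. dist (ws (Suc n)) wstar) \<in> o(\<lambda>n. dist (ws n) wstar)"
    proof (rule landau_o.smallI)
      fix c :: real assume c: "0 < c"
      have "0 < c * \<kappa> / K" using c pos by simp
      then obtain m where m: "0 < m" "\<And>\<nu>. 0 < \<nu> \<Longrightarrow> \<nu> \<le> m \<Longrightarrow> mu_next A \<nu> \<le> c * \<kappa> / K * \<nu>"
        using mu_next_small[OF par(3)] by blast
      have "\<forall>\<^sub>F n in sequentially. \<mu>s n < m" by (rule order_tendstoD(2)[OF \<mu>s_lim m(1)])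
      with eventually_gt_at_top[of 0] show "\<forall>\<^sub>F n in sequentially. norm (dist (ws (Suc n)) wstar) \<le> c * norm (dist (ws n) wstar)"
      proof eventually_elim
        case (elim n)
        \<comment> \<open>The lower bound on the distance is available only after a first extrapolation step.\<close>
        obtain n' where n': "n = Suc n'" using elim(1) by (cases n) auto
        have "norm (ws (Suc n) - wstar) \<le> K * \<mu>s (Suc n)" by (rule rec(2))
        also have "\<dots> \<le> K * (c * \<kappa> / K * \<mu>s n)"
          unfolding rec(1)[of n] using m(2)[OF \<mu>s_pos, of n] elim(2) pos by (intro mult_left_mono) auto
        also have "\<dots> = c * (\<kappa> * \<mu>s n)" using pos by simp
        also have "\<dots> \<le> c * norm (ws n - wstar)" using rec(3)[of n'] c unfolding n' by (intro mult_left_mono) auto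
        finally show ?case by (simp add: dist_norm)
      qed
    qed
    ultimately have "converges_superlinearly ws wstar" by (simp add: converges_superlinearly_def)
    moreover have "ws 0 = w" "\<mu>s 0 = \<mu>" using unique[OF inv0] by auto
    ultimately show "\<exists>ws \<mu>s. ws 0 = w \<and> \<mu>s 0 = \<mu> \<and>
             (\<forall>j. \<sigma> (Suc k + j) = Step4 (l + j) (ws j) (\<mu>s j) \<and>
                  theta P (\<mu>s j) (ws j) \<le> cbar A * \<mu>s j) \<and>
             converges_superlinearly ws wstar"
      using inv unfolding inv_def by blast
  qed
qed

end
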